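(* Let $N\ge2$, $1\le p<\infty$, let $T_1=T_{f_1,w_1},\dots,T_N=T_{f_N,w_N}$ be unilateral pseudo-shifts on $\ell^p(\mathbb{N})$, and let $\mathcal{A}$ be one of the families $\mathcal{A}_{uBd}$, $\mathcal{A}_{ud}$, $\mathcal{A}_{ld}$. If $\mathcal{A}$ is $(f_s)_{s=1}^N$-weakly partition regular, then $T_1,\dots,T_N$ are disjoint $\mathcal{A}$-hypercyclic if and only if there exist sets $A_k\in\mathcal{A}$, $k\ge1$, and a sequence $(\varepsilon_k)_{k\ge1}$ of positive real numbers tending to $0$ such that: (1) for any $j\ge1$ and any $s\in[N]$, $\sum_{n\ge1}\frac{1}{|W^s_{j,n}|^p}<\infty$; (2) for any $1\le j\le l$, any $k\ge1$, any $n\in A_k$, any $s\ne t\in[N]$, $$\sum_{m\in A_l\setminus\{n\}:\ f_t^m(j)\in f_s^n((k,+\infty))}\frac{|W^s_{f_s^{-n}(f_t^m(j)),n}|^p}{|W^t_{j,m}|^p}\le\varepsilon_l;$$ (3) for any $1\le j\le k<l$, any $n\in A_l$, any $s\ne t\in[N]$, $$\sum_{m\in A_k:\ f_t^m(j)\in f_s^n((l,+\infty))}\frac{|W^s_{f_s^{-n}(f_t^m(j)),n}|^p}{|W^t_{j,m}|^p}\le\varepsilon_l;$$ (4) for any $l\ge1$, any scalars $(a_{s,j})_{s\in[N],j\in[l]}$ with all $a_{s,j}\ne0$, and any $\varepsilon>0$, there exists $L\ge l$ such that for any $s\ne t\in[N]$ and any $n\in A_L$: (a) for any $j\in f_t^n([l])\cap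 f_s^n([l])$, $\left|\frac{W^s_{f_s^{-n}(j),n}}{W^t_{f_t^{-n}(j),n}}-\frac{a_{s,f_s^{-n}(j)}}{a_{t,f_t^{-n}(j)}}\right|\le\varepsilon$; (b) for any $j\in f_t^n([l])\cap f_s^n((l,\infty))$, $\frac{|W^s_{f_s^{-n}(j),n}|}{|W^t_{f_t^{-n}(j),n}|}\le\varepsilon$. Here $W^s_{l,n}=\prod_{m=1}^nw_{s,f_s^m(l)}$ for all $s\in[N]$.
   Context: $\mathbb{N}=\{1,2,\dots\}$, $[l]=\{1,\dots,l\}$, $(l,\infty)$ denotes the integers $>l$; spaces are over $\mathbb{K}=\mathbb{R}$ or $\mathbb{C}$ with canonical basis $(e_j)_{j\ge1}$. $f^n$ is the $n$-th iterate of $f$ and, for injective $f$, $f^{-n}$ is the inverse of $f^n$ on its range. Pseudo-shift: for a bounded weight sequence of scalars $w=(w_j)_{j\in\mathbb{N}}$ and a strictly increasing $f:\mathbb{N}\to\mathbb{N}$ with $f(1)>1$, $T_{f,w}\big(\sum_{j\ge1}x_je_j\big)=\sum_{j\ge1}w_{f(j)}x_{f(j)}e_j$. We write $w_s=(w_{s,j})_{j\in\mathbb{N}}$. For $A\subset\mathbb{N}$: $\underline{\mathrm{dens}}\,A=\liminf_{M\to\infty}\frac{\mathrm{card}\{n\le M:n\in A\}}{M}$, $\overline{\mathrm{dens}}\,A=\limsup_{M\to\infty}\frac{\mathrm{card}\{n\le M:n\in A\}}{M}$, $\overline{\mathrm{Bd}}\,A=\limsup_{M\to\infty}\max_{k\ge1}\frac{\mathrm{card}(A\cap\{k+1,\dots,k+M\})}{M}$.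 $\mathcal{A}_{uBd},\mathcal{A}_{ud},\mathcal{A}_{ld}$ are the families of subsets of $\mathbb{N}$ of positive upper Banach density, positive upper density, positive lower density, respectively. $T_1,\dots,T_N$ are disjoint $\mathcal{A}$-hypercyclic if there is $x\in X$ (here $X=\ell^p(\mathbb{N})$) such that for all non-empty open $V_1,\dots,V_N\subset X$, $\{n:T_s^nx\in V_s\text{ for all }s\in[N]\}\in\mathcal{A}$. $\mathcal{A}$ is $(f_s)_{s=1}^N$-weakly partition regular if for any sequence $(B_l)_{l\ge1}\subset\mathcal{A}$ there is a sequence $(A_l)_{l\ge1}\subset\mathcal{A}$ such that $A_l\subseteq B_l$ for every $l\ge1$, and for every $l,k\ge1$, $f_s^m([l])\cap f_t^n([k])=\emptyset$ for all $m\in A_l$, $n\in A_k$ with $m\ne n$ and all $s,t\in[N]$. Convention: $1/0=+\infty$, so condition (1) includes the requirement that all $W^s_{j,n}$ are nonzero. *)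

theory Defs
  imports "HOL-Analysis.Analysis"
begin

text \<open>
  The index set is \<open>{1, 2, \<dots>}\<close>, represented inside \<^typ>\<open>nat\<close>. A scalar sequence
  \<open>(x\<^sub>j)\<close> with \<open>j \<ge> 1\<close> is a function on \<^typ>\<open>nat\<close>; membership in the sequence space
  pins its value at the dummy index \<open>0\<close> to \<open>0\<close>. Maps \<open>f\<close> and weights are only ever
  constrained on, and evaluated at, positive arguments.

  The scalar sort \<open>{real_normed_field, euclidean_space}\<close> stands for the real or complex numbers:
  both types are instances, and a finite-dimensional real field with multiplicative norm is
  isometrically isomorphic to one of them.
\<close>

definition lp :: "real \<Rightarrow> (nat \<Rightarrow> 'a::real_normed_field) set" where
  "lp p = {x. x 0 = 0 \<and> summable (\<lambda>j. norm (x j) powr p)}"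

definition lp_norm :: "real \<Rightarrow> (nat \<Rightarrow> 'a::real_normed_field) \<Rightarrow> real" where
  "lp_norm p x = (\<Sum>j. norm (x j) powr p) powr (1 / p)"

definition lp_dist :: "real \<Rightarrow> (nat \<Rightarrow> 'a::real_normed_field) \<Rightarrow> (nat \<Rightarrow> 'a) \<Rightarrow> real" where
  "lp_dist p x y = lp_norm p (\<lambda>j. x j - y j)"

definition lp_topology :: "real \<Rightarrow> (nat \<Rightarrow> 'a::real_normed_field) topology" where
  "lp_topology p = Metric_space.mtopology (lp p) (lp_dist p)"

definition pseudo_shift_data :: "(nat \<Rightarrow> nat) \<Rightarrow> (nat \<Rightarrow> 'a::real_normed_field) \<Rightarrow> bool" where
  "pseudo_shift_data f w \<longleftrightarrow> strict_mono_on {1..} f \<and> f 1 > 1 \<and> bounded (w ` {1..})"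

definition pseudo_shift ::
  "(nat \<Rightarrow> nat) \<Rightarrow> (nat \<Rightarrow> 'a::real_normed_field) \<Rightarrow> (nat \<Rightarrow> 'a) \<Rightarrow> (nat \<Rightarrow> 'a)" where
  "pseudo_shift f w x = (\<lambda>j. if j = 0 then 0 else w (f j) * x (f j))"

text \<open>\<open>W\<^sub>l\<^sub>,\<^sub>n\<close> for the pseudo-shift with data \<open>f\<close>, \<open>w\<close>.\<close>

definition weight_prod :: "(nat \<Rightarrow> nat) \<Rightarrow> (nat \<Rightarrow> 'a::real_normed_field) \<Rightarrow> nat \<Rightarrow> nat \<Rightarrow> 'a" where
  "weight_prod f w l n = (\<Prod>m=1..n. w ((f ^^ m) l))"

text \<open>\<open>f\<^sup>-\<^sup>n(i)\<close>, meaningful for \<open>i\<close> in the range \<open>f\<^sup>n({1, 2, \<dots>})\<close>.\<close>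

definition iter_inv :: "(nat \<Rightarrow> nat) \<Rightarrow> nat \<Rightarrow> nat \<Rightarrow> nat" where
  "iter_inv f n i = inv_into {1..} (f ^^ n) i"

definition lower_density :: "nat set \<Rightarrow> ereal" where
  "lower_density A = liminf (\<lambda>M. ereal (real (card {n \<in> A. 1 \<le> n \<and> n \<le> M}) / real M))"

definition upper_density :: "nat set \<Rightarrow> ereal" where
  "upper_density A = limsup (\<lambda>M. ereal (real (card {n \<in> A. 1 \<le> n \<and> n \<le> M}) / real M))"

text \<open>The supremum over \<open>k\<close> is attained, the cardinalities being natural numbers bounded by \<open>M\<close>.\<close>

definition upper_Banach_density :: "nat set \<Rightarrow> ereal" where
  "upper_Banach_density A =
     limsup (\<lambda>M. SUP k\<in>{1..}. ereal (real (card (A \<inter> {k+1..k+M})) / real M))"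

definition fam_uBd :: "nat set set" where
  "fam_uBd = {A. A \<subseteq> {1..} \<and> upper_Banach_density A > 0}"

definition fam_ud :: "nat set set" where
  "fam_ud = {A. A \<subseteq> {1..} \<and> upper_density A > 0}"

definition fam_ld :: "nat set set" where
  "fam_ld = {A. A \<subseteq> {1..} \<and> lower_density A > 0}"

definition disjoint_hypercyclic ::
  "'b topology \<Rightarrow> nat set set \<Rightarrow> nat \<Rightarrow> (nat \<Rightarrow> 'b \<Rightarrow> 'b) \<Rightarrow> bool" where
  "disjoint_hypercyclic X \<A> N T \<longleftrightarrow>
     (\<exists>x \<in> topspace X. \<forall>V. (\<forall>s\<in>{1..N}. openin X (V s) \<and> V s \<noteq> {}) \<longrightarrow>
        {n. n \<ge> 1 \<and> (\<forall>s\<in>{1..N}. (T s ^^ n) x \<in> V s)} \<in> \<A>)"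

definition weakly_partition_regular ::
  "nat set set \<Rightarrow> nat \<Rightarrow> (nat \<Rightarrow> nat \<Rightarrow> nat) \<Rightarrow> bool" where
  "weakly_partition_regular \<A> N f \<longleftrightarrow>
     (\<forall>B. (\<forall>l\<ge>1. B l \<in> \<A>) \<longrightarrow>
        (\<exists>A. (\<forall>l\<ge>1. A l \<in> \<A> \<and> A l \<subseteq> B l) \<and>
             (\<forall>l\<ge>1. \<forall>k\<ge>1. \<forall>m\<in>A l. \<forall>n\<in>A k. m \<noteq> n \<longrightarrow>
                (\<forall>s\<in>{1..N}. \<forall>t\<in>{1..N}. (f s ^^ m) ` {1..l} \<inter> (f t ^^ n) ` {1..k} = {}))))"

lemma lp_sum_bound:
  fixes x y :: "nat \<Rightarrow> 'a::real_normed_field"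
  assumes p: "p \<ge> 1" and x: "x \<in> lp p" and y: "y \<in> lp p"
  shows "(\<lambda>j. x j + y j) \<in> lp p \<and> lp_norm p (\<lambda>j. x j + y j) \<le> lp_norm p x + lp_norm p y"
proof -
  define S where "S = (\<lambda>x::nat \<Rightarrow> 'a. \<Sum>j. norm (x j) powr p)"
  have sm: "summable (\<lambda>j. norm (x j) powr p)" "summable (\<lambda>j. norm (y j) powr p)"
    and x0: "x 0 = 0" "y 0 = 0"
    using x y by (auto simp: lp_def)
  have S0: "S z \<ge> 0" if "summable (\<lambda>j. norm (z j) powr p)" for z
    unfolding S_def using that by (intro suminf_nonneg) auto
  have null: "z = (\<lambda>_. 0)" if "summable (\<lambda>j. norm (z j) powr p)" "S z = 0" for z
    using suminf_eq_zero_iff[OF that(1)] that(2) unfolding S_def by (auto simp: fun_eq_iff)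
  show ?thesis
  proof (cases "S x = 0 \<or> S y = 0")
    case True
    then consider "x = (\<lambda>_. 0)" | "y = (\<lambda>_. 0)" using null sm by blast
    then show ?thesis
      by cases (use x y in \<open>auto simp: lp_norm_def lp_def\<close>)
  next
    case False
    then have pos: "S x > 0" "S y > 0" using S0 sm by (auto simp: less_le)
    define a where "a = lp_norm p x"
    define b where "b = lp_norm p y"
    have ab: "a > 0" "b > 0" using pos by (auto simp: a_def b_def lp_norm_def S_def)
    have apow: "a powr p = S x" "b powr p = S y"
      using p pos by (auto simp: a_def b_def lp_norm_def S_def powr_powr)
    have conv: "((1 - u) * r + u * s) powr p \<le> (1 - u) * r powr p + u * s powr p"
      if "r \<ge> 0" "s \<ge> 0" "0 < u" "u < 1" for r s u :: real
    proof (cases "r = 0 \<or> s = 0")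
      case True
      have le: "v powr p \<le> v" if "0 < v" "v < 1" for v :: real
        using powr_mono'[of 1 p v] that p by simp
      from True show ?thesis
        using that le[of u] le[of "1-u"] p
        by (auto simp: powr_mult intro!: mult_right_mono)
    next
      case False
      then show ?thesis
        using convex_onD[OF powr_convex[OF p], of u r s] that by (simp add: algebra_simps)
    qed
    define u where "u = b / (a + b)"
    have u: "0 < u" "u < 1" "1 - u = a / (a + b)" using ab by (auto simp: u_def field_simps)
    define g where
      "g = (\<lambda>j. (a+b) powr p * ((1-u) * (norm (x j) powr p / S x) + u * (norm (y j) powr p / S y)))"
    have bound: "norm (x j + y j) powr p \<le> g j" for j
    proof -
      have eq: "norm (x j) + norm (y j) = (a+b) * ((1-u) * (norm (x j) / a) + u * (norm (y j) / b))"
      proof -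
        have "(1-u) * (norm (x j) / a) = norm (x j) / (a+b)" "u * (norm (y j) / b) = norm (y j) / (a+b)"
          using ab unfolding u(3) by (simp_all add: u_def)
        moreover have "(a+b) * (v / (a+b) + v' / (a+b)) = v + v'" for v v' :: real
          using ab by (simp flip: add_divide_distrib)
        ultimately show ?thesis by metis
      qed
      have "norm (x j + y j) powr p \<le> (norm (x j) + norm (y j)) powr p"
        using p by (intro powr_mono2) (auto intro: norm_triangle_ineq)
      also have "\<dots> = (a+b) powr p * ((1-u) * (norm (x j) / a) + u * (norm (y j) / b)) powr p"
        unfolding eq using ab u by (intro powr_mult) 
      also have "\<dots> \<le> (a+b) powr p *
          ((1-u) * (norm (x j) / a) powr p + u * (norm (y j) / b) powr p)"
        using ab u by (intro mult_left_mono conv) auto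
      also have "\<dots> = g j"
        using ab by (simp add: g_def powr_divide apow)
      finally show ?thesis .
    qed
    have gs: "g sums ((a+b) powr p * ((1-u) * (S x / S x) + u * (S y / S y)))"
      unfolding g_def S_def using sm
      by (intro sums_mult sums_add sums_divide summable_sums)
    then have gs: "g sums ((a+b) powr p)" using pos by simp
    have sxy: "summable (\<lambda>j. norm (x j + y j) powr p)"
      by (rule summable_comparison_test'[OF sums_summable[OF gs], of 0]) (simp add: bound)
    have "S (\<lambda>j. x j + y j) \<le> (a+b) powr p"
      unfolding S_def sums_unique[OF gs] by (rule suminf_le[OF bound sxy sums_summable[OF gs]])
    then have "S (\<lambda>j. x j + y j) powr (1/p) \<le> ((a+b) powr p) powr (1/p)"
      using p S0[OF sxy] by (intro powr_mono2) auto
    also have "\<dots> = a + b" using p ab by (simp add: powr_powr)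
    finally show ?thesis using sxy x0 by (auto simp: lp_def lp_norm_def S_def a_def b_def)
  qed
qed

lemma Metric_space_lp:
  assumes p: "p \<ge> 1"
  shows "Metric_space (lp p) (lp_dist p :: (nat \<Rightarrow> 'a::real_normed_field) \<Rightarrow> _)"
proof
  fix x y z :: "nat \<Rightarrow> 'a"
  have diff: "(\<lambda>j. x j - y j) \<in> lp p" if "x \<in> lp p" "y \<in> lp p" for x y :: "nat \<Rightarrow> 'a"
    using lp_sum_bound[OF p that(1), of "\<lambda>j. - y j"] that(2) by (auto simp: lp_def)
  show "0 \<le> lp_dist p x y" by (simp add: lp_dist_def lp_norm_def)
  show "lp_dist p x y = lp_dist p y x" by (simp add: lp_dist_def lp_norm_def norm_minus_commute)
  show "lp_dist p x y = 0 \<longleftrightarrow> x = y" if "x \<in> lp p" "y \<in> lp p"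
    using diff[OF that] suminf_eq_zero_iff[of "\<lambda>j. norm (x j - y j) powr p"]
    by (auto simp: lp_dist_def lp_norm_def lp_def fun_eq_iff)
  show "lp_dist p x z \<le> lp_dist p x y + lp_dist p y z"
    if "x \<in> lp p" "y \<in> lp p" "z \<in> lp p"
    using lp_sum_bound[OF p diff[OF that(1,2)] diff[OF that(2,3)]] by (simp add: lp_dist_def)
qed

end

theory Submission
  imports Defs
begin

text \<open>
  The \<open>j\<close>-th entry of \<open>T\<^sub>s\<^sup>n x\<close> is \<open>W s j n * x (f\<^sub>s\<^sup>n(j))\<close>, so the orbits of a single vector under
  all the pseudo-shifts are governed by the values of that vector at the sites \<open>f\<^sub>s\<^sup>n(j)\<close>. Two
  pseudo-shifts interact exactly where their sites coincide, and there the quotients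
  \<open>W s i n / W t j m\<close> appear.

  Necessity. Let \<open>x\<close> be disjoint hypercyclic. If \<open>B\<close> is the set of times at which \<open>T\<^sub>s\<^sup>n x\<close> is close to
  the \<open>j\<close>-th unit vector, then for every \<open>n\<close> in \<open>B\<close> the sum of \<open>1 / |W s j k|\<^sup>p\<close> over the \<open>k\<close> with
  \<open>n + k\<close> in \<open>B\<close> is bounded by a constant. Consecutive terms are comparable because the weights are
  bounded, and a double count based on the positive upper Banach density of \<open>B\<close> upgrades this to
  the summability of the whole series (\<open>summable_of_recurrence\<close>). For the remaining conditions,
  \<open>A L\<close> is the set of times at which all orbits are close to a target whose entries are of size at
  least \<open>L\<close> on \<open>[L]\<close> and vanish beyond \<open>L\<close>. The cross sums then compare a small tail of one orbit with
  large entries of another. The ratio condition involves only quotients of target entries, so the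
  targets may run through large multiples of a countable dense family of arrays
  (\<open>conditions_if_disjoint_hypercyclic\<close>).

  Sufficiency. Weak partition regularity, applied to translates of the given sets and then once more,
  makes these sets disjoint, with large gaps, and with disjoint sets of sites at different times
  (\<open>scattered_refinement\<close>). A recurring sequence of arrays \<open>a q\<close> and indices \<open>L q\<close>, growing rapidly,
  is chosen, and \<open>x\<close> gets the value \<open>a q t j / W t j m\<close> at the site \<open>f\<^sub>t\<^sup>m(j)\<close>, for every \<open>m\<close> in
  \<open>A (L q)\<close>. At a time \<open>n\<close> in \<open>A (L q)\<close> the entries placed for time \<open>n\<close> reproduce the array \<open>a q\<close> up
  to the error in the ratio condition. Entries placed for another time \<open>m\<close> contribute a cross sum when
  they come from a different pseudo-shift; when they come from the same one, the quotient of weight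
  products telescopes to \<open>1 / W s j (m - n)\<close> with a large \<open>m - n\<close>, and these contributions form a tail
  of the summable series. The total error in the \<open>p\<close>-th power is at most \<open>3 / 2\<^sup>q\<close>
  (\<open>orbit_near_target\<close>).

  Nonnegative series are handled through their finite partial sums throughout; the statement with
  extended real sums is recovered at the very end.
\<close>

section \<open>Stability of the density families\<close>

text \<open>
  A discrepancy of at most \<open>c\<close> between window counts disappears after division by the length of the
  window, so none of the three densities sees it.
\<close>

lemma densities_le_of_windows:
  fixes A B :: "nat set"
  assumes le: "\<And>k M. card (A \<inter> {k+1..k+M}) \<le> card (B \<inter> {k+1..k+M}) + c"
  shows "lower_density A \<le> lower_density B" "upper_density A \<le> upper_density B"
    "upper_Banach_density A \<le> upper_Banach_density B"
proof -
  have lim: "(\<lambda>M. ereal (real c / real M)) \<longlonglongrightarrow> 0"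
    using lim_const_over_n[of "real c"] by (simp add: zero_ereal_def)
  have le': "real (card (A \<inter> {k+1..k+M})) / real M \<le> real (card (B \<inter> {k+1..k+M})) / real M + real c / real M" for k M
  proof -
    have "real (card (A \<inter> {k+1..k+M})) \<le> real (card (B \<inter> {k+1..k+M})) + real c"
      using le[of k M] by linarith
    then show ?thesis by (simp add: divide_right_mono flip: add_divide_distrib)
  qed
  have ini: "{n \<in> X. 1 \<le> n \<and> n \<le> M} = X \<inter> {0+1..0+M}" for X and M :: nat by auto
  have pt: "ereal (real (card {n \<in> A. 1 \<le> n \<and> n \<le> M}) / real M)
     \<le> ereal (real c / real M) + ereal (real (card {n \<in> B. 1 \<le> n \<and> n \<le> M}) / real M)" for M
    using le'[of 0 M] unfolding ini by simp
  have sup: "(SUP k\<in>{1..}. ereal (real (card (A \<inter> {k+1..k+M})) / real M)) \<le>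
       ereal (real c / real M) + (SUP k\<in>{1..}. ereal (real (card (B \<inter> {k+1..k+M})) / real M))" for M
  proof (rule SUP_least)
    fix k :: nat assume k: "k \<in> {1..}"
    have "ereal (real (card (A \<inter> {k+1..k+M})) / real M) \<le> ereal (real c / real M) + ereal (real (card (B \<inter> {k+1..k+M})) / real M)"
      using le'[of k M] by simp
    also have "\<dots> \<le> ereal (real c / real M) + (SUP k\<in>{1..}. ereal (real (card (B \<inter> {k+1..k+M})) / real M))"
      by (intro add_left_mono SUP_upper[OF k])
    finally show "ereal (real (card (A \<inter> {k+1..k+M})) / real M) \<le> \<dots>" .
  qed
  show "upper_density A \<le> upper_density B"
  proof -
    have "upper_density A \<le> limsup (\<lambda>M. ereal (real c / real M) + ereal (real (card {n \<in> B. 1 \<le> n \<and> n \<le> M}) / real M))"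
      unfolding upper_density_def by (intro Limsup_mono always_eventually allI pt)
    also have "\<dots> = upper_density B"
      unfolding upper_density_def by (subst ereal_limsup_lim_add[OF lim]) auto
    finally show ?thesis .
  qed
  show "lower_density A \<le> lower_density B"
  proof -
    have "lower_density A \<le> liminf (\<lambda>M. ereal (real c / real M) + ereal (real (card {n \<in> B. 1 \<le> n \<and> n \<le> M}) / real M))"
      unfolding lower_density_def by (intro Liminf_mono always_eventually allI pt)
    also have "\<dots> = lower_density B"
      unfolding lower_density_def by (subst ereal_liminf_lim_add[OF lim]) auto
    finally show ?thesis .
  qed
  show "upper_Banach_density A \<le> upper_Banach_density B"
  proof -
    have "upper_Banach_density A \<le> limsup (\<lambda>M. ereal (real c / real M) + (SUP k\<in>{1..}. ereal (real (card (B \<inter> {k+1..k+M})) / real M)))"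
      unfolding upper_Banach_density_def by (intro Limsup_mono always_eventually allI sup)
    also have "\<dots> = upper_Banach_density B"
      unfolding upper_Banach_density_def by (subst ereal_limsup_lim_add[OF lim]) auto
    finally show ?thesis .
  qed
qed

text \<open>
  Passing to supersets or translates and deleting an initial segment change window counts by a
  bounded amount only; this lemma therefore covers every modification of sets needed below.
\<close>

lemma family_window:
  assumes "\<A> \<in> {fam_uBd, fam_ud, fam_ld}" and "A \<in> \<A>" and "B \<subseteq> {1..}"
    and le: "\<And>k M. card (A \<inter> {k+1..k+M}) \<le> card (B \<inter> {k+1..k+M}) + c"
  shows "B \<in> \<A>"
  using assms(1-3) densities_le_of_windows[of A B c, OF le]
  by (auto simp: fam_uBd_def fam_ud_def fam_ld_def)

lemma family_pos: "\<A> \<in> {fam_uBd, fam_ud, fam_ld} \<Longrightarrow> A \<in> \<A> \<Longrightarrow> A \<subseteq> {1..}"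
  by (auto simp: fam_uBd_def fam_ud_def fam_ld_def)

lemma family_superset:
  assumes "\<A> \<in> {fam_uBd, fam_ud, fam_ld}" "A \<in> \<A>" "A \<subseteq> B" "B \<subseteq> {1..}"
  shows "B \<in> \<A>"
proof (rule family_window[OF assms(1,2,4), of 0])
  fix k M show "card (A \<inter> {k+1..k+M}) \<le> card (B \<inter> {k+1..k+M}) + 0"
    using assms(3) by (auto intro!: card_mono)
qed

lemma family_shift_down:
  assumes "\<A> \<in> {fam_uBd, fam_ud, fam_ld}" "A \<in> \<A>"
  shows "{n. 1 \<le> n \<and> n + c \<in> A} \<in> \<A>"
proof (rule family_window[OF assms, of _ c])
  fix k M
  let ?B = "{n. 1 \<le> n \<and> n + c \<in> A} \<inter> {k+1..k+M}"
  have "A \<inter> {k+1..k+M} \<subseteq> (\<lambda>n. n + c) ` ?B \<union> {k+1..k+c}"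
  proof
    fix n assume n: "n \<in> A \<inter> {k+1..k+M}"
    show "n \<in> (\<lambda>n. n + c) ` ?B \<union> {k+1..k+c}"
    proof (cases "n \<le> k + c")
      case False
      then show ?thesis using n by (intro UnI1 image_eqI[of _ _ "n - c"]) auto
    qed (use n in auto)
  qed
  then have "card (A \<inter> {k+1..k+M}) \<le> card ((\<lambda>n. n + c) ` ?B \<union> {k+1..k+c})"
    by (intro card_mono) auto
  also have "\<dots> \<le> card ((\<lambda>n. n + c) ` ?B) + card {k+1..k+c}" by (rule card_Un_le)
  also have "\<dots> \<le> card ?B + c" by (intro add_mono card_image_le) auto
  finally show "card (A \<inter> {k+1..k+M}) \<le> card ?B + c" .
qed auto

lemma family_shift_up:
  assumes "\<A> \<in> {fam_uBd, fam_ud, fam_ld}" "A \<in> \<A>"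
  shows "(\<lambda>n. n + c) ` A \<in> \<A>"
proof (rule family_window[OF assms, of _ c])
  show "(\<lambda>n. n + c) ` A \<subseteq> {1..}" using family_pos[OF assms] by auto
  fix k M
  let ?B = "(\<lambda>n. n + c) ` A \<inter> {k+1..k+M}"
  have "A \<inter> {k+1..k+M} \<subseteq> (\<lambda>n. n - c) ` ?B \<union> {k+M-c+1..k+M}"
  proof
    fix n assume n: "n \<in> A \<inter> {k+1..k+M}"
    show "n \<in> (\<lambda>n. n - c) ` ?B \<union> {k+M-c+1..k+M}"
    proof (cases "n + c \<le> k + M")
      case True
      then show ?thesis using n by (intro UnI1 image_eqI[of _ _ "n + c"]) auto
    qed (use n in auto)
  qed
  then have "card (A \<inter> {k+1..k+M}) \<le> card ((\<lambda>n. n - c) ` ?B \<union> {k+M-c+1..k+M})"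
    by (intro card_mono) auto
  also have "\<dots> \<le> card ((\<lambda>n. n - c) ` ?B) + card {k+M-c+1..k+M}" by (rule card_Un_le)
  also have "\<dots> \<le> card ?B + c" by (intro add_mono card_image_le) auto
  finally show "card (A \<inter> {k+1..k+M}) \<le> card ?B + c" .
qed

lemma family_tail:
  assumes "\<A> \<in> {fam_uBd, fam_ud, fam_ld}" "A \<in> \<A>"
  shows "A \<inter> {c..} \<in> \<A>"
proof (rule family_window[OF assms, of _ c])
  show "A \<inter> {c..} \<subseteq> {1..}" using family_pos[OF assms] by auto
  fix k M
  have "card (A \<inter> {k+1..k+M}) \<le> card (A \<inter> {c..} \<inter> {k+1..k+M} \<union> {..<c})"
    by (intro card_mono) auto
  also have "\<dots> \<le> card (A \<inter> {c..} \<inter> {k+1..k+M}) + card {..<c}" by (rule card_Un_le)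
  finally show "card (A \<inter> {k+1..k+M}) \<le> card (A \<inter> {c..} \<inter> {k+1..k+M}) + c" by simp
qed

text \<open>
  The windows in the upper Banach density begin at \<open>2\<close> or later, so an initial segment is compared
  with its translate by \<open>1\<close>, at the cost of the element \<open>1\<close>.
\<close>

lemma family_uBd:
  assumes "\<A> \<in> {fam_uBd, fam_ud, fam_ld}" "A \<in> \<A>"
  shows "A \<in> fam_uBd"
proof -
  have 1: "lower_density A \<le> upper_density A"
    unfolding lower_density_def upper_density_def by (intro Liminf_le_Limsup) auto
  have lim: "(\<lambda>M. ereal (1 / real M)) \<longlonglongrightarrow> 0"
    using lim_const_over_n[of "1::real"] by (simp add: zero_ereal_def)
  have pt: "ereal (real (card {n \<in> A. 1 \<le> n \<and> n \<le> M}) / real M) \<le>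
       ereal (1 / real M) + (SUP k\<in>{1..}. ereal (real (card (A \<inter> {k+1..k+M})) / real M))" for M
  proof -
    have "card {n \<in> A. 1 \<le> n \<and> n \<le> M} \<le> card (insert 1 (A \<inter> {1+1..1+M}))"
      by (intro card_mono) auto
    also have "\<dots> \<le> Suc (card (A \<inter> {1+1..1+M}))"
      by (rule card_insert_le_m1) auto
    finally have "real (card {n \<in> A. 1 \<le> n \<and> n \<le> M}) \<le> 1 + real (card (A \<inter> {1+1..1+M}))" by linarith
    then have "real (card {n \<in> A. 1 \<le> n \<and> n \<le> M}) / real M \<le> 1 / real M + real (card (A \<inter> {1+1..1+M})) / real M"
      by (simp add: divide_right_mono flip: add_divide_distrib)
    then have "ereal (real (card {n \<in> A. 1 \<le> n \<and> n \<le> M}) / real M) \<le> ereal (1 / real M) + ereal (real (card (A \<inter> {1+1..1+M})) / real M)"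
      by simp
    also have "\<dots> \<le> ereal (1 / real M) + (SUP k\<in>{1..}. ereal (real (card (A \<inter> {k+1..k+M})) / real M))"
      by (intro add_left_mono SUP_upper) auto
    finally show ?thesis .
  qed
  have "upper_density A \<le> limsup (\<lambda>M. ereal (1 / real M) + (SUP k\<in>{1..}. ereal (real (card (A \<inter> {k+1..k+M})) / real M)))"
    unfolding upper_density_def by (intro Limsup_mono always_eventually allI pt)
  also have "\<dots> = upper_Banach_density A"
    unfolding upper_Banach_density_def by (subst ereal_limsup_lim_add[OF lim]) auto
  finally show ?thesis using 1 assms by (auto simp: fam_uBd_def fam_ud_def fam_ld_def)
qed

section \<open>Summability from recurrence along a set of positive upper Banach density\<close>

text \<open>
  The upper Banach density \<open>d\<close> controls a set from both sides: no window of a suitable fixed length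
  is much denser than \<open>d\<close>, while some arbitrarily long windows are almost as dense as \<open>d\<close>. A long
  window of the second kind cannot afford many gaps, by the first property.
\<close>

lemma uBd_windows:
  assumes "B \<in> fam_uBd"
  obtains d :: real where "0 < d" "d \<le> 1"
    "\<And>\<eta>. 0 < \<eta> \<Longrightarrow> \<exists>L\<ge>1. \<forall>k\<ge>1. real (card (B \<inter> {k+1..k+L})) \<le> (d + \<eta>) * real L"
    "\<And>\<eta> M0. 0 < \<eta> \<Longrightarrow> \<exists>M\<ge>M0. \<exists>k\<ge>1. real (card (B \<inter> {k+1..k+M})) \<ge> (d - \<eta>) * real M"
proof -
  define \<phi> where "\<phi> M = (SUP k\<in>{1..}. ereal (real (card (B \<inter> {k+1..k+M})) / real M))" for M
  have lim: "limsup \<phi> > 0"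
    using assms by (auto simp: fam_uBd_def upper_Banach_density_def \<phi>_def[abs_def])
  have "\<phi> M \<le> 1" for M
    unfolding \<phi>_def
  proof (rule SUP_least)
    fix k
    have "card (B \<inter> {k+1..k+M}) \<le> card {k+1..k+M}" by (intro card_mono) auto
    then show "ereal (real (card (B \<inter> {k+1..k+M})) / real M) \<le> 1"
      by (auto simp: divide_le_eq_1)
  qed
  then have "limsup \<phi> \<le> 1" by (intro Limsup_bounded always_eventually) auto
  with lim obtain d where d: "limsup \<phi> = ereal d" "0 < d" "d \<le> 1"
    by (cases "limsup \<phi>") auto
  show thesis
  proof (rule that[OF d(2,3)])
    fix \<eta> :: real assume \<eta>: "0 < \<eta>"
    have "eventually (\<lambda>M. \<phi> M < ereal (d + \<eta>)) sequentially"
      using d \<eta> by (intro Limsup_lessD) auto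
    then have "eventually (\<lambda>M. \<phi> M < ereal (d + \<eta>) \<and> M \<ge> 1) sequentially"
      by (intro eventually_conj eventually_ge_at_top)
    then obtain L where L: "\<phi> L < ereal (d + \<eta>)" "L \<ge> 1"
      by (auto simp: eventually_sequentially)
    have "real (card (B \<inter> {k+1..k+L})) \<le> (d + \<eta>) * real L" if "k \<ge> 1" for k
    proof -
      have "ereal (real (card (B \<inter> {k+1..k+L})) / real L) \<le> \<phi> L"
        unfolding \<phi>_def using that by (intro SUP_upper) auto
      also note L(1)
      finally show ?thesis using L(2) by (simp add: field_simps)
    qed
    then show "\<exists>L\<ge>1. \<forall>k\<ge>1. real (card (B \<inter> {k+1..k+L})) \<le> (d + \<eta>) * real L"
      using L(2) by blast
    fix M0
    have "\<not> eventually (\<lambda>M. \<phi> M \<le> ereal (d - \<eta>)) sequentially"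
    proof
      assume "eventually (\<lambda>M. \<phi> M \<le> ereal (d - \<eta>)) sequentially"
      then have "limsup \<phi> \<le> ereal (d - \<eta>)" by (rule Limsup_bounded)
      then show False using d \<eta> by simp
    qed
    then obtain M where M: "M \<ge> Suc M0" "\<not> \<phi> M \<le> ereal (d - \<eta>)"
      unfolding eventually_sequentially by blast
    have "\<exists>k\<in>{1..}. \<not> ereal (real (card (B \<inter> {k+1..k+M})) / real M) \<le> ereal (d - \<eta>)"
    proof (rule ccontr)
      assume "\<not> ?thesis"
      then have "\<phi> M \<le> ereal (d - \<eta>)" unfolding \<phi>_def by (intro SUP_least) auto
      with M show False by simp
    qed
    then obtain k where k: "k \<ge> 1" "d - \<eta> < real (card (B \<inter> {k+1..k+M})) / real M"
      by (auto simp: not_le)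
    then have "(d - \<eta>) * real M \<le> real (card (B \<inter> {k+1..k+M}))"
      using M(1) by (simp add: field_simps)
    then show "\<exists>M\<ge>M0. \<exists>k\<ge>1. real (card (B \<inter> {k+1..k+M})) \<ge> (d - \<eta>) * real M"
      using M(1) k(1) by (intro exI[of _ M]) auto
  qed
qed

lemma fam_uBd_nonempty: "B \<in> fam_uBd \<Longrightarrow> B \<noteq> {}"
proof
  assume "B \<in> fam_uBd" "B = {}"
  then obtain d :: real where d: "0 < d"
    and low: "\<And>\<eta> M0. 0 < \<eta> \<Longrightarrow> \<exists>M\<ge>M0. \<exists>k\<ge>1. real (card (B \<inter> {k+1..k+M})) \<ge> (d - \<eta>) * real M"
    using uBd_windows by metis
  from low[of "d/2" 1] d \<open>B = {}\<close> show False by (auto simp: mult_le_0_iff)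
qed

lemma card_shifted_window:
  fixes B :: "nat set"
  shows "card (B \<inter> {a+1..a+M}) \<le> card {k\<in>{a+1..a+M}. k + r \<in> B} + r"
proof -
  have "B \<inter> {a+1..a+M} \<subseteq> (\<lambda>k. k + r) ` {k\<in>{a+1..a+M}. k + r \<in> B} \<union> {a+1..a+r}"
  proof
    fix n assume n: "n \<in> B \<inter> {a+1..a+M}"
    show "n \<in> (\<lambda>k. k + r) ` {k\<in>{a+1..a+M}. k + r \<in> B} \<union> {a+1..a+r}"
    proof (cases "n \<le> a + r")
      case False
      then show ?thesis using n by (intro UnI1 image_eqI[of _ _ "n - r"]) auto
    qed (use n in auto)
  qed
  then have "card (B \<inter> {a+1..a+M}) \<le> card ((\<lambda>k. k + r) ` {k\<in>{a+1..a+M}. k + r \<in> B} \<union> {a+1..a+r})"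
    by (intro card_mono) auto
  also have "\<dots> \<le> card ((\<lambda>k. k + r) ` {k\<in>{a+1..a+M}. k + r \<in> B}) + card {a+1..a+r}" by (rule card_Un_le)
  also have "\<dots> \<le> card {k\<in>{a+1..a+M}. k + r \<in> B} + r" by (intro add_mono card_image_le) auto
  finally show ?thesis .
qed

lemma card_filter_of_bool:
  "finite I \<Longrightarrow> real (card {k\<in>I. P k}) = (\<Sum>k\<in>I. of_bool (P k))"
  using sum.inter_filter[of I "\<lambda>_. 1::real" P] by (simp add: of_bool_def)

text \<open>
  The hypothesis bounds \<open>\<Sum> \<alpha> k\<close> only over those \<open>k\<close> that are differences from a fixed element of \<open>B\<close>
  to later ones. To reach every \<open>k\<close>, the starting point is allowed to leave \<open>B\<close>: from a point at
  distance less than \<open>L\<close> to the right of \<open>B\<close> the same sum is at most \<open>C\<^sup>L * c\<close>, by the growth condition.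
  In a long window of almost maximal density \<open>d\<close>, such points have density at least about \<open>1 - d/4\<close>.
  Hence for each \<open>k \<le> K\<close> a proportion of at least \<open>d/2\<close> of the window consists of admissible starting
  points from which a step of length \<open>k\<close> leads into \<open>B\<close>. Summing the bound over all starting points
  gives \<open>d/2 * (\<alpha> 1 + \<dots> + \<alpha> K) \<le> C\<^sup>L * c\<close>.
\<close>

lemma summable_of_recurrence:
  fixes \<alpha> :: "nat \<Rightarrow> real"
  assumes B: "B \<in> fam_uBd" and \<alpha>0: "\<And>k. \<alpha> k \<ge> 0" and C: "C \<ge> 1"
    and grow: "\<And>k. \<alpha> k \<le> C * \<alpha> (Suc k)"
    and bnd: "\<And>n K. n \<in> B \<Longrightarrow> (\<Sum>k | k \<in> {1..K} \<and> n + k \<in> B. \<alpha> k) \<le> c"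
  shows "summable \<alpha>"
proof -
  obtain d where d: "0 < d" "d \<le> 1"
    and up: "\<And>\<eta>. 0 < \<eta> \<Longrightarrow> \<exists>L\<ge>1. \<forall>k\<ge>1. real (card (B \<inter> {k+1..k+L})) \<le> (d + \<eta>) * real L"
    and low: "\<And>\<eta> M0. 0 < \<eta> \<Longrightarrow> \<exists>M\<ge>M0. \<exists>k\<ge>1. real (card (B \<inter> {k+1..k+M})) \<ge> (d - \<eta>) * real M"
    using uBd_windows[OF B] by blast
  \<comment> \<open>So small that \<open>(d - \<eta>) / (d + \<eta>)\<close>, the density of starting points, is at least \<open>1 - d/4\<close>.\<close>
  define \<eta> where "\<eta> = d\<^sup>2 / 8"
  have \<eta>: "\<eta> > 0" using d by (simp add: \<eta>_def)
  obtain L where L: "L \<ge> 1" "\<And>k. k \<ge> 1 \<Longrightarrow> real (card (B \<inter> {k+1..k+L})) \<le> (d + \<eta>) * real L"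
    using up[OF \<eta>] by blast
  obtain b0 where "b0 \<in> B" using fam_uBd_nonempty[OF B] by blast
  from bnd[OF this, of 0] have c0: "c \<ge> 0" by simp
  have powC: "\<alpha> k \<le> C ^ r * \<alpha> (k + r)" for k r
  proof (induction r)
    case (Suc r)
    have "C ^ r * \<alpha> (k + r) \<le> C ^ r * (C * \<alpha> (Suc (k + r)))"
      using C by (intro mult_left_mono grow) auto
    with Suc show ?case by (simp add: algebra_simps)
  qed simp
  have near: "(\<Sum>k | k \<in> {1..K} \<and> g + k \<in> B. \<alpha> k) \<le> C ^ L * c"
    if "n' \<in> B" "n' \<le> g" "g < n' + L" for g n' K
  proof -
    define r where "r = g - n'"
    have r: "g = n' + r" "r < L" using that by (auto simp: r_def)
    have "(\<Sum>k | k \<in> {1..K} \<and> g + k \<in> B. \<alpha> k) \<le> (\<Sum>k | k \<in> {1..K} \<and> g + k \<in> B. C ^ r * \<alpha> (k + r))"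
      by (intro sum_mono powC)
    also have "\<dots> = C ^ r * (\<Sum>k | k \<in> {1..K} \<and> g + k \<in> B. \<alpha> (k + r))"
      by (simp add: sum_distrib_left)
    also have "(\<Sum>k | k \<in> {1..K} \<and> g + k \<in> B. \<alpha> (k + r)) = sum \<alpha> ((\<lambda>k. k + r) ` {k. k \<in> {1..K} \<and> g + k \<in> B})"
      by (subst sum.reindex) (auto simp: inj_on_def)
    also have "\<dots> \<le> (\<Sum>k | k \<in> {1..K + r} \<and> n' + k \<in> B. \<alpha> k)"
      using \<alpha>0 r by (intro sum_mono2) (auto simp: ac_simps)
    also have "\<dots> \<le> c" by (rule bnd[OF that(1)])
    also have "C ^ r * c \<le> C ^ L * c"
      using C c0 r by (intro mult_right_mono power_increasing) auto
    finally show ?thesis using C by (simp add: mult_left_mono)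
  qed
  have main: "(\<Sum>k\<in>{1..K}. \<alpha> k) \<le> 2 * C ^ L * c / d" for K
  proof -
    \<comment> \<open>From \<open>M0\<close> on, all boundary terms together are at most \<open>d/8\<close> times the length of the window.\<close>
    obtain M0 :: nat where M0: "real M0 \<ge> 8 * (real L + real K + real L / d) / d + 1"
      using real_arch_simple by blast
    obtain M a where M: "M \<ge> M0" "a \<ge> 1" "real (card (B \<inter> {a+1..a+M})) \<ge> (d - \<eta>) * real M"
      using low[OF \<eta>] by blast
    define I where "I = {a+1..a+M}"
    define G where "G = {k\<in>I. B \<inter> {k+1..k+L} \<noteq> {}}"
    have finI: "finite I" and cardI: "card I = M" by (auto simp: I_def)
    have GI: "G \<subseteq> I" and finG: "finite G" by (auto simp: G_def I_def)
    \<comment> \<open>Double count of the pairs \<open>(k, r)\<close> with \<open>k + r \<in> B\<close> and \<open>1 \<le> r \<le> L\<close>: every \<open>r\<close> occurs almost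
      \<open>card (B \<inter> I)\<close> times, every \<open>k\<close> at most \<open>(d + \<eta>) * L\<close> times, and only \<open>k \<in> G\<close> occur at all.\<close>
    have cw: "real (card (B \<inter> {k+1..k+L})) = (\<Sum>r\<in>{1..L}. of_bool (k + r \<in> B))" for k
    proof -
      have "B \<inter> {k+1..k+L} = (\<lambda>r. k + r) ` {r\<in>{1..L}. k + r \<in> B}"
      proof (intro subset_antisym subsetI)
        fix n assume "n \<in> B \<inter> {k+1..k+L}"
        then show "n \<in> (\<lambda>r. k + r) ` {r\<in>{1..L}. k + r \<in> B}"
          by (intro image_eqI[of _ _ "n - k"]) auto
      qed auto
      then have "card (B \<inter> {k+1..k+L}) = card {r\<in>{1..L}. k + r \<in> B}"
        by (simp add: card_image)
      then show ?thesis by (simp only: card_filter_of_bool[OF finite_atLeastAtMost])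
    qed
    have "real L * (real (card (B \<inter> I)) - real L) = (\<Sum>r\<in>{1..L}. real (card (B \<inter> I)) - real L)"
      by simp
    also have "\<dots> \<le> (\<Sum>r\<in>{1..L}. real (card {k\<in>I. k + r \<in> B}))"
    proof (intro sum_mono)
      fix r assume "r \<in> {1..L}"
      then show "real (card (B \<inter> I)) - real L \<le> real (card {k\<in>I. k + r \<in> B})"
        using card_shifted_window[of B a M r] unfolding I_def by auto
    qed
    also have "\<dots> = (\<Sum>r\<in>{1..L}. \<Sum>k\<in>I. of_bool (k + r \<in> B))"
      by (simp only: card_filter_of_bool[OF finI])
    also have "\<dots> = (\<Sum>k\<in>I. real (card (B \<inter> {k+1..k+L})))"
      unfolding cw by (rule sum.swap)
    also have "\<dots> = (\<Sum>k\<in>G. real (card (B \<inter> {k+1..k+L})))"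
      using finI GI by (intro sum.mono_neutral_right) (auto simp: G_def)
    also have "\<dots> \<le> (\<Sum>k\<in>G. (d + \<eta>) * real L)"
      by (intro sum_mono L(2)) (auto simp: G_def I_def)
    also have "\<dots> = real L * ((d + \<eta>) * real (card G))" by simp
    finally have "real (card (B \<inter> I)) - real L \<le> (d + \<eta>) * real (card G)"
      using L(1) by simp
    then have "(d - \<eta>) * real M - real L \<le> (d + \<eta>) * real (card G)"
      using M(3) by (simp add: I_def)
    then have cG: "real (card G) \<ge> ((d - \<eta>) * real M - real L) / (d + \<eta>)"
      using d \<eta> by (simp add: field_simps)
    have "(d - \<eta>) * real M / (d + \<eta>) \<ge> (1 - 2 * \<eta> / d) * real M"
    proof -
      have "(1 - 2 * \<eta> / d) * (d + \<eta>) \<le> d - \<eta>"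
        using d \<eta> by (simp add: field_simps)
      then have "(1 - 2 * \<eta> / d) * (d + \<eta>) * real M \<le> (d - \<eta>) * real M"
        by (intro mult_right_mono) auto
      then show ?thesis using d \<eta> by (simp add: pos_le_divide_eq mult_ac)
    qed
    moreover have "real L / (d + \<eta>) \<le> real L / d"
      using d \<eta> by (intro divide_left_mono) auto
    ultimately have cG: "real (card G) \<ge> (1 - 2 * \<eta> / d) * real M - real L / d"
      using cG by (simp add: diff_divide_distrib)
    \<comment> \<open>The starting points are the \<open>h + L\<close> with \<open>h \<in> G\<close>: each lies less than \<open>L\<close> to the right of an
      element of \<open>B\<close>.\<close>
    have many: "real (card {h\<in>G. h + L + k \<in> B}) \<ge> d / 2 * real M" if "k \<in> {1..K}" for k
    proof -
      have "{k'\<in>I. k' + (L + k) \<in> B} \<subseteq> {h\<in>G. h + L + k \<in> B} \<union> (I - G)"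
        by (auto simp: add.assoc)
      then have "card {k'\<in>I. k' + (L + k) \<in> B} \<le> card ({h\<in>G. h + L + k \<in> B} \<union> (I - G))"
        using finI finG by (intro card_mono) auto
      also have "\<dots> \<le> card {h\<in>G. h + L + k \<in> B} + card (I - G)" by (rule card_Un_le)
      finally have "card (B \<inter> I) \<le> card {h\<in>G. h + L + k \<in> B} + card (I - G) + (L + k)"
        using card_shifted_window[of B a M "L + k"] by (simp add: I_def)
      moreover have "card (I - G) + card G = M"
        using card_Diff_subset[OF finG GI] card_mono[OF finI GI] cardI by simp
      ultimately have "real (card {h\<in>G. h + L + k \<in> B}) \<ge> real (card (B \<inter> I)) + real (card G) - real M - real L - real k"
        by linarith
      moreover have "real k \<le> real K" using that by simp
      ultimately have "real (card {h\<in>G. h + L + k \<in> B}) \<ge>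
          (d - \<eta>) * real M + ((1 - 2 * \<eta> / d) * real M - real L / d) - real M - real L - real K"
        using cG M(3) by (simp add: I_def)
      also have "(d - \<eta>) * real M + ((1 - 2 * \<eta> / d) * real M - real L / d) - real M - real L - real K
         = (d - d\<^sup>2 / 8 - d / 4) * real M - (real L + real K + real L / d)"
        using d by (simp add: \<eta>_def field_simps power2_eq_square)
      finally have 1: "real (card {h\<in>G. h + L + k \<in> B}) \<ge> (d - d\<^sup>2 / 8 - d / 4) * real M - (real L + real K + real L / d)" .
      have "d\<^sup>2 \<le> d" using d by (simp add: power2_eq_square mult_left_le)
      then have "(d - d\<^sup>2 / 8 - d / 4) * real M \<ge> (d / 2 + d / 8) * real M"
        by (intro mult_right_mono) auto
      moreover have "real L + real K + real L / d \<le> d / 8 * real M"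
      proof -
        have "8 * (real L + real K + real L / d) / d \<le> real M" using M0 M(1) by linarith
        then show ?thesis using d by (simp add: field_simps)
      qed
      ultimately show ?thesis using 1 by (simp add: distrib_right)
    qed
    have "d / 2 * real M * (\<Sum>k\<in>{1..K}. \<alpha> k) = (\<Sum>k\<in>{1..K}. \<alpha> k * (d / 2 * real M))"
      by (simp add: sum_distrib_left mult_ac)
    also have "\<dots> \<le> (\<Sum>k\<in>{1..K}. \<alpha> k * real (card {h\<in>G. h + L + k \<in> B}))"
      by (intro sum_mono mult_left_mono many \<alpha>0)
    also have "\<dots> = (\<Sum>k\<in>{1..K}. \<Sum>h\<in>G. \<alpha> k * of_bool (h + L + k \<in> B))"
      by (simp only: card_filter_of_bool[OF finG] sum_distrib_left)
    also have "\<dots> = (\<Sum>h\<in>G. \<Sum>k\<in>{1..K}. \<alpha> k * of_bool (h + L + k \<in> B))"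
      by (rule sum.swap)
    also have "\<dots> = (\<Sum>h\<in>G. \<Sum>k | k \<in> {1..K} \<and> (h + L) + k \<in> B. \<alpha> k)"
      by (intro sum.cong refl sum.mono_neutral_cong_right) auto
    also have "\<dots> \<le> (\<Sum>h\<in>G. C ^ L * c)"
    proof (intro sum_mono)
      fix h assume "h \<in> G"
      then obtain n' where "n' \<in> B" "h + 1 \<le> n'" "n' \<le> h + L" by (auto simp: G_def)
      then show "(\<Sum>k | k \<in> {1..K} \<and> (h + L) + k \<in> B. \<alpha> k) \<le> C ^ L * c"
        by (intro near[of n']) auto
    qed
    also have "\<dots> = real (card G) * (C ^ L * c)" by simp
    also have "\<dots> \<le> real M * (C ^ L * c)"
      using card_mono[OF finI GI] cardI C c0 by (intro mult_right_mono) auto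
    finally have "real M * (d / 2 * (\<Sum>k\<in>{1..K}. \<alpha> k)) \<le> real M * (C ^ L * c)"
      by (simp add: mult_ac)
    moreover have "real M > 0"
    proof -
      have "0 \<le> 8 * (real L + real K + real L / d) / d" using d by auto
      then show ?thesis using M0 M(1) by linarith
    qed
    ultimately have "d / 2 * (\<Sum>k\<in>{1..K}. \<alpha> k) \<le> C ^ L * c" by simp
    then show ?thesis using d by (simp add: field_simps)
  qed
  show ?thesis
  proof (rule bounded_imp_summable[OF \<alpha>0])
    fix n :: nat
    have "{..n} = insert 0 {1..n::nat}" by auto
    then have "sum \<alpha> {..n} = \<alpha> 0 + (\<Sum>k\<in>{1..n}. \<alpha> k)" by simp
    then show "sum \<alpha> {..n} \<le> \<alpha> 0 + 2 * C ^ L * c / d" using main[of n] by simp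
  qed
qed

section \<open>The sequence space\<close>

text \<open>
  All norm estimates below are estimates of finite sums, which these two lemmas convert.
\<close>

lemma lp_of_finite_sums:
  fixes z :: "nat \<Rightarrow> 'a::real_normed_field"
  assumes p: "p \<ge> 1" and "z 0 = 0" and c: "c \<ge> 0"
    and le: "\<And>F. finite F \<Longrightarrow> F \<subseteq> {1..} \<Longrightarrow> (\<Sum>j\<in>F. norm (z j) powr p) \<le> c"
  shows "z \<in> lp p" "lp_norm p z \<le> c powr (1 / p)"
proof -
  have le': "(\<Sum>j\<in>F. norm (z j) powr p) \<le> c" if "finite F" for F
  proof -
    have "(\<Sum>j\<in>F. norm (z j) powr p) = (\<Sum>j\<in>F - {0}. norm (z j) powr p)"
      using that \<open>z 0 = 0\<close> p by (intro sum.mono_neutral_right) auto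
    also have "\<dots> \<le> c" using that by (intro le) auto
    finally show ?thesis .
  qed
  have sm: "summable (\<lambda>j. norm (z j) powr p)"
    by (rule bounded_imp_summable[of _ c]) (auto intro: le')
  show "z \<in> lp p" using sm \<open>z 0 = 0\<close> by (simp add: lp_def)
  have "(\<Sum>j. norm (z j) powr p) \<le> c"
    by (rule suminf_le_const[OF sm]) (auto intro: le')
  then show "lp_norm p z \<le> c powr (1 / p)"
    unfolding lp_norm_def using p sm by (intro powr_mono2 suminf_nonneg) auto
qed

lemma finite_sum_le_lp_norm:
  fixes z :: "nat \<Rightarrow> 'a::real_normed_field"
  assumes p: "p \<ge> 1" and z: "z \<in> lp p" and F: "finite F"
  shows "(\<Sum>j\<in>F. norm (z j) powr p) \<le> lp_norm p z powr p"
proof -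
  have sm: "summable (\<lambda>j. norm (z j) powr p)" using z by (simp add: lp_def)
  have "(\<Sum>j\<in>F. norm (z j) powr p) \<le> (\<Sum>j. norm (z j) powr p)"
    by (rule sum_le_suminf[OF sm F]) auto
  also have "\<dots> = lp_norm p z powr p"
    unfolding lp_norm_def using p sm by (simp add: powr_powr suminf_nonneg)
  finally show ?thesis .
qed

lemma lp_diff:
  fixes x y :: "nat \<Rightarrow> 'a::real_normed_field"
  assumes "p \<ge> 1" "x \<in> lp p" "y \<in> lp p"
  shows "(\<lambda>j. x j - y j) \<in> lp p"
  using lp_sum_bound[OF assms(1,2), of "\<lambda>j. - y j"] assms(3) by (auto simp: lp_def)

lemma lp_add:
  fixes x y :: "nat \<Rightarrow> 'a::real_normed_field"
  assumes "p \<ge> 1" "x \<in> lp p" "y \<in> lp p"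
  shows "(\<lambda>j. x j + y j) \<in> lp p"
  using lp_sum_bound[OF assms] by simp

lemma lp_finite_support:
  fixes y :: "nat \<Rightarrow> 'a::real_normed_field"
  assumes "\<And>j. j \<notin> {1..l} \<Longrightarrow> y j = 0"
  shows "y \<in> lp p"
  unfolding lp_def using assms by (auto intro!: summable_finite[of "{1..l}"])

text \<open>
  Numbers, read as codes of lists, index the finite arrays over a countable dense set of scalars.
  The scalar \<open>0\<close> can be left out of that set because scalars have no isolated points; quotients of
  entries are going to be formed.
\<close>

lemma dense_nonzero_arrays:
  obtains Q :: "nat \<Rightarrow> nat \<Rightarrow> nat \<Rightarrow> 'a::{real_normed_field, euclidean_space}"
  where "\<And>i s j. Q i s j \<noteq> 0"
    "\<And>a \<eta> K. 0 < \<eta> \<Longrightarrow> \<exists>i. \<forall>s\<le>K. \<forall>j\<le>K. norm (Q i s j - a s j) < \<eta>"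
proof -
  obtain D :: "'a set" where D: "countable D" "\<And>X. open X \<Longrightarrow> X \<noteq> {} \<Longrightarrow> \<exists>d\<in>D. d \<in> X"
    using countable_dense_setE by metis
  define e where "e = from_nat_into (D - {0})"
  have near: "\<exists>d\<in>D - {0}. norm (d - b) < \<eta>" if \<eta>: "0 < \<eta>" for b :: 'a and \<eta> :: real
  proof -
    have "ball b \<eta> - {0} \<noteq> {}"
    proof
      assume "ball b \<eta> - {0} = {}"
      then have "ball b \<eta> \<subseteq> {0}" by blast
      then have "ball b \<eta> = {0}" using \<eta> by (auto simp: subset_singleton_iff)
      then show False using open_ball[of b \<eta>] not_open_singleton[of "0::'a"] by simp
    qed
    then obtain d where "d \<in> D" "d \<in> ball b \<eta> - {0}"
      using D(2)[of "ball b \<eta> - {0}"] by (auto intro: open_Diff)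
    then show ?thesis by (intro bexI[of _ d]) (auto simp: dist_norm norm_minus_commute)
  qed
  have ne: "D - {0} \<noteq> {}" using near[of 1 0] by auto
  have e0: "e n \<noteq> 0" for n using from_nat_into[OF ne, of n] by (simp add: e_def)
  have en: "\<exists>n. norm (e n - b) < \<eta>" if \<eta>: "0 < \<eta>" for b :: 'a and \<eta>
  proof -
    obtain d where d: "d \<in> D - {0}" "norm (d - b) < \<eta>" using near[OF \<eta>] by blast
    obtain n where "e n = d"
      using from_nat_into_surj[of "D - {0}" d] D(1) d(1) unfolding e_def by auto
    with d(2) show ?thesis by blast
  qed
  define Q where "Q i s j = (let xs = list_decode i; k = prod_encode (s, j) in
      e (if k < length xs then xs ! k else 0))" for i s j
  show thesis
  proof (rule that[of Q])
    show "Q i s j \<noteq> 0" for i s j by (simp add: Q_def Let_def e0)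
    fix a :: "nat \<Rightarrow> nat \<Rightarrow> 'a" and \<eta> :: real and K :: nat
    assume "0 < \<eta>"
    then have "\<forall>s j. \<exists>n. norm (e n - a s j) < \<eta>" using en by blast
    then obtain g where g: "\<And>s j. norm (e (g s j) - a s j) < \<eta>" by metis
    obtain B where B: "\<And>k. k \<in> prod_encode ` ({..K} \<times> {..K}) \<Longrightarrow> k \<le> B"
      using finite_nat_set_iff_bounded_le[of "prod_encode ` ({..K} \<times> {..K})"] by auto
    define xs where "xs = map (\<lambda>k. case prod_decode k of (s, j) \<Rightarrow> g s j) [0..<Suc B]"
    have "Q (list_encode xs) s j = e (g s j)" if "s \<le> K" "j \<le> K" for s j
    proof -
      have "prod_encode (s, j) \<le> B" using that by (intro B) auto
      then show ?thesis by (simp add: Q_def Let_def xs_def del: upt_Suc)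
    qed
    then show "\<exists>i. \<forall>s\<le>K. \<forall>j\<le>K. norm (Q i s j - a s j) < \<eta>"
      using g by (intro exI[of _ "list_encode xs"]) auto
  qed
qed

section \<open>Extended sums of weight ratios\<close>

lemma ennreal_infsum_le_iff:
  fixes g :: "'b \<Rightarrow> real"
  assumes g: "\<And>m. m \<in> S \<Longrightarrow> g m \<ge> 0" and c: "c \<ge> 0"
  shows "(\<Sum>\<^sub>\<infinity>m\<in>S. ennreal (g m)) \<le> ennreal c \<longleftrightarrow>
    (\<forall>F. finite F \<longrightarrow> F \<subseteq> S \<longrightarrow> sum g F \<le> c)"
proof -
  have "(\<Sum>m\<in>F. ennreal (g m)) \<le> ennreal c \<longleftrightarrow> sum g F \<le> c" if "F \<subseteq> S" for F
    using that g c by (subst sum_ennreal) (auto intro!: ennreal_le_iff)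
  then show ?thesis
    by (subst nonneg_infsum_complete) (auto simp: SUP_le_iff)
qed

lemma infsum_ratio_le_iff:
  fixes a b :: "nat \<Rightarrow> 'a::real_normed_field"
  assumes b: "\<And>m. m \<in> S \<Longrightarrow> b m \<noteq> 0" and c: "c \<ge> 0"
  shows "(\<Sum>\<^sub>\<infinity>m\<in>S. ennreal (norm (a m) powr p) / ennreal (norm (b m) powr p)) \<le> ennreal c \<longleftrightarrow>
    (\<forall>F. finite F \<longrightarrow> F \<subseteq> S \<longrightarrow> (\<Sum>m\<in>F. norm (a m / b m) powr p) \<le> c)"
proof -
  have "(\<Sum>\<^sub>\<infinity>m\<in>S. ennreal (norm (a m) powr p) / ennreal (norm (b m) powr p)) =
      (\<Sum>\<^sub>\<infinity>m\<in>S. ennreal (norm (a m / b m) powr p))"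
    using b by (intro infsum_cong) (simp add: divide_ennreal norm_divide powr_divide)
  then show ?thesis using ennreal_infsum_le_iff[of S "\<lambda>m. norm (a m / b m) powr p" c] c by simp
qed

text \<open>
  In the extended reals \<open>1 / 0 = \<infinity>\<close>, so a finite sum forces every \<open>b n\<close> to be nonzero.
\<close>

lemma infsum_inverse_finite_iff:
  fixes b :: "nat \<Rightarrow> 'a::real_normed_field"
  shows "(\<Sum>\<^sub>\<infinity>n\<in>{1..}. 1 / ennreal (norm (b n) powr p)) < \<infinity> \<longleftrightarrow>
    (\<forall>n\<ge>1. b n \<noteq> 0) \<and> summable (\<lambda>n. norm (1 / b n) powr p)" (is "?S < \<infinity> \<longleftrightarrow> ?N \<and> ?C")
proof -
  have nz: ?N if "?S < \<infinity>"
  proof (intro allI impI notI)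
    fix n :: nat assume n: "n \<ge> 1" and 0: "b n = 0"
    have "(\<Sum>m\<in>{n}. 1 / ennreal (norm (b m) powr p)) \<le> ?S"
      using n by (subst nonneg_infsum_complete) (auto intro!: SUP_upper2[of "{n}"])
    then show False using that 0 by simp
  qed
  have fin: "?S < \<infinity> \<longleftrightarrow> ?C" if N: ?N
  proof -
    have eq: "?S = (\<Sum>\<^sub>\<infinity>n\<in>{1..}. ennreal (norm (1 / b n) powr p))"
    proof (intro infsum_cong)
      fix n :: nat assume "n \<in> {1..}"
      then show "1 / ennreal (norm (b n) powr p) = ennreal (norm (1 / b n) powr p)"
        using N divide_ennreal[of 1 "norm (b n) powr p"] by (simp add: norm_divide powr_divide)
    qed
    show ?thesis
    proof
      assume "?S < \<infinity>"
      then obtain c where c: "c \<ge> 0" "?S = ennreal c"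
        by (cases ?S) auto
      then have fin: "sum (\<lambda>n. norm (1 / b n) powr p) F \<le> c" if "finite F" "F \<subseteq> {1..}" for F
        using ennreal_infsum_le_iff[of "{1..}" "\<lambda>n. norm (1 / b n) powr p" c] that unfolding eq by auto
      have "summable (\<lambda>n. norm (1 / b (Suc n)) powr p)"
      proof (rule bounded_imp_summable[of _ c])
        fix n
        have "(\<Sum>k\<le>n. norm (1 / b (Suc k)) powr p) = sum (\<lambda>n. norm (1 / b n) powr p) (Suc ` {..n})"
          by (subst sum.reindex) auto
        also have "\<dots> \<le> c" by (intro fin) auto
        finally show "(\<Sum>k\<le>n. norm (1 / b (Suc k)) powr p) \<le> c" .
      qed auto
      then show ?C by (subst (asm) summable_Suc_iff)
    next
      assume ?C
      have "?S \<le> ennreal (\<Sum>n. norm (1 / b n) powr p)"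
        unfolding eq using \<open>?C\<close>
        by (subst ennreal_infsum_le_iff) (auto intro: sum_le_suminf suminf_nonneg)
      then show "?S < \<infinity>" using ennreal_less_top le_less_trans infinity_ennreal_def by metis
    qed
  qed
  show ?thesis using nz fin by blast
qed

section \<open>Iterates of a pseudo-shift\<close>

lemma weight_prod_0 [simp]: "weight_prod f w l 0 = 1"
  by (simp add: weight_prod_def)

lemma weight_prod_Suc: "weight_prod f w l (Suc n) = weight_prod f w l n * w ((f ^^ Suc n) l)"
  by (simp add: weight_prod_def)

lemma weight_prod_add:
  "weight_prod f w l (m + n) = weight_prod f w l m * weight_prod f w ((f ^^ m) l) n"
proof (induction n)
  case (Suc n)
  have "(f ^^ Suc (m + n)) l = (f ^^ Suc n) ((f ^^ m) l)"
    by (metis add.commute add_Suc funpow_add o_apply)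
  with Suc show ?case by (simp add: weight_prod_Suc del: funpow.simps)
qed simp

lemma pseudo_shift_iter_0: "x 0 = 0 \<Longrightarrow> (pseudo_shift f w ^^ n) x 0 = 0"
  by (cases n) (auto simp: pseudo_shift_def)

context
  fixes f :: "nat \<Rightarrow> nat" and w :: "nat \<Rightarrow> 'a::real_normed_field"
  assumes data: "pseudo_shift_data f w"
begin

lemma shift_map_gt: "1 \<le> j \<Longrightarrow> j < f j"
proof (induction j rule: dec_induct)
  case base
  then show ?case using data by (simp add: pseudo_shift_data_def)
next
  case (step j)
  then have "f j < f (Suc j)"
    using data by (auto simp: pseudo_shift_data_def strict_mono_on_def)
  with step show ?case by linarith
qed

lemma iter_ge: "1 \<le> j \<Longrightarrow> j + n \<le> (f ^^ n) j"
proof (induction n)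
  case (Suc n)
  then show ?case using shift_map_gt[of "(f ^^ n) j"] by auto
qed simp

lemma iter_pos: "1 \<le> j \<Longrightarrow> 1 \<le> (f ^^ n) j"
  using iter_ge[of j n] by linarith

lemma iter_less: "1 \<le> i \<Longrightarrow> i < j \<Longrightarrow> (f ^^ n) i < (f ^^ n) j"
proof (induction n)
  case (Suc n)
  then show ?case using data iter_pos[of i n] iter_pos[of j n]
    by (auto simp: pseudo_shift_data_def strict_mono_on_def)
qed simp

lemma iter_le: "1 \<le> i \<Longrightarrow> i \<le> j \<Longrightarrow> (f ^^ n) i \<le> (f ^^ n) j"
  using iter_less[of i j n] by (cases "i = j") auto

lemma iter_inj: "1 \<le> i \<Longrightarrow> 1 \<le> j \<Longrightarrow> (f ^^ n) i = (f ^^ n) j \<longleftrightarrow> i = j"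
  using iter_less[of i j n] iter_less[of j i n] by (cases i j rule: linorder_cases) auto

lemma iter_split: "n \<le> m \<Longrightarrow> (f ^^ m) j = (f ^^ n) ((f ^^ (m - n)) j)"
  by (metis funpow_add le_add_diff_inverse o_apply)

lemma iter_less_time: "1 \<le> j \<Longrightarrow> n < m \<Longrightarrow> (f ^^ n) j < (f ^^ m) j"
  using iter_split[of n m j] iter_less[of j "(f ^^ (m - n)) j" n] iter_ge[of j "m - n"] by auto

lemma iter_inv_iter: "1 \<le> j \<Longrightarrow> iter_inv f n ((f ^^ n) j) = j"
  unfolding iter_inv_def by (intro inv_into_f_f inj_onI) (auto simp: iter_inj)

lemma pseudo_shift_iter:
  "1 \<le> j \<Longrightarrow> (pseudo_shift f w ^^ n) x j = weight_prod f w j n * x ((f ^^ n) j)"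
proof (induction n arbitrary: j)
  case (Suc n)
  have fj: "1 \<le> f j" using shift_map_gt[OF Suc.prems] Suc.prems by linarith
  have "weight_prod f w j (Suc n) = w (f j) * weight_prod f w (f j) n"
    using weight_prod_add[of f w j 1 n] by (simp add: weight_prod_Suc)
  then show ?case using Suc.IH[OF fj] Suc.prems
    by (simp add: pseudo_shift_def funpow_swap1)
qed simp

end

section \<open>Scattered refinements under weak partition regularity\<close>

lemma weakly_partition_regularE:
  assumes wpr: "weakly_partition_regular \<A> N f" and B: "\<And>l. 1 \<le> l \<Longrightarrow> B l \<in> \<A>"
  obtains A where "\<And>l. 1 \<le> l \<Longrightarrow> A l \<in> \<A>" "\<And>l. 1 \<le> l \<Longrightarrow> A l \<subseteq> B l"
    "\<And>l k m n s t. 1 \<le> l \<Longrightarrow> 1 \<le> k \<Longrightarrow> m \<in> A l \<Longrightarrow> n \<in> A k \<Longrightarrow> m \<noteq> n \<Longrightarrow>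
       s \<in> {1..N} \<Longrightarrow> t \<in> {1..N} \<Longrightarrow> (f s ^^ m) ` {1..l} \<inter> (f t ^^ n) ` {1..k} = {}"
proof -
  have "\<forall>l\<ge>1. B l \<in> \<A>" using B by simp
  from mp[OF spec[OF wpr[unfolded weakly_partition_regular_def], of B] this]
  obtain A where A: "\<forall>l\<ge>1. A l \<in> \<A> \<and> A l \<subseteq> B l"
    "\<forall>l\<ge>1. \<forall>k\<ge>1. \<forall>m\<in>A l. \<forall>n\<in>A k. m \<noteq> n \<longrightarrow>
       (\<forall>s\<in>{1..N}. \<forall>t\<in>{1..N}. (f s ^^ m) ` {1..l} \<inter> (f t ^^ n) ` {1..k} = {})"
    by (elim exE conjE)
  show thesis by (rule that[of A]) (use A(1) in blast, use A(1) in blast, rule A(2)[rule_format])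
qed

text \<open>
  Weak partition regularity supplies the last clause. In the construction of a hypercyclic vector,
  disjointness lets a time determine its set, and lower bounds that grow with the indices, for elements
  and for their distances, make the tails small.
\<close>

definition scattered :: "nat \<Rightarrow> (nat \<Rightarrow> nat \<Rightarrow> nat) \<Rightarrow> (nat \<Rightarrow> nat set) \<Rightarrow> bool" where
  "scattered N f A \<longleftrightarrow>
     (\<forall>k\<ge>1. \<forall>m\<in>A k. k \<le> m) \<and>
     (\<forall>k\<ge>1. \<forall>l\<ge>1. k \<noteq> l \<longrightarrow> A k \<inter> A l = {}) \<and>
     (\<forall>k\<ge>1. \<forall>l\<ge>1. \<forall>m\<in>A k. \<forall>n\<in>A l. n < m \<longrightarrow> n + max k l \<le> m) \<and>
     (\<forall>k\<ge>1. \<forall>l\<ge>1. \<forall>m\<in>A k. \<forall>n\<in>A l. m \<noteq> n \<longrightarrow>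
        (\<forall>s\<in>{1..N}. \<forall>t\<in>{1..N}. (f s ^^ m) ` {1..k} \<inter> (f t ^^ n) ` {1..l} = {}))"

text \<open>
  Weak partition regularity says nothing about a common element of two of the sets, and little about
  the distance between elements of different sets. Both come from applying it to translates: the set
  \<open>B l - l\<^sup>2\<close> is placed at the index \<open>M l = f\<^sub>1\<^bsup>l + l\<^sup>2\<^esup>(1)\<close>. If \<open>n' < m'\<close> are taken from the resulting
  subsets at the indices \<open>M k\<close> and \<open>M l\<close>, then \<open>f\<^sub>1\<^bsup>m' - n'\<^esup>(1) > M k\<close>, since otherwise \<open>f\<^sub>1\<^bsup>m'\<^esup>(1)\<close> would be a
  common site; so \<open>m' - n' > k + k\<^sup>2\<close>. Undoing the translations keeps the elements at distance at least
  \<open>max k l\<close>: in one direction because \<open>k + k\<^sup>2\<close> exceeds the difference of the translations by enough, in the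
  other because that difference is itself at least \<open>max k l\<close>. In particular the sets are disjoint. A second
  application, to the sets so obtained, separates the sites at the original indices.
\<close>

lemma scattered_refinement:
  fixes f :: "nat \<Rightarrow> nat \<Rightarrow> nat" and w :: "nat \<Rightarrow> 'a::real_normed_field"
  assumes fam: "\<A> \<in> {fam_uBd, fam_ud, fam_ld}" and N: "1 \<le> N"
    and data: "pseudo_shift_data (f 1) w"
    and wpr: "weakly_partition_regular \<A> N f"
    and B: "\<And>l. 1 \<le> l \<Longrightarrow> B l \<in> \<A>"
  shows "\<exists>A. (\<forall>l\<ge>1. A l \<in> \<A> \<and> A l \<subseteq> B l) \<and> scattered N f A"
proof -
  define c where "c l = l * l" for l :: nat
  define M where "M l = (f 1 ^^ (l + c l)) 1" for l
  note less_time = iter_less_time[OF data order_refl]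
  have cM: "l + c l < k + c k" if "l < k" for l k
    using that by (simp add: c_def add_strict_mono mult_strict_mono)
  have Mless: "M l < M k" if "l < k" for l k
    unfolding M_def by (rule less_time[OF cM[OF that]])
  have injM: "inj M" by (rule strict_mono_imp_inj_on) (auto intro: strict_monoI Mless)
  have M1: "1 \<le> M l" for l unfolding M_def by (rule iter_pos[OF data]) simp
  \<comment> \<open>At the index \<open>M l\<close> this is \<open>B l\<close> translated down by \<open>c l\<close>; other indices just need some member of
    the family.\<close>
  define B' where "B' i = {n. 1 \<le> n \<and> n + c (inv M i) \<in> B (max 1 (inv M i))}" for i
  have "B' i \<in> \<A>" for i unfolding B'_def by (intro family_shift_down[OF fam] B) auto
  then obtain A' where A': "\<And>l. 1 \<le> l \<Longrightarrow> A' l \<in> \<A>" "\<And>l. 1 \<le> l \<Longrightarrow> A' l \<subseteq> B' l"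
    and sep': "\<And>l k m n s t. 1 \<le> l \<Longrightarrow> 1 \<le> k \<Longrightarrow> m \<in> A' l \<Longrightarrow> n \<in> A' k \<Longrightarrow> m \<noteq> n \<Longrightarrow>
       s \<in> {1..N} \<Longrightarrow> t \<in> {1..N} \<Longrightarrow> (f s ^^ m) ` {1..l} \<inter> (f t ^^ n) ` {1..k} = {}"
    using weakly_partition_regularE[OF wpr, of B'] by metis
  define A1 where "A1 l = ((\<lambda>n. n + c l) ` A' (M l)) \<inter> {l..}" for l
  have A1: "A1 l \<in> \<A>" for l
    unfolding A1_def by (intro family_tail[OF fam] family_shift_up[OF fam]) (use A' M1 in auto)
  have A1B: "A1 l \<subseteq> B l" if "1 \<le> l" for l
    using A'(2)[OF M1, of l] that injM by (auto simp: A1_def B'_def max_def)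
  have big: "k + c k < m - n" if "m \<in> A' (M l)" "n \<in> A' (M k)" "n < m" for m n k l
  proof (rule ccontr)
    assume *: "\<not> k + c k < m - n"
    have "(f 1 ^^ (m - n)) 1 \<le> M k"
      using less_time[of "m - n" "k + c k"] * unfolding M_def by (cases "m - n = k + c k") auto
    then have "(f 1 ^^ m) 1 \<in> (f 1 ^^ n) ` {1..M k}"
      using iter_split[OF data, of n m 1] that(3) iter_pos[OF data, of 1 "m - n"] by auto
    moreover have "(f 1 ^^ m) 1 \<in> (f 1 ^^ m) ` {1..M l}" using M1 by auto
    ultimately show False using sep'[OF M1 M1 that(1,2), of 1 1] that(3) N by auto
  qed
  have claim: "m \<noteq> n \<and> (n < m \<longrightarrow> n + k \<le> m) \<and> (m < n \<longrightarrow> m + k \<le> n)"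
    if lk: "l < k" and m: "m \<in> A1 l" and n: "n \<in> A1 k" for l k m n
  proof -
    obtain m' n' where mn: "m = m' + c l" "n = n' + c k" "m' \<in> A' (M l)" "n' \<in> A' (M k)"
      using m n by (auto simp: A1_def)
    have ck: "c l + k \<le> c k"
    proof -
      obtain d where "k = Suc (l + d)" using lk less_iff_Suc_add by auto
      then show ?thesis by (simp add: c_def algebra_simps)
    qed
    have "n' < m' \<Longrightarrow> k + c k < m' - n'" using big[OF mn(3,4)] .
    then show ?thesis using ck lk unfolding mn(1,2) by linarith
  qed
  have same: "n + k \<le> m" if m: "m \<in> A1 k" and n: "n \<in> A1 k" and nm: "n < m" for m n k
  proof -
    obtain m' n' where "m = m' + c k" "n = n' + c k" "m' \<in> A' (M k)" "n' \<in> A' (M k)"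
      using m n by (auto simp: A1_def)
    then show ?thesis using big[of m' k n' k] nm by auto
  qed
  obtain A where A: "\<And>l. 1 \<le> l \<Longrightarrow> A l \<in> \<A>" "\<And>l. 1 \<le> l \<Longrightarrow> A l \<subseteq> A1 l"
    and sep: "\<And>l k m n s t. 1 \<le> l \<Longrightarrow> 1 \<le> k \<Longrightarrow> m \<in> A l \<Longrightarrow> n \<in> A k \<Longrightarrow> m \<noteq> n \<Longrightarrow>
       s \<in> {1..N} \<Longrightarrow> t \<in> {1..N} \<Longrightarrow> (f s ^^ m) ` {1..l} \<inter> (f t ^^ n) ` {1..k} = {}"
    using weakly_partition_regularE[OF wpr, of A1] A1 by metis
  have AB: "A l \<subseteq> B l" if "1 \<le> l" for l using A(2)[OF that] A1B[OF that] by blast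
  have late: "l \<le> m" if "m \<in> A l" "1 \<le> l" for l m
    using A(2)[OF that(2)] that(1) by (auto simp: A1_def)
  have disj: "A l \<inter> A k = {}" if "1 \<le> l" "1 \<le> k" "l \<noteq> k" for l k
    using A(2)[OF that(1)] A(2)[OF that(2)] claim[of l k] claim[of k l] that(3)
    by (cases l k rule: linorder_cases) blast+
  have gap: "n + max l k \<le> m" if "1 \<le> l" "1 \<le> k" "m \<in> A l" "n \<in> A k" "n < m" for l k m n
  proof -
    have "m \<in> A1 l" "n \<in> A1 k" using that A(2) by blast+
    then show ?thesis using claim[of l k m n] claim[of k l n m] same[of m k n] that(5)
      by (cases l k rule: linorder_cases) (auto simp: max_def)
  qed
  have "scattered N f A"
    unfolding scattered_def
    by (intro conjI allI impI ballI) (erule (1) late, erule (2) disj, erule (4) gap, erule (1) sep, assumption+)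
  then show ?thesis using A(1) AB by blast
qed

lemma scattered_late: "scattered N f A \<Longrightarrow> m \<in> A k \<Longrightarrow> 1 \<le> k \<Longrightarrow> k \<le> m"
  and scattered_disjoint:
    "scattered N f A \<Longrightarrow> 1 \<le> k \<Longrightarrow> 1 \<le> l \<Longrightarrow> k \<noteq> l \<Longrightarrow> A k \<inter> A l = {}"
  and scattered_gap:
    "scattered N f A \<Longrightarrow> 1 \<le> k \<Longrightarrow> 1 \<le> l \<Longrightarrow> m \<in> A k \<Longrightarrow> n \<in> A l \<Longrightarrow> n < m \<Longrightarrow> n + max k l \<le> m"
  by (simp_all add: scattered_def)

lemma scattered_separated:
  "scattered N f A \<Longrightarrow> 1 \<le> k \<Longrightarrow> 1 \<le> l \<Longrightarrow> m \<in> A k \<Longrightarrow> n \<in> A l \<Longrightarrow> m \<noteq> n \<Longrightarrow>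
     s \<in> {1..N} \<Longrightarrow> t \<in> {1..N} \<Longrightarrow> (f s ^^ m) ` {1..k} \<inter> (f t ^^ n) ` {1..l} = {}"
  using conjunct2[OF conjunct2[OF conjunct2[OF iffD1[OF scattered_def]]], rule_format] .

section \<open>Conditions on the weights, in finitary form\<close>

lemma finite_positive_lower_bound:
  fixes g :: "'b \<Rightarrow> real"
  assumes "finite S" "\<And>x. x \<in> S \<Longrightarrow> 0 < g x"
  obtains \<mu> where "0 < \<mu>" "\<And>x. x \<in> S \<Longrightarrow> \<mu> \<le> g x"
proof (rule that[of "Min (insert 1 (g ` S))"])
  show "0 < Min (insert 1 (g ` S))" using assms by (subst Min_gr_iff) auto
qed (use assms in auto)

locale pseudo_shifts =
  fixes N :: nat and p :: real and f :: "nat \<Rightarrow> nat \<Rightarrow> nat"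
    and w :: "nat \<Rightarrow> nat \<Rightarrow> 'a::{real_normed_field, euclidean_space}"
  assumes p: "1 \<le> p" and data: "\<And>s. s \<in> {1..N} \<Longrightarrow> pseudo_shift_data (f s) (w s)"
begin

abbreviation W :: "nat \<Rightarrow> nat \<Rightarrow> nat \<Rightarrow> 'a" where
  "W s j n \<equiv> weight_prod (f s) (w s) j n"

abbreviation \<phi> :: "nat \<Rightarrow> nat \<Rightarrow> nat \<Rightarrow> nat" where
  "\<phi> s n \<equiv> f s ^^ n"

text \<open>
  The tail \<open>\<Sum>d\<ge>K. |1 / W s j d|\<^sup>p\<close>, written as a difference so that it visibly tends to \<open>0\<close>.
\<close>

definition inverse_weight_tail :: "nat \<Rightarrow> nat \<Rightarrow> nat \<Rightarrow> real" where
  "inverse_weight_tail s j K =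
     (\<Sum>d. norm (1 / W s j d) powr p) - (\<Sum>d<K. norm (1 / W s j d) powr p)"

lemma inverse_weight_tail_ge:
  assumes "summable (\<lambda>d. norm (1 / W s j d) powr p)" "finite F" "F \<subseteq> {K..}"
  shows "(\<Sum>d\<in>F. norm (1 / W s j d) powr p) \<le> inverse_weight_tail s j K"
proof -
  have "(\<Sum>d\<in>F \<union> {..<K}. norm (1 / W s j d) powr p) =
     (\<Sum>d\<in>F. norm (1 / W s j d) powr p) + (\<Sum>d<K. norm (1 / W s j d) powr p)"
    using assms(2,3) by (intro sum.union_disjoint) auto
  moreover have "(\<Sum>d\<in>F \<union> {..<K}. norm (1 / W s j d) powr p) \<le> (\<Sum>d. norm (1 / W s j d) powr p)"
    using assms by (intro sum_le_suminf) auto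
  ultimately show ?thesis by (simp add: inverse_weight_tail_def)
qed

lemma inverse_weight_tail_tendsto:
  assumes "summable (\<lambda>d. norm (1 / W s j d) powr p)"
  shows "inverse_weight_tail s j \<longlonglongrightarrow> 0"
proof -
  have "(\<lambda>K. (\<Sum>d. norm (1 / W s j d) powr p) - (\<Sum>d<K. norm (1 / W s j d) powr p)) \<longlonglongrightarrow>
      (\<Sum>d. norm (1 / W s j d) powr p) - (\<Sum>d. norm (1 / W s j d) powr p)"
    by (intro tendsto_diff tendsto_const summable_LIMSEQ assms)
  then show ?thesis by (simp add: inverse_weight_tail_def[abs_def])
qed

text \<open>
  A bound for what an array \<open>b\<close> on \<open>[N] \<times> [l]\<close> contributes to orbits at times for which it was not
  placed: \<open>\<epsilon> K\<close> accounts for its effect on the other pseudo-shifts and the tail for its effect on the same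
  one.
\<close>

definition interaction :: "(nat \<Rightarrow> real) \<Rightarrow> (nat \<Rightarrow> nat \<Rightarrow> 'a) \<Rightarrow> nat \<Rightarrow> nat \<Rightarrow> real" where
  "interaction \<epsilon> b l K =
     (\<Sum>t\<in>{1..N}. \<Sum>j\<in>{1..l}. norm (b t j) powr p * (\<epsilon> K + inverse_weight_tail t j K))"

text \<open>
  The bounds on the cross sums, stated for all finite partial sums.
\<close>

definition crosses_later :: "(nat \<Rightarrow> nat set) \<Rightarrow> (nat \<Rightarrow> real) \<Rightarrow> bool" where
  "crosses_later A \<epsilon> \<longleftrightarrow> (\<forall>j l k. 1 \<le> j \<and> j \<le> l \<and> 1 \<le> k \<longrightarrow>
     (\<forall>n\<in>A k. \<forall>s\<in>{1..N}. \<forall>t\<in>{1..N}. s \<noteq> t \<longrightarrow>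
       (\<forall>F. finite F \<longrightarrow> F \<subseteq> {m \<in> A l - {n}. \<phi> t m j \<in> \<phi> s n ` {k<..}} \<longrightarrow>
         (\<Sum>m\<in>F. norm (W s (iter_inv (f s) n (\<phi> t m j)) n / W t j m) powr p) \<le> \<epsilon> l)))"

definition crosses_earlier :: "(nat \<Rightarrow> nat set) \<Rightarrow> (nat \<Rightarrow> real) \<Rightarrow> bool" where
  "crosses_earlier A \<epsilon> \<longleftrightarrow> (\<forall>j k l. 1 \<le> j \<and> j \<le> k \<and> k < l \<longrightarrow>
     (\<forall>n\<in>A l. \<forall>s\<in>{1..N}. \<forall>t\<in>{1..N}. s \<noteq> t \<longrightarrow>
       (\<forall>F. finite F \<longrightarrow> F \<subseteq> {m \<in> A k. \<phi> t m j \<in> \<phi> s n ` {l<..}} \<longrightarrow>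
         (\<Sum>m\<in>F. norm (W s (iter_inv (f s) n (\<phi> t m j)) n / W t j m) powr p) \<le> \<epsilon> l)))"

text \<open>
  Both parts of the ratio condition at once, in terms of the preimages \<open>i\<close> and \<open>j\<close> of a common site: a
  target supported in \<open>[l]\<close> has the entry \<open>0\<close> at every \<open>i > l\<close>.
\<close>

definition ratios_at :: "nat set \<Rightarrow> nat \<Rightarrow> (nat \<Rightarrow> nat \<Rightarrow> 'a) \<Rightarrow> real \<Rightarrow> bool" where
  "ratios_at B l a e \<longleftrightarrow> (\<forall>s\<in>{1..N}. \<forall>t\<in>{1..N}. s \<noteq> t \<longrightarrow> (\<forall>n\<in>B. \<forall>i\<ge>1. \<forall>j\<in>{1..l}.
     \<phi> s n i = \<phi> t n j \<longrightarrow>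
     norm (W s i n / W t j n - (if i \<le> l then a s i / a t j else 0)) \<le> e))"

definition ratios_dense :: "(nat \<Rightarrow> nat set) \<Rightarrow> bool" where
  "ratios_dense A \<longleftrightarrow> (\<forall>l\<ge>1. \<forall>a. (\<forall>s\<in>{1..N}. \<forall>j\<in>{1..l}. a s j \<noteq> 0) \<longrightarrow>
     (\<forall>e>0. \<exists>L\<ge>l. ratios_at (A L) l a e))"

lemma crosses_laterD:
  "crosses_later A \<epsilon> \<Longrightarrow> 1 \<le> j \<Longrightarrow> j \<le> l \<Longrightarrow> 1 \<le> k \<Longrightarrow> n \<in> A k \<Longrightarrow>
     s \<in> {1..N} \<Longrightarrow> t \<in> {1..N} \<Longrightarrow> s \<noteq> t \<Longrightarrow> finite F \<Longrightarrow>
     F \<subseteq> {m \<in> A l - {n}. \<phi> t m j \<in> \<phi> s n ` {k<..}} \<Longrightarrow>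
     (\<Sum>m\<in>F. norm (W s (iter_inv (f s) n (\<phi> t m j)) n / W t j m) powr p) \<le> \<epsilon> l"
  unfolding crosses_later_def by blast

lemma crosses_earlierD:
  "crosses_earlier A \<epsilon> \<Longrightarrow> 1 \<le> j \<Longrightarrow> j \<le> k \<Longrightarrow> k < l \<Longrightarrow> n \<in> A l \<Longrightarrow>
     s \<in> {1..N} \<Longrightarrow> t \<in> {1..N} \<Longrightarrow> s \<noteq> t \<Longrightarrow> finite F \<Longrightarrow>
     F \<subseteq> {m \<in> A k. \<phi> t m j \<in> \<phi> s n ` {l<..}} \<Longrightarrow>
     (\<Sum>m\<in>F. norm (W s (iter_inv (f s) n (\<phi> t m j)) n / W t j m) powr p) \<le> \<epsilon> l"
  unfolding crosses_earlier_def by blast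

lemma crosses_later_subset:
  assumes sub: "\<And>l. 1 \<le> l \<Longrightarrow> A l \<subseteq> B l" and B: "crosses_later B \<epsilon>"
  shows "crosses_later A \<epsilon>"
  unfolding crosses_later_def
proof (intro allI impI ballI, elim conjE)
  fix j l k n s t and F :: "nat set"
  assume H: "n \<in> A k" "s \<in> {1..N}" "t \<in> {1..N}" "s \<noteq> t" "finite F"
    "F \<subseteq> {m \<in> A l - {n}. \<phi> t m j \<in> \<phi> s n ` {k<..}}" "1 \<le> j" "j \<le> l" "1 \<le> k"
  have "n \<in> B k" "A l \<subseteq> B l" using sub[of k] sub[of l] H by auto
  moreover from this(2) have "F \<subseteq> {m \<in> B l - {n}. \<phi> t m j \<in> \<phi> s n ` {k<..}}" using H(6) by blast
  ultimately show "(\<Sum>m\<in>F. norm (W s (iter_inv (f s) n (\<phi> t m j)) n / W t j m) powr p) \<le> \<epsilon> l"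
    by (intro crosses_laterD[OF B H(7-9) _ H(2-5)])
qed

lemma crosses_earlier_subset:
  assumes sub: "\<And>l. 1 \<le> l \<Longrightarrow> A l \<subseteq> B l" and B: "crosses_earlier B \<epsilon>"
  shows "crosses_earlier A \<epsilon>"
  unfolding crosses_earlier_def
proof (intro allI impI ballI, elim conjE)
  fix j k l n s t and F :: "nat set"
  assume H: "n \<in> A l" "s \<in> {1..N}" "t \<in> {1..N}" "s \<noteq> t" "finite F"
    "F \<subseteq> {m \<in> A k. \<phi> t m j \<in> \<phi> s n ` {l<..}}" "1 \<le> j" "j \<le> k" "k < l"
  have "n \<in> B l" "A k \<subseteq> B k" using sub[of k] sub[of l] H by auto
  moreover from this(2) have "F \<subseteq> {m \<in> B k. \<phi> t m j \<in> \<phi> s n ` {l<..}}" using H(6) by blast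
  ultimately show "(\<Sum>m\<in>F. norm (W s (iter_inv (f s) n (\<phi> t m j)) n / W t j m) powr p) \<le> \<epsilon> l"
    by (intro crosses_earlierD[OF B H(7-9) _ H(2-5)])
qed

text \<open>
  The index \<open>L\<close> can be taken as large as desired while \<open>l\<close> stays fixed: the condition is applied on
  \<open>[max l L0]\<close> to the array extended by a tiny constant \<open>\<mu>\<close>. For \<open>l < i \<le> L0\<close> the quotients of weights
  are then close to \<open>\<mu> / a t j\<close>, hence small, as the condition for \<open>l\<close> demands.
\<close>

lemma ratios_dense_beyond:
  assumes ra: "ratios_dense A" and l: "1 \<le> l" and e: "0 < e"
    and nz: "\<And>s j. s \<in> {1..N} \<Longrightarrow> j \<in> {1..l} \<Longrightarrow> a s j \<noteq> 0"
  shows "\<exists>L\<ge>max l L0. ratios_at (A L) l a e"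
proof -
  have "finite ({1..N} \<times> {1..l})" by simp
  then obtain \<mu> where \<mu>: "0 < \<mu>" "\<And>x. x \<in> {1..N} \<times> {1..l} \<Longrightarrow> \<mu> \<le> e / 2 * norm (a (fst x) (snd x))"
    by (rule finite_positive_lower_bound[where g = "\<lambda>x. e / 2 * norm (a (fst x) (snd x))"])
      (use nz e in auto)
  define a' where "a' s j = (if j \<le> l then a s j else of_real \<mu>)" for s j
  have "\<forall>s\<in>{1..N}. \<forall>j\<in>{1..max l L0}. a' s j \<noteq> 0" using nz \<mu>(1) by (auto simp: a'_def)
  moreover have "1 \<le> max l L0" "0 < e / 2" using l e by auto
  ultimately obtain L where L: "L \<ge> max l L0" "ratios_at (A L) (max l L0) a' (e / 2)"
    using ra unfolding ratios_dense_def by blast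
  have "norm (W s i n / W t j n - (if i \<le> l then a s i / a t j else 0)) \<le> e"
    if st: "s \<in> {1..N}" "t \<in> {1..N}" "s \<noteq> t" and n: "n \<in> A L" and i: "1 \<le> i" and j: "j \<in> {1..l}"
      and eq: "\<phi> s n i = \<phi> t n j" for s t n i j
  proof -
    have j': "j \<in> {1..max l L0}" using j by auto
    have B: "norm (W s i n / W t j n - (if i \<le> max l L0 then a' s i / a' t j else 0)) \<le> e / 2"
      using L(2) st n i j' eq unfolding ratios_at_def by blast
    have at: "a' t j = a t j" using j by (simp add: a'_def)
    consider "i \<le> l" | "l < i" "i \<le> max l L0" | "max l L0 < i" by linarith
    then show ?thesis
    proof cases
      case 1
      then have "a' s i = a s i" "i \<le> max l L0" by (auto simp: a'_def)
      then show ?thesis using B e at 1 by simp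
    next
      case 2
      then have "a' s i = of_real \<mu>" by (simp add: a'_def)
      then have "norm (W s i n / W t j n - of_real \<mu> / a t j) \<le> e / 2" using B at 2(2) by simp
      moreover have "norm (of_real \<mu> / a t j) \<le> e / 2"
      proof -
        have "\<mu> \<le> e / 2 * norm (a t j)" using \<mu>(2)[of "(t, j)"] st j by simp
        then show ?thesis using \<mu>(1) nz[OF st(2) j] by (simp add: norm_divide pos_divide_le_eq)
      qed
      ultimately have "norm (W s i n / W t j n) \<le> e"
        using norm_triangle_sub[of "W s i n / W t j n" "of_real \<mu> / a t j"] by linarith
      then show ?thesis using 2 by simp
    next
      case 3
      then have "\<not> i \<le> max l L0" "\<not> i \<le> l" by auto
      then show ?thesis using B e by (simp only: if_False diff_zero)
    qed
  qed
  then show ?thesis using L(1) unfolding ratios_at_def by blast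
qed

end

section \<open>The block vector\<close>

text \<open>
  A sum over quadruples is organised by the first three components; only sums over the last one have
  to be estimated.
\<close>

lemma sum_tuples_le:
  fixes c \<beta> :: "nat \<Rightarrow> nat \<Rightarrow> nat \<Rightarrow> real" and h :: "nat \<Rightarrow> nat \<Rightarrow> nat \<Rightarrow> nat \<Rightarrow> real"
  assumes fin: "finite T" and T: "T \<subseteq> {(r, t, j, m). t \<in> {1..N} \<and> j \<in> {1..l r}}"
    and c: "\<And>r t j. c r t j \<ge> 0"
    and bnd: "\<And>r t j F. finite F \<Longrightarrow> t \<in> {1..N} \<Longrightarrow> j \<in> {1..l r} \<Longrightarrow> \<forall>m\<in>F. (r, t, j, m) \<in> T \<Longrightarrow>
      (\<Sum>m\<in>F. h r t j m) \<le> \<beta> r t j"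
  shows "(\<Sum>(r, t, j, m)\<in>T. c r t j * h r t j m) \<le>
    (\<Sum>r\<in>fst ` T. \<Sum>t\<in>{1..N}. \<Sum>j\<in>{1..l r}. c r t j * \<beta> r t j)"
proof -
  define M where "M = (\<lambda>(r, t, j, m). m) ` T"
  define S where "S = (SIGMA r:fst ` T. SIGMA t:{1..N}. SIGMA j:{1..l r}. M)"
  have finM: "finite M" and finR: "finite (fst ` T)" using fin by (auto simp: M_def)
  have finS: "finite S" unfolding S_def using finM finR by (intro finite_SigmaI) auto
  have TS: "T \<subseteq> S" using T by (force simp: S_def M_def)
  have "(\<Sum>(r, t, j, m)\<in>T. c r t j * h r t j m) =
      (\<Sum>(r, t, j, m)\<in>S. if (r, t, j, m) \<in> T then c r t j * h r t j m else 0)"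
    using finS TS by (intro sum.mono_neutral_cong_left) auto
  also have "\<dots> = (\<Sum>r\<in>fst ` T. \<Sum>t\<in>{1..N}. \<Sum>j\<in>{1..l r}. \<Sum>m\<in>M.
      if (r, t, j, m) \<in> T then c r t j * h r t j m else 0)"
    unfolding S_def using finM finR by (simp add: sum.Sigma split_def)
  also have "\<dots> \<le> (\<Sum>r\<in>fst ` T. \<Sum>t\<in>{1..N}. \<Sum>j\<in>{1..l r}. c r t j * \<beta> r t j)"
  proof (intro sum_mono)
    fix r t j assume tj: "t \<in> {1..N}" "j \<in> {1..l r}"
    have "(\<Sum>m\<in>M. if (r, t, j, m) \<in> T then c r t j * h r t j m else 0) =
        (\<Sum>m\<in>{m\<in>M. (r, t, j, m) \<in> T}. c r t j * h r t j m)"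
      using finM by (rule sum.inter_filter[symmetric])
    also have "\<dots> = c r t j * (\<Sum>m\<in>{m\<in>M. (r, t, j, m) \<in> T}. h r t j m)"
      by (simp add: sum_distrib_left)
    also have "\<dots> \<le> c r t j * \<beta> r t j"
      using finM tj by (intro mult_left_mono c bnd) auto
    finally show "(\<Sum>m\<in>M. if (r, t, j, m) \<in> T then c r t j * h r t j m else 0) \<le> c r t j * \<beta> r t j" .
  qed
  finally show ?thesis .
qed

lemma sum_half_powers_le:
  assumes "finite S" "S \<subseteq> {q<..}"
  shows "(\<Sum>r\<in>S. (1/2::real) ^ r) \<le> (1/2) ^ q"
proof -
  have "S = (\<lambda>i. Suc q + i) ` ((\<lambda>r. r - Suc q) ` S)"
    using assms(2) by (force simp: image_image)
  then have "(\<Sum>r\<in>S. (1/2::real) ^ r) = (\<Sum>i\<in>(\<lambda>r. r - Suc q) ` S. (1/2) ^ (Suc q + i))"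
    by (metis (no_types, lifting) add_left_cancel inj_on_def sum.reindex_cong)
  also have "\<dots> = (1/2) ^ Suc q * (\<Sum>i\<in>(\<lambda>r. r - Suc q) ` S. (1/2) ^ i)"
    by (simp add: power_add sum_distrib_left)
  also have "\<dots> \<le> (1/2) ^ Suc q * (\<Sum>i. (1/2) ^ i)"
    using assms(1) by (intro mult_left_mono sum_le_suminf summable_geometric) auto
  also have "\<dots> = (1/2) ^ q" by (subst suminf_geometric) auto
  finally show ?thesis .
qed

text \<open>
  The \<open>q\<close>-th block is the array \<open>a q\<close> on \<open>[N] \<times> [l q]\<close>, placed at all times in \<open>A (L q)\<close>. The assumption
  \<open>small\<close> makes the first \<open>q + 1\<close> blocks together negligible at stage \<open>q\<close>, and \<open>\<delta> q\<close> is the accuracy with which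
  the quotients of weights reproduce those of \<open>a q\<close>.
\<close>

locale block_vector = pseudo_shifts N p f w
  for N p f and w :: "nat \<Rightarrow> nat \<Rightarrow> 'a::{real_normed_field, euclidean_space}" +
  fixes A :: "nat \<Rightarrow> nat set" and \<epsilon> :: "nat \<Rightarrow> real"
    and a :: "nat \<Rightarrow> nat \<Rightarrow> nat \<Rightarrow> 'a" and \<delta> :: "nat \<Rightarrow> real" and l L :: "nat \<Rightarrow> nat"
  assumes W_nz: "\<And>s j n. s \<in> {1..N} \<Longrightarrow> 1 \<le> j \<Longrightarrow> W s j n \<noteq> 0"
    and W_sum: "\<And>s j. s \<in> {1..N} \<Longrightarrow> 1 \<le> j \<Longrightarrow> summable (\<lambda>n. norm (1 / W s j n) powr p)"
    and \<epsilon>0: "\<And>k. 1 \<le> k \<Longrightarrow> 0 \<le> \<epsilon> k"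
    and later: "crosses_later A \<epsilon>" and earlier: "crosses_earlier A \<epsilon>"
    and scattered: "scattered N f A"
    and l1: "\<And>q. 1 \<le> l q" and lL: "\<And>q. l q \<le> L q" and L_mono: "strict_mono L"
    and small: "\<And>q. (\<Sum>r\<le>q. interaction \<epsilon> (a r) (l r) (L q)) \<le> (1/2) ^ q"
    and ratios: "\<And>q. ratios_at (A (L q)) (l q) (a q) (\<delta> q)"
    and a_nz: "\<And>q s j. a q s j \<noteq> 0"
    and \<delta>0: "\<And>q. 0 \<le> \<delta> q"
    and \<delta>: "\<And>q. \<delta> q powr p * (\<Sum>t\<in>{1..N}. \<Sum>j\<in>{1..l q}. norm (a q t j) powr p) \<le> (1/2) ^ q"
begin

lemmas A_late = scattered_late[OF scattered] and A_disj = scattered_disjoint[OF scattered]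
  and A_gap = scattered_gap[OF scattered] and A_sep = scattered_separated[OF scattered]

text \<open>
  The quadruple \<open>(r, t, j, m)\<close> stands for the entry \<open>(t, j)\<close> of block \<open>r\<close> placed at time \<open>m\<close>. Entries of one
  block placed at the same time can share a site, so the value of the vector there comes from a chosen
  one of them, its \<open>source\<close>; the ratio condition makes the choice immaterial up to a small error. Entries
  for different times or from different blocks have different sites.
\<close>

definition blocks :: "(nat \<times> nat \<times> nat \<times> nat) set" where
  "blocks = {(r, t, j, m). t \<in> {1..N} \<and> j \<in> {1..l r} \<and> m \<in> A (L r)}"

definition site :: "nat \<times> nat \<times> nat \<times> nat \<Rightarrow> nat" where
  "site = (\<lambda>(r, t, j, m). \<phi> t m j)"

abbreviation source :: "nat \<Rightarrow> nat \<times> nat \<times> nat \<times> nat" where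
  "source \<equiv> inv_into blocks site"

definition vec :: "nat \<Rightarrow> 'a" where
  "vec i = (if i \<in> site ` blocks then case source i of (r, t, j, m) \<Rightarrow> a r t j / W t j m else 0)"

definition target :: "nat \<Rightarrow> nat \<Rightarrow> nat \<Rightarrow> 'a" where
  "target q s i = (if 1 \<le> i \<and> i \<le> l q then a q s i else 0)"

lemma L1: "1 \<le> L q" using l1[of q] lL[of q] by linarith

lemma L_inj: "L q = L r \<longleftrightarrow> q = r"
  using L_mono by (simp add: strict_mono_eq)

lemma tail_nonneg: "t \<in> {1..N} \<Longrightarrow> 1 \<le> j \<Longrightarrow> 0 \<le> inverse_weight_tail t j K"
  using inverse_weight_tail_ge[OF W_sum, where F = "{}"] by simp

lemma interaction_nonneg: "1 \<le> K \<Longrightarrow> 0 \<le> interaction \<epsilon> (a r) (l r) K"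
  unfolding interaction_def
  by (intro sum_nonneg mult_nonneg_nonneg add_nonneg_nonneg tail_nonneg \<epsilon>0) auto

lemma sourceE:
  assumes "i \<in> site ` blocks"
  obtains r t j m where "source i = (r, t, j, m)" "t \<in> {1..N}" "j \<in> {1..l r}" "m \<in> A (L r)" "\<phi> t m j = i"
proof -
  obtain r t j m where s: "source i = (r, t, j, m)" by (metis prod_cases4)
  have "(r, t, j, m) \<in> blocks" "site (r, t, j, m) = i"
    using inv_into_into[OF assms] f_inv_into_f[OF assms] unfolding s by auto
  then show thesis using that[OF s] unfolding blocks_def site_def by simp
qed

text \<open>
  The total size of entries \<open>i\<close> whose sites carry values placed for times other than \<open>n\<close>. For \<open>n = 0\<close> it
  bounds the norm of the vector, and for \<open>n\<close> in \<open>A (L q)\<close> the influence of all other times. The bound assumed for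
  block \<open>r\<close> refers to the stage \<open>max q r\<close>: blocks \<open>r \<le> q\<close> cost at most \<open>1 / 2\<^sup>q\<close> in total by smallness at
  stage \<open>q\<close>, and a block \<open>r > q\<close> costs at most \<open>1 / 2\<^sup>r\<close> by smallness at its own stage.
\<close>

lemma sum_over_blocks_le:
  assumes s: "s \<in> {1..N}" and I: "finite I" "I \<subseteq> {1..}" and cov: "\<And>i. i \<in> I \<Longrightarrow> \<phi> s n i \<in> site ` blocks"
    and bnd: "\<And>r t j F. finite F \<Longrightarrow> t \<in> {1..N} \<Longrightarrow> j \<in> {1..l r} \<Longrightarrow>
      \<forall>m\<in>F. \<exists>i\<in>I. source (\<phi> s n i) = (r, t, j, m) \<Longrightarrow>
      (\<Sum>m\<in>F. norm (W s (iter_inv (f s) n (\<phi> t m j)) n / W t j m) powr p)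
        \<le> \<epsilon> (L (max q r)) + inverse_weight_tail t j (L (max q r))"
  shows "(\<Sum>i\<in>I. norm (W s i n * vec (\<phi> s n i)) powr p) \<le> 2 * (1/2) ^ q"
proof -
  define T where "T = (\<lambda>i. source (\<phi> s n i)) ` I"
  define h where "h r t j m = norm (W s (iter_inv (f s) n (\<phi> t m j)) n / W t j m) powr p" for r t j m :: nat
  define E where "E r K = interaction \<epsilon> (a r) (l r) K" for r K
  have finT: "finite T" using I by (simp add: T_def)
  have inj: "inj_on (\<lambda>i. source (\<phi> s n i)) I"
  proof (rule inj_onI)
    fix i i' assume i: "i \<in> I" "i' \<in> I" "source (\<phi> s n i) = source (\<phi> s n i')"
    then have "\<phi> s n i = \<phi> s n i'" using cov by (metis f_inv_into_f)
    then show "i = i'" using iter_inj[OF data[OF s]] i(1,2) I(2) by (auto simp: subset_iff)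
  qed
  have "(\<Sum>i\<in>I. norm (W s i n * vec (\<phi> s n i)) powr p) =
      (\<Sum>i\<in>I. case source (\<phi> s n i) of (r, t, j, m) \<Rightarrow> norm (a r t j) powr p * h r t j m)"
  proof (intro sum.cong refl)
    fix i assume i: "i \<in> I"
    obtain r t j m where src: "source (\<phi> s n i) = (r, t, j, m)" "\<phi> t m j = \<phi> s n i"
      using sourceE[OF cov[OF i]] by metis
    have "iter_inv (f s) n (\<phi> s n i) = i"
      using iter_inv_iter[OF data[OF s]] i I(2) by auto
    then show "norm (W s i n * vec (\<phi> s n i)) powr p =
        (case source (\<phi> s n i) of (r, t, j, m) \<Rightarrow> norm (a r t j) powr p * h r t j m)"
      using cov[OF i] src by (simp add: vec_def h_def norm_mult norm_divide powr_mult powr_divide)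
  qed
  also have "\<dots> = (\<Sum>(r, t, j, m)\<in>T. norm (a r t j) powr p * h r t j m)"
    unfolding T_def by (subst sum.reindex[OF inj]) simp
  also have "\<dots> \<le> (\<Sum>r\<in>fst ` T. \<Sum>t\<in>{1..N}. \<Sum>j\<in>{1..l r}.
      norm (a r t j) powr p * (\<epsilon> (L (max q r)) + inverse_weight_tail t j (L (max q r))))"
  proof (rule sum_tuples_le[OF finT])
    show "T \<subseteq> {(r, t, j, m). t \<in> {1..N} \<and> j \<in> {1..l r}}"
    proof
      fix \<tau> assume "\<tau> \<in> T"
      then obtain i where i: "i \<in> I" "\<tau> = source (\<phi> s n i)" by (auto simp: T_def)
      show "\<tau> \<in> {(r, t, j, m). t \<in> {1..N} \<and> j \<in> {1..l r}}"
        by (rule sourceE[OF cov[OF i(1)]]) (simp add: i(2))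
    qed
    fix r t j and F :: "nat set"
    assume "finite F" "t \<in> {1..N}" "j \<in> {1..l r}" "\<forall>m\<in>F. (r, t, j, m) \<in> T"
    then show "(\<Sum>m\<in>F. h r t j m) \<le> \<epsilon> (L (max q r)) + inverse_weight_tail t j (L (max q r))"
      unfolding h_def T_def by (intro bnd) (auto simp: image_iff, metis)
  qed auto
  also have "\<dots> = (\<Sum>r\<in>fst ` T. E r (L (max q r)))"
    by (simp add: E_def interaction_def)
  also have "\<dots> = (\<Sum>r\<in>fst ` T \<inter> {..q}. E r (L (max q r))) + (\<Sum>r\<in>fst ` T \<inter> {q<..}. E r (L (max q r)))"
    using finT by (subst sum.union_disjoint[symmetric]) (auto intro!: sum.cong)
  also have "(\<Sum>r\<in>fst ` T \<inter> {..q}. E r (L (max q r))) = (\<Sum>r\<in>fst ` T \<inter> {..q}. E r (L q))"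
    by (intro sum.cong) auto
  also have "\<dots> \<le> (\<Sum>r\<le>q. E r (L q))"
    unfolding E_def by (intro sum_mono2 interaction_nonneg L1) auto
  also have "\<dots> \<le> (1/2) ^ q" unfolding E_def by (rule small)
  also have "(\<Sum>r\<in>fst ` T \<inter> {q<..}. E r (L (max q r))) \<le> (\<Sum>r\<in>fst ` T \<inter> {q<..}. (1/2) ^ r)"
  proof (intro sum_mono)
    fix r assume r: "r \<in> fst ` T \<inter> {q<..}"
    have "E r (L r) \<le> (\<Sum>r'\<le>r. E r' (L r))"
      unfolding E_def by (intro member_le_sum interaction_nonneg L1) auto
    also have "\<dots> \<le> (1/2) ^ r" unfolding E_def by (rule small)
    finally show "E r (L (max q r)) \<le> (1/2) ^ r" using r by (simp add: max_def)
  qed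
  also have "\<dots> \<le> (1/2) ^ q"
    using finT by (intro sum_half_powers_le) auto
  finally show ?thesis by simp
qed

lemma vec_0: "vec 0 = 0"
proof (cases "(0::nat) \<in> site ` blocks")
  case True
  then obtain t m j where tj: "t \<in> {1..N}" "1 \<le> j" "\<phi> t m j = 0"
    by (metis sourceE atLeastAtMost_iff)
  then show ?thesis using iter_pos[OF data[OF tj(1)] tj(2), of m] by simp
qed (simp add: vec_def)

text \<open>
  Every time at which block \<open>r\<close> is placed is at least \<open>L r\<close>, so its norm is bounded by tails from
  \<open>L r\<close> on.
\<close>

lemma vec_in_lp: "vec \<in> lp p"
proof (cases "N = 0")
  case True
  then have "blocks = {}" unfolding blocks_def by auto
  then have "vec = (\<lambda>_. 0)" by (auto simp: vec_def)
  then show ?thesis by (simp add: lp_def)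
next
  case False
  then have s: "1 \<in> {1..N}" by auto
  show ?thesis
  proof (rule lp_of_finite_sums(1)[where z = vec and c = "2 * (1/2) ^ 0", OF p vec_0])
    fix F :: "nat set" assume F: "finite F" "F \<subseteq> {1..}"
    have "(\<Sum>i\<in>F. norm (vec i) powr p) = (\<Sum>i\<in>F \<inter> site ` blocks. norm (vec i) powr p)"
      using F(1) p by (intro sum.mono_neutral_right) (auto simp: vec_def)
    also have "\<dots> = (\<Sum>i\<in>F \<inter> site ` blocks. norm (W 1 i 0 * vec (\<phi> 1 0 i)) powr p)"
      by simp
    also have "\<dots> \<le> 2 * (1/2) ^ 0"
    proof (rule sum_over_blocks_le[OF s])
      fix r t j and G :: "nat set"
      assume G: "finite G" "t \<in> {1..N}" "j \<in> {1..l r}"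
        "\<forall>m\<in>G. \<exists>i\<in>F \<inter> site ` blocks. source (\<phi> 1 0 i) = (r, t, j, m)"
      have "m \<in> A (L r)" "1 \<le> \<phi> t m j" if m: "m \<in> G" for m
      proof -
        obtain i where "i \<in> F \<inter> site ` blocks" "source (\<phi> 1 0 i) = (r, t, j, m)"
          using bspec[OF G(4) m] by blast
        then have i: "i \<in> site ` blocks" "source i = (r, t, j, m)" by auto
        then show "m \<in> A (L r)" using sourceE[OF i(1)] by (metis prod.inject)
        show "1 \<le> \<phi> t m j" using iter_pos[OF data[OF G(2)]] G(3) by auto
      qed
      moreover have "iter_inv (f 1) 0 i = i" if "1 \<le> i" for i
        using iter_inv_iter[OF data[OF s] that, of 0] by simp
      ultimately have "(\<Sum>m\<in>G. norm (W 1 (iter_inv (f 1) 0 (\<phi> t m j)) 0 / W t j m) powr p)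
         = (\<Sum>m\<in>G. norm (1 / W t j m) powr p)" by simp
      also have "\<dots> \<le> inverse_weight_tail t j (L r)"
        using G \<open>\<And>m. m \<in> G \<Longrightarrow> m \<in> A (L r)\<close> A_late[OF _ L1]
        by (intro inverse_weight_tail_ge W_sum) auto
      finally show "(\<Sum>m\<in>G. norm (W 1 (iter_inv (f 1) 0 (\<phi> t m j)) 0 / W t j m) powr p)
          \<le> \<epsilon> (L (max 0 r)) + inverse_weight_tail t j (L (max 0 r))"
        using \<epsilon>0[OF L1, of r] by simp
    qed (use F in auto)
    finally show "(\<Sum>i\<in>F. norm (vec i) powr p) \<le> 2 * (1/2) ^ 0" .
  qed auto
qed

lemma own_entry_error:
  assumes n: "n \<in> A (L q)" and st: "s \<in> {1..N}" "t \<in> {1..N}" "s \<noteq> t" and i: "1 \<le> i"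
    and j: "j \<in> {1..l q}" and eq: "\<phi> s n i = \<phi> t n j"
  shows "norm (W s i n / W t j n * a q t j - (if i \<le> l q then a q s i else 0)) \<le> \<delta> q * norm (a q t j)"
proof -
  have "norm (W s i n / W t j n - (if i \<le> l q then a q s i / a q t j else 0)) \<le> \<delta> q"
    using ratios[of q] assms unfolding ratios_at_def by blast
  then have "norm (W s i n / W t j n - (if i \<le> l q then a q s i / a q t j else 0)) * norm (a q t j)
      \<le> \<delta> q * norm (a q t j)"
    by (intro mult_right_mono) auto
  also have "norm (W s i n / W t j n - (if i \<le> l q then a q s i / a q t j else 0)) * norm (a q t j)
      = norm (W s i n / W t j n * a q t j - (if i \<le> l q then a q s i else 0))"
    using a_nz[of q t j] by (simp add: left_diff_distrib flip: norm_mult)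
  finally show ?thesis .
qed

text \<open>
  Entries placed for the current time \<open>n\<close> come from block \<open>q\<close>, by disjointness. Distinct \<open>i\<close> have distinct
  sources \<open>(t, j)\<close>, so the errors \<open>\<delta> q * |a q t j|\<close> are summed at most once each.
\<close>

lemma active_block_sum_le:
  assumes s: "s \<in> {1..N}" and n: "n \<in> A (L q)" and I: "finite I" "I \<subseteq> {1..}"
    and cov: "\<And>i. i \<in> I \<Longrightarrow> \<phi> s n i \<in> site ` blocks \<and> (\<exists>r t j. source (\<phi> s n i) = (r, t, j, n))"
  shows "(\<Sum>i\<in>I. norm (W s i n * vec (\<phi> s n i) - target q s i) powr p) \<le> (1/2) ^ q"
proof -
  define g where "g i = (case source (\<phi> s n i) of (r, t, j, m) \<Rightarrow> (t, j))" for i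
  have g: "\<exists>t\<in>{1..N}. \<exists>j\<in>{1..l q}. source (\<phi> s n i) = (q, t, j, n) \<and> \<phi> t n j = \<phi> s n i"
    if i: "i \<in> I" for i
  proof -
    have c: "\<phi> s n i \<in> site ` blocks" using cov[OF i] by blast
    obtain r t j m where src: "source (\<phi> s n i) = (r, t, j, m)" "t \<in> {1..N}" "j \<in> {1..l r}"
      "m \<in> A (L r)" "\<phi> t m j = \<phi> s n i"
      using sourceE[OF c] by metis
    have "m = n" using cov[OF i] src(1) by auto
    moreover have "r = q"
      using A_disj[OF L1 L1, of r q] src(4) n \<open>m = n\<close> L_inj by blast
    ultimately show ?thesis using src by auto
  qed
  have inj: "inj_on g I"
  proof (rule inj_onI)
    fix i i' assume i: "i \<in> I" "i' \<in> I" "g i = g i'"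
    then have "\<phi> s n i = \<phi> s n i'" using g[OF i(1)] g[OF i(2)] by (auto simp: g_def)
    then show "i = i'" using iter_inj[OF data[OF s]] i(1,2) I(2) by (auto simp: subset_iff)
  qed
  have "(\<Sum>i\<in>I. norm (W s i n * vec (\<phi> s n i) - target q s i) powr p)
    \<le> (\<Sum>i\<in>I. case g i of (t, j) \<Rightarrow> \<delta> q powr p * norm (a q t j) powr p)"
  proof (intro sum_mono)
    fix i assume i: "i \<in> I"
    obtain t j where tj: "t \<in> {1..N}" "j \<in> {1..l q}" "source (\<phi> s n i) = (q, t, j, n)" "\<phi> t n j = \<phi> s n i"
      using g[OF i] by blast
    have i1: "1 \<le> i" using i I(2) by auto
    have v: "vec (\<phi> s n i) = a q t j / W t j n" using cov[OF i] tj(3) by (simp add: vec_def)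
    have "norm (W s i n * vec (\<phi> s n i) - target q s i) \<le> \<delta> q * norm (a q t j)"
    proof (cases "s = t")
      case True
      then have "i = j" using tj(2,4) i1 iter_inj[OF data[OF s], of j i n] by auto
      then show ?thesis using W_nz[OF s i1, of n] True tj(2) \<delta>0[of q]
        unfolding v by (simp add: target_def)
    next
      case False
      then show ?thesis using own_entry_error[OF n s tj(1) False i1 tj(2) tj(4)[symmetric]] i1
        by (simp add: v target_def)
    qed
    then have "norm (W s i n * vec (\<phi> s n i) - target q s i) powr p \<le> (\<delta> q * norm (a q t j)) powr p"
      using p by (intro powr_mono2) auto
    then show "norm (W s i n * vec (\<phi> s n i) - target q s i) powr p
        \<le> (case g i of (t, j) \<Rightarrow> \<delta> q powr p * norm (a q t j) powr p)"
      by (simp add: g_def tj(3) powr_mult \<delta>0)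
  qed
  also have "\<dots> = (\<Sum>(t, j)\<in>g ` I. \<delta> q powr p * norm (a q t j) powr p)"
    by (subst sum.reindex[OF inj]) simp
  also have "\<dots> \<le> (\<Sum>(t, j)\<in>{1..N} \<times> {1..l q}. \<delta> q powr p * norm (a q t j) powr p)"
  proof (intro sum_mono2)
    show "g ` I \<subseteq> {1..N} \<times> {1..l q}"
    proof
      fix x assume "x \<in> g ` I"
      then obtain i where i: "i \<in> I" "x = g i" by blast
      show "x \<in> {1..N} \<times> {1..l q}" using g[OF i(1)] i(2) by (auto simp: g_def)
    qed
  qed auto
  also have "\<dots> = \<delta> q powr p * (\<Sum>t\<in>{1..N}. \<Sum>j\<in>{1..l q}. norm (a q t j) powr p)"
    by (simp add: sum.cartesian_product[symmetric] sum_distrib_left)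
  also have "\<dots> \<le> (1/2) ^ q" by (rule \<delta>)
  finally show ?thesis .
qed

text \<open>
  Let \<open>\<phi> s n i\<close> be the site of an entry placed for a time \<open>m \<noteq> n\<close>. Separation gives \<open>i > L q\<close>, which is the
  range of the cross sums; these apply when the entry belongs to another pseudo-shift. When it belongs to
  the same one, \<open>m < n\<close> is impossible: then \<open>j = \<phi> s (n - m) i \<ge> \<phi> s (n - m) 1\<close>, so \<open>\<phi> s n 1\<close> would be a
  common site of the times \<open>m\<close> and \<open>n\<close>. For \<open>m > n\<close> the quotient of weight products is
  \<open>1 / W s j (m - n)\<close>, and the gap between \<open>n\<close> and \<open>m\<close> is at least \<open>L (max q r)\<close>.
\<close>

lemma inactive_blocks_sum_le:
  assumes s: "s \<in> {1..N}" and n: "n \<in> A (L q)" and I: "finite I" "I \<subseteq> {1..}"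
    and cov: "\<And>i. i \<in> I \<Longrightarrow> \<phi> s n i \<in> site ` blocks \<and> (\<exists>r t j m. source (\<phi> s n i) = (r, t, j, m) \<and> m \<noteq> n)"
  shows "(\<Sum>i\<in>I. norm (W s i n * vec (\<phi> s n i)) powr p) \<le> 2 * (1/2) ^ q"
proof (rule sum_over_blocks_le[OF s I])
  show "\<phi> s n i \<in> site ` blocks" if "i \<in> I" for i using cov[OF that] by blast
  fix r t j and F :: "nat set"
  assume F: "finite F" and t: "t \<in> {1..N}" and j: "j \<in> {1..l r}"
    and ex: "\<forall>m\<in>F. \<exists>i\<in>I. source (\<phi> s n i) = (r, t, j, m)"
  have j1: "1 \<le> j" and jL: "j \<le> L r" using j lL[of r] by auto
  have Fm: "m \<in> A (L r) \<and> m \<noteq> n \<and> (\<exists>i. L q < i \<and> \<phi> t m j = \<phi> s n i)" if m: "m \<in> F" for m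
  proof -
    obtain i where i: "i \<in> I" "source (\<phi> s n i) = (r, t, j, m)" using ex m by blast
    have c: "\<phi> s n i \<in> site ` blocks" using cov[OF i(1)] by blast
    have m': "m \<in> A (L r)" "\<phi> t m j = \<phi> s n i" using sourceE[OF c] i(2) by (metis prod.inject)+
    have mn: "m \<noteq> n" using cov[OF i(1)] i(2) by auto
    have "L q < i"
    proof (rule ccontr)
      assume "\<not> L q < i"
      then have "i \<in> {1..L q}" using i(1) I(2) by auto
      then have "\<phi> s n i \<in> \<phi> s n ` {1..L q}" by (rule imageI)
      moreover have "\<phi> t m j \<in> \<phi> t m ` {1..L r}" using j1 jL by (intro imageI) auto
      ultimately show False using A_sep[OF L1 L1 m'(1) n mn t s] m'(2) by auto
    qed
    with m' mn show ?thesis by blast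
  qed
  have \<epsilon>L: "0 \<le> \<epsilon> (L (max q r))" by (intro \<epsilon>0 L1)
  have tail: "0 \<le> inverse_weight_tail t j (L (max q r))" by (intro tail_nonneg t j1)
  show "(\<Sum>m\<in>F. norm (W s (iter_inv (f s) n (\<phi> t m j)) n / W t j m) powr p)
        \<le> \<epsilon> (L (max q r)) + inverse_weight_tail t j (L (max q r))"
  proof (cases "s = t")
    case False
    show ?thesis
    proof (cases "q \<le> r")
      case True
      have "(\<Sum>m\<in>F. norm (W s (iter_inv (f s) n (\<phi> t m j)) n / W t j m) powr p) \<le> \<epsilon> (L r)"
        by (rule crosses_laterD[OF later j1 jL L1 n s t False F]) (use Fm in fastforce)
      then show ?thesis using tail True by (simp add: max_def)
    next
      case rq: False
      then have "L r < L q" using L_mono by (simp add: strict_mono_less)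
      then have "(\<Sum>m\<in>F. norm (W s (iter_inv (f s) n (\<phi> t m j)) n / W t j m) powr p) \<le> \<epsilon> (L q)"
        by (rule crosses_earlierD[OF earlier j1 jL _ n s t False F]) (use Fm in fastforce)
      then show ?thesis using tail rq by (simp add: max_def)
    qed
  next
    case st: True
    have gap: "n + L (max q r) \<le> m \<and> W s (iter_inv (f s) n (\<phi> t m j)) n / W t j m = 1 / W t j (m - n)"
      if m: "m \<in> F" for m
    proof -
      obtain i where i: "m \<in> A (L r)" "m \<noteq> n" "L q < i" "\<phi> s m j = \<phi> s n i" using Fm[OF m] st by auto
      have i1: "1 \<le> i" using i(3) by simp
      have "\<not> m < n"
      proof
        assume mn: "m < n"
        then have "\<phi> s m (\<phi> s (n - m) i) = \<phi> s m j"
          using iter_split[OF data[OF s], of m n i] i(4) by simp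
        then have "j = \<phi> s (n - m) i"
          using iter_inj[OF data[OF s]] iter_pos[OF data[OF s] i1] j1 by auto
        then have "\<phi> s (n - m) 1 \<le> L r"
          using iter_le[OF data[OF s] order_refl i1, of "n - m"] jL by simp
        then have "\<phi> s n 1 \<in> \<phi> s m ` {1..L r}"
          using iter_split[OF data[OF s], of m n 1] mn iter_pos[OF data[OF s], of 1 "n - m"] by auto
        moreover have "\<phi> s n 1 \<in> \<phi> s n ` {1..L q}" using L1[of q] by auto
        ultimately show False using A_sep[OF L1 L1 i(1) n i(2) s s] by auto
      qed
      then have nm: "n < m" using i(2) by simp
      then have "n + max (L q) (L r) \<le> m" using A_gap[OF L1 L1 i(1) n] by simp
      moreover have "max (L q) (L r) = L (max q r)"
        using L_mono by (simp add: max_def strict_mono_less_eq)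
      moreover have ij: "i = \<phi> s (m - n) j"
        using iter_split[OF data[OF s], of n m j] nm i(4)
          iter_inj[OF data[OF s] i1 iter_pos[OF data[OF s] j1]] by simp
      moreover have "iter_inv (f s) n (\<phi> s m j) = i"
        using iter_inv_iter[OF data[OF s] i1] i(4) by simp
      moreover have "W s j m = W s j (m - n) * W s i n"
        using weight_prod_add[of "f s" "w s" j "m - n" n] nm ij by simp
      ultimately show ?thesis using W_nz[OF s i1, of n] W_nz[OF s j1] st by simp
    qed
    have "(\<Sum>m\<in>F. norm (W s (iter_inv (f s) n (\<phi> t m j)) n / W t j m) powr p)
       = (\<Sum>m\<in>F. norm (1 / W t j (m - n)) powr p)"
    proof (rule sum.cong[OF refl])
      fix m assume "m \<in> F"
      from conjunct2[OF gap[OF this]]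
      show "norm (W s (iter_inv (f s) n (\<phi> t m j)) n / W t j m) powr p = norm (1 / W t j (m - n)) powr p"
        by (rule arg_cong)
    qed
    also have "\<dots> = (\<Sum>d\<in>(\<lambda>m. m - n) ` F. norm (1 / W t j d) powr p)"
    proof (subst sum.reindex)
      show "inj_on (\<lambda>m. m - n) F"
      proof (rule inj_onI)
        fix m m' assume "m \<in> F" "m' \<in> F" "m - n = m' - n"
        moreover have "n + L (max q r) \<le> m" "n + L (max q r) \<le> m'"
          using conjunct1[OF gap] \<open>m \<in> F\<close> \<open>m' \<in> F\<close> by blast+
        ultimately show "m = m'" by linarith
      qed
    qed simp
    also have "\<dots> \<le> inverse_weight_tail t j (L (max q r))"
    proof (rule inverse_weight_tail_ge[OF W_sum[OF t j1]])
      show "(\<lambda>m. m - n) ` F \<subseteq> {L (max q r)..}"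
      proof
        fix d assume "d \<in> (\<lambda>m. m - n) ` F"
        then obtain m where "m \<in> F" "d = m - n" by blast
        with conjunct1[OF gap, of m] show "d \<in> {L (max q r)..}" by simp
      qed
    qed (use F in simp)
    finally show ?thesis using \<epsilon>L by simp
  qed
qed

lemma orbit_near_target:
  assumes s: "s \<in> {1..N}" and n: "n \<in> A (L q)"
  shows "(pseudo_shift (f s) (w s) ^^ n) vec \<in> lp p"
    "lp_dist p ((pseudo_shift (f s) (w s) ^^ n) vec) (target q s) \<le> (3 * (1/2) ^ q) powr (1 / p)"
proof -
  define D where "D i = (pseudo_shift (f s) (w s) ^^ n) vec i - target q s i" for i
  have D0: "D 0 = 0" by (simp add: D_def pseudo_shift_iter_0 vec_0 target_def)
  have Di: "D i = W s i n * vec (\<phi> s n i) - target q s i" if "1 \<le> i" for i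
    using pseudo_shift_iter[OF data[OF s] that] by (simp add: D_def)
  have head: "\<phi> s n i \<in> site ` blocks \<and> (\<exists>r t j. source (\<phi> s n i) = (r, t, j, n))" if "1 \<le> i" "i \<le> l q" for i
  proof -
    have "(q, s, i, n) \<in> blocks" using that s n by (simp add: blocks_def)
    moreover have "site (q, s, i, n) = \<phi> s n i" by (simp add: site_def)
    ultimately have c: "\<phi> s n i \<in> site ` blocks" by (metis imageI)
    obtain r t j m where src: "source (\<phi> s n i) = (r, t, j, m)" "t \<in> {1..N}" "j \<in> {1..l r}"
      "m \<in> A (L r)" "\<phi> t m j = \<phi> s n i"
      using sourceE[OF c] by metis
    have "m = n"
    proof (rule ccontr)
      assume mn: "m \<noteq> n"
      have "\<phi> t m j \<in> \<phi> t m ` {1..L r}" using src(3) lL[of r] by (intro imageI) auto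
      moreover have "\<phi> s n i \<in> \<phi> s n ` {1..L q}" using that lL[of q] by (intro imageI) auto
      ultimately show False using A_sep[OF L1 L1 src(4) n mn src(2) s] src(5) by auto
    qed
    with c src(1) show ?thesis by auto
  qed
  have fin: "(\<Sum>i\<in>F. norm (D i) powr p) \<le> 3 * (1/2) ^ q" if F: "finite F" "F \<subseteq> {1..}" for F
  proof -
    define C where "C = {i\<in>F. \<phi> s n i \<in> site ` blocks}"
    define C1 where "C1 = {i\<in>C. \<exists>r t j. source (\<phi> s n i) = (r, t, j, n)}"
    have sub: "finite C1" "finite (C - C1)" "C1 \<subseteq> {1..}" "C - C1 \<subseteq> {1..}" "C1 \<subseteq> C" "finite C" "C \<subseteq> F"
      using F by (auto simp: C_def C1_def)
    have tz: "target q s i = 0" if "i \<in> F - C1" for i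
    proof (rule ccontr)
      assume "target q s i \<noteq> 0"
      then have "1 \<le> i" "i \<le> l q" by (auto simp: target_def split: if_splits)
      from head[OF this] that show False by (auto simp: C1_def C_def)
    qed
    have "(\<Sum>i\<in>F. norm (D i) powr p) = (\<Sum>i\<in>C. norm (D i) powr p)"
    proof (intro sum.mono_neutral_right ballI F(1) sub)
      fix i assume i: "i \<in> F - C"
      then have "target q s i = 0" using tz[of i] sub by auto
      moreover have "vec (\<phi> s n i) = 0" using i by (simp add: C_def vec_def)
      moreover have "1 \<le> i" using i F by auto
      ultimately show "norm (D i) powr p = 0" using p by (simp add: Di)
    qed
    also have "\<dots> = (\<Sum>i\<in>C - C1. norm (D i) powr p) + (\<Sum>i\<in>C1. norm (D i) powr p)"
      by (intro sum.subset_diff sub)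
    finally have split: "(\<Sum>i\<in>F. norm (D i) powr p) =
        (\<Sum>i\<in>C - C1. norm (D i) powr p) + (\<Sum>i\<in>C1. norm (D i) powr p)" .
    have "(\<Sum>i\<in>C1. norm (D i) powr p) = (\<Sum>i\<in>C1. norm (W s i n * vec (\<phi> s n i) - target q s i) powr p)"
      using sub(3) by (intro sum.cong) (auto simp: Di)
    moreover have "(\<Sum>i\<in>C1. norm (W s i n * vec (\<phi> s n i) - target q s i) powr p) \<le> (1/2) ^ q"
      by (intro active_block_sum_le s n sub) (auto simp: C1_def C_def)
    moreover have "(\<Sum>i\<in>C - C1. norm (D i) powr p) = (\<Sum>i\<in>C - C1. norm (W s i n * vec (\<phi> s n i)) powr p)"
    proof (rule sum.cong[OF refl])
      fix i assume i: "i \<in> C - C1"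
      then have "1 \<le> i" "i \<in> F - C1" using sub(4,7) by auto
      then show "norm (D i) powr p = norm (W s i n * vec (\<phi> s n i)) powr p" using tz by (simp add: Di)
    qed
    moreover have "(\<Sum>i\<in>C - C1. norm (W s i n * vec (\<phi> s n i)) powr p) \<le> 2 * (1/2) ^ q"
    proof (intro inactive_blocks_sum_le s n sub)
      fix i assume "i \<in> C - C1"
      moreover obtain r t j m where "source (\<phi> s n i) = (r, t, j, m)" by (metis prod_cases4)
      ultimately show "\<phi> s n i \<in> site ` blocks \<and> (\<exists>r t j m. source (\<phi> s n i) = (r, t, j, m) \<and> m \<noteq> n)"
        by (auto simp: C1_def C_def)
    qed
    ultimately show ?thesis using split by linarith
  qed
  have D: "D \<in> lp p" "lp_norm p D \<le> (3 * (1/2) ^ q) powr (1 / p)"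
    using lp_of_finite_sums[where z = D, OF p D0 _ fin] by auto
  then show "lp_dist p ((pseudo_shift (f s) (w s) ^^ n) vec) (target q s) \<le> (3 * (1/2) ^ q) powr (1 / p)"
    by (simp add: lp_dist_def D_def[abs_def])
  have "target q s \<in> lp p" by (rule lp_finite_support[of "l q"]) (auto simp: target_def)
  from lp_add[OF p D(1) this] show "(pseudo_shift (f s) (w s) ^^ n) vec \<in> lp p"
    by (simp add: D_def)
qed

end

section \<open>The conditions are sufficient\<close>

context pseudo_shifts
begin

lemma interaction_tendsto:
  assumes "\<epsilon> \<longlonglongrightarrow> 0"
    and "\<And>s j. s \<in> {1..N} \<Longrightarrow> 1 \<le> j \<Longrightarrow> summable (\<lambda>n. norm (1 / W s j n) powr p)"
  shows "interaction \<epsilon> b l \<longlonglongrightarrow> 0"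
proof -
  have "(\<lambda>K. \<Sum>t\<in>{1..N}. \<Sum>j\<in>{1..l}. norm (b t j) powr p * (\<epsilon> K + inverse_weight_tail t j K))
      \<longlonglongrightarrow> (\<Sum>t\<in>{1..N}. \<Sum>j\<in>{1..l}. norm (b t j) powr p * (0 + 0))"
    using assms by (intro tendsto_intros inverse_weight_tail_tendsto) auto
  then show ?thesis by (simp add: interaction_def[abs_def])
qed

lemma truncated_approximation:
  assumes v: "\<And>s. s \<in> {1..N} \<Longrightarrow> v s \<in> lp p" and \<eta>: "0 < \<eta>"
    and Q: "\<And>(a :: nat \<Rightarrow> nat \<Rightarrow> 'a) \<eta> K. 0 < \<eta> \<Longrightarrow> \<exists>i. \<forall>s\<le>K. \<forall>j\<le>K. norm (Q i s j - a s j) < \<eta>"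
  shows "\<exists>l0 i. \<forall>s\<in>{1..N}.
    lp_dist p (v s) (\<lambda>j. if 1 \<le> j \<and> j \<le> Suc l0 then Q i s j else 0) \<le> \<eta> powr (1 / p)"
proof -
  have sm: "summable (\<lambda>j. norm (v s j) powr p)" if "s \<in> {1..N}" for s using v[OF that] by (simp add: lp_def)
  have "eventually (\<lambda>K. \<forall>s\<in>{1..N}. (\<Sum>j. norm (v s j) powr p) - (\<Sum>j<K. norm (v s j) powr p) < \<eta> / 2) sequentially"
  proof (intro eventually_ball_finite ballI)
    fix s assume s: "s \<in> {1..N}"
    have "(\<lambda>K. (\<Sum>j. norm (v s j) powr p) - (\<Sum>j<K. norm (v s j) powr p)) \<longlonglongrightarrow>
        (\<Sum>j. norm (v s j) powr p) - (\<Sum>j. norm (v s j) powr p)"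
      by (intro tendsto_diff tendsto_const summable_LIMSEQ sm s)
    then show "eventually (\<lambda>K. (\<Sum>j. norm (v s j) powr p) - (\<Sum>j<K. norm (v s j) powr p) < \<eta> / 2) sequentially"
      using \<eta> by (intro order_tendstoD(2)[where y = 0]) auto
  qed simp
  then obtain K where K: "\<And>s. s \<in> {1..N} \<Longrightarrow> (\<Sum>j. norm (v s j) powr p) - (\<Sum>j<K. norm (v s j) powr p) < \<eta> / 2"
    unfolding eventually_sequentially by blast
  define \<eta>' where "\<eta>' = (\<eta> / (2 * real (Suc K))) powr (1 / p)"
  have "0 < \<eta>'" using \<eta> by (simp add: \<eta>'_def)
  then obtain i where i: "\<And>s j. s \<le> N + Suc K \<Longrightarrow> j \<le> N + Suc K \<Longrightarrow> norm (Q i s j - v s j) < \<eta>'"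
    using Q[of \<eta>' "N + Suc K" v] by blast
  have "lp_dist p (v s) (\<lambda>j. if 1 \<le> j \<and> j \<le> Suc K then Q i s j else 0) \<le> \<eta> powr (1 / p)"
    if s: "s \<in> {1..N}" for s
  proof -
    define z where "z j = v s j - (if 1 \<le> j \<and> j \<le> Suc K then Q i s j else 0)" for j
    have z0: "z 0 = 0" using v[OF s] by (simp add: z_def lp_def)
    have "(\<Sum>j\<in>F. norm (z j) powr p) \<le> \<eta>" if F: "finite F" "F \<subseteq> {1..}" for F
    proof -
      let ?G = "F \<inter> {1..Suc K}" and ?H = "F - {1..Suc K}"
      have split: "(\<Sum>j\<in>F. norm (z j) powr p) = (\<Sum>j\<in>?G. norm (z j) powr p) + (\<Sum>j\<in>?H. norm (z j) powr p)"
        using F(1) by (rule sum.Int_Diff)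
      have "(\<Sum>j\<in>?G. norm (z j) powr p) \<le> (\<Sum>j\<in>?G. \<eta> / (2 * real (Suc K)))"
      proof (intro sum_mono)
        fix j assume j: "j \<in> ?G"
        have "norm (z j) \<le> \<eta>'" using i[of s j] j s by (simp add: z_def norm_minus_commute)
        then have "norm (z j) powr p \<le> \<eta>' powr p" using p by (intro powr_mono2) auto
        also have "\<dots> = \<eta> / (2 * real (Suc K))" using \<eta> p by (simp add: \<eta>'_def powr_powr)
        finally show "norm (z j) powr p \<le> \<eta> / (2 * real (Suc K))" .
      qed
      also have "\<dots> = real (card ?G) * (\<eta> / (2 * real (Suc K)))" by simp
      also have "\<dots> \<le> real (Suc K) * (\<eta> / (2 * real (Suc K)))"
      proof -
        have "card ?G \<le> card {1..Suc K}" by (intro card_mono) auto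
        then show ?thesis using \<eta> by (intro mult_right_mono) auto
      qed
      also have "\<dots> = \<eta> / 2" by (simp add: field_simps)
      finally have 1: "(\<Sum>j\<in>?G. norm (z j) powr p) \<le> \<eta> / 2" .
      have "(\<Sum>j\<in>?H. norm (z j) powr p) = (\<Sum>j\<in>?H. norm (v s j) powr p)"
        using F(2) by (intro sum.cong) (auto simp: z_def)
      moreover have "(\<Sum>j\<in>?H. norm (v s j) powr p) + (\<Sum>j<K. norm (v s j) powr p)
          = (\<Sum>j\<in>?H \<union> {..<K}. norm (v s j) powr p)"
        using F by (intro sum.union_disjoint[symmetric]) auto
      moreover have "(\<Sum>j\<in>?H \<union> {..<K}. norm (v s j) powr p) \<le> (\<Sum>j. norm (v s j) powr p)"
        using F by (intro sum_le_suminf sm s) auto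
      ultimately show ?thesis using K[OF s] 1 split by linarith
    qed
    then have "lp_norm p z \<le> \<eta> powr (1 / p)"
      using lp_of_finite_sums(2)[where z = z and c = \<eta>, OF p z0] \<eta> by auto
    then show ?thesis by (simp add: lp_dist_def z_def[abs_def])
  qed
  then show ?thesis by blast
qed

text \<open>
  The arrays are enumerated with infinite repetition, and \<open>L q\<close> is chosen recursively, so large that the
  blocks up to \<open>q\<close> are negligible at stage \<open>q\<close>. Given open sets,
  some array approximates points of them, and it recurs at a stage where the error of the block vector is
  as small as desired.
\<close>

lemma disjoint_hypercyclic_if:
  assumes N: "1 \<le> N" and fam: "\<A> \<in> {fam_uBd, fam_ud, fam_ld}"
    and wpr: "weakly_partition_regular \<A> N f"
    and B: "\<And>k. 1 \<le> k \<Longrightarrow> B k \<in> \<A>" and \<epsilon>: "\<And>k. 1 \<le> k \<Longrightarrow> 0 < \<epsilon> k" "\<epsilon> \<longlonglongrightarrow> 0"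
    and W_nz: "\<And>s j n. s \<in> {1..N} \<Longrightarrow> 1 \<le> j \<Longrightarrow> W s j n \<noteq> 0"
    and W_sum: "\<And>s j. s \<in> {1..N} \<Longrightarrow> 1 \<le> j \<Longrightarrow> summable (\<lambda>n. norm (1 / W s j n) powr p)"
    and later: "crosses_later B \<epsilon>" and earlier: "crosses_earlier B \<epsilon>" and ratios: "ratios_dense B"
  shows "disjoint_hypercyclic (lp_topology p) \<A> N (\<lambda>s. pseudo_shift (f s) (w s))"
proof -
  have one: "1 \<in> {1..N}" using N by simp
  obtain A where A: "\<And>l. 1 \<le> l \<Longrightarrow> A l \<in> \<A>" "\<And>l. 1 \<le> l \<Longrightarrow> A l \<subseteq> B l"
    and sc: "scattered N f A"
    using scattered_refinement[of \<A> N f "w 1" B, OF fam N data[OF one] wpr B] by blast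
  obtain Q :: "nat \<Rightarrow> nat \<Rightarrow> nat \<Rightarrow> 'a" where Q: "\<And>i s j. Q i s j \<noteq> 0"
    "\<And>a \<eta> K. 0 < \<eta> \<Longrightarrow> \<exists>i. \<forall>s\<le>K. \<forall>j\<le>K. norm (Q i s j - a s j) < \<eta>"
    using dense_nonzero_arrays by metis
  \<comment> \<open>The number \<open>q\<close> codes \<open>((l0, i), r)\<close>; letting \<open>r\<close> vary makes each array recur at arbitrarily
    large \<open>q\<close>.\<close>
  define l where "l q = Suc (fst (prod_decode (fst (prod_decode q))))" for q
  define a where "a q = Q (snd (prod_decode (fst (prod_decode q))))" for q
  define R where "R q = (\<Sum>t\<in>{1..N}. \<Sum>j\<in>{1..l q}. norm (a q t j) powr p)" for q
  define \<delta> where "\<delta> q = ((1/2) ^ q / (1 + R q)) powr (1 / p)" for q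
  have R0: "0 \<le> R q" for q unfolding R_def by (intro sum_nonneg) auto
  have \<delta>0: "0 < \<delta> q" for q using R0[of q] by (auto simp: \<delta>_def)
  have \<delta>R: "\<delta> q powr p * R q \<le> (1/2) ^ q" for q
  proof -
    have "\<delta> q powr p = (1/2) ^ q / (1 + R q)" using p R0[of q] by (simp add: \<delta>_def powr_powr)
    then have "\<delta> q powr p * R q = (1/2) ^ q * (R q / (1 + R q))" by simp
    moreover have "R q / (1 + R q) \<le> 1" using R0[of q] by simp
    ultimately show ?thesis by (simp only: mult_left_le zero_le_power zero_le_divide_1_iff zero_le_numeral)
  qed
  have a0: "a q s j \<noteq> 0" for q s j by (simp add: a_def Q)
  have l1: "1 \<le> l q" for q by (simp add: l_def)
  have "\<forall>q. \<exists>K0. \<forall>K\<ge>K0. (\<Sum>r\<le>q. interaction \<epsilon> (a r) (l r) K) \<le> (1/2) ^ q"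
  proof
    fix q
    have "(\<lambda>K. \<Sum>r\<le>q. interaction \<epsilon> (a r) (l r) K) \<longlonglongrightarrow> (\<Sum>r\<le>q. 0)"
      by (intro tendsto_sum interaction_tendsto \<epsilon>(2) W_sum)
    then have "eventually (\<lambda>K. (\<Sum>r\<le>q. interaction \<epsilon> (a r) (l r) K) < (1/2) ^ q) sequentially"
      by (intro order_tendstoD(2)) auto
    then show "\<exists>K0. \<forall>K\<ge>K0. (\<Sum>r\<le>q. interaction \<epsilon> (a r) (l r) K) \<le> (1/2) ^ q"
      by (auto simp: eventually_sequentially intro: less_imp_le)
  qed
  then obtain K0 where K0: "\<And>q K. K0 q \<le> K \<Longrightarrow> (\<Sum>r\<le>q. interaction \<epsilon> (a r) (l r) K) \<le> (1/2) ^ q"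
    by metis
  have step: "\<exists>L\<ge>max (l q) M. ratios_at (B L) (l q) (a q) (\<delta> q)" for q M
    by (rule ratios_dense_beyond[OF ratios l1 \<delta>0]) (rule a0)
  have "\<exists>L. \<forall>q. (L q \<ge> max (l q) (K0 q) \<and> ratios_at (B (L q)) (l q) (a q) (\<delta> q)) \<and> L q < L (Suc q)"
  proof (rule dependent_nat_choice)
    show "\<exists>x\<ge>max (l 0) (K0 0). ratios_at (B x) (l 0) (a 0) (\<delta> 0)" by (rule step)
    fix x q
    obtain L where "L \<ge> max (l (Suc q)) (max (K0 (Suc q)) (Suc x))"
      "ratios_at (B L) (l (Suc q)) (a (Suc q)) (\<delta> (Suc q))"
      using step by blast
    then show "\<exists>y. (max (l (Suc q)) (K0 (Suc q)) \<le> y \<and> ratios_at (B y) (l (Suc q)) (a (Suc q)) (\<delta> (Suc q))) \<and> x < y"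
      by (intro exI[of _ L]) auto
  qed
  then obtain L where L: "\<And>q. max (l q) (K0 q) \<le> L q" "\<And>q. ratios_at (B (L q)) (l q) (a q) (\<delta> q)"
    "\<And>q. L q < L (Suc q)" by blast
  have L1: "1 \<le> L q" for q using L(1)[of q] l1[of q] by linarith
  interpret block_vector N p f w A \<epsilon> a \<delta> l L
  proof
    show "W s j n \<noteq> 0" if "s \<in> {1..N}" "1 \<le> j" for s j n by (rule W_nz[OF that])
    show "summable (\<lambda>n. norm (1 / W s j n) powr p)" if "s \<in> {1..N}" "1 \<le> j" for s j by (rule W_sum[OF that])
    show "0 \<le> \<epsilon> k" if "1 \<le> k" for k using \<epsilon>(1)[OF that] by simp
    show "crosses_later A \<epsilon>" by (rule crosses_later_subset[OF A(2) later])
    show "crosses_earlier A \<epsilon>" by (rule crosses_earlier_subset[OF A(2) earlier])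
    show "ratios_at (A (L q)) (l q) (a q) (\<delta> q)" for q
      using L(2)[of q] A(2)[OF L1, of q] unfolding ratios_at_def by blast
    show "l q \<le> L q" for q using L(1)[of q] by simp
    show "strict_mono L" using L(3) by (simp add: strict_mono_Suc_iff)
    show "(\<Sum>r\<le>q. interaction \<epsilon> (a r) (l r) (L q)) \<le> (1/2) ^ q" for q
      using L(1)[of q] by (intro K0) simp
    show "\<delta> q powr p * (\<Sum>t\<in>{1..N}. \<Sum>j\<in>{1..l q}. norm (a q t j) powr p) \<le> (1/2) ^ q" for q
      using \<delta>R[of q] by (simp add: R_def)
    show "0 \<le> \<delta> q" for q using \<delta>0[of q] by simp
  qed (fact l1 sc a0)+
  interpret M: Metric_space "lp p" "lp_dist p :: (nat \<Rightarrow> 'a) \<Rightarrow> _" by (rule Metric_space_lp[OF p])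
  show ?thesis
    unfolding disjoint_hypercyclic_def
  proof (intro bexI[of _ vec] allI impI)
    show "vec \<in> topspace (lp_topology p)" using vec_in_lp by (simp add: lp_topology_def)
    fix V :: "nat \<Rightarrow> (nat \<Rightarrow> 'a) set"
    assume V: "\<forall>s\<in>{1..N}. openin (lp_topology p) (V s) \<and> V s \<noteq> {}"
    have "\<exists>v \<rho>. v \<in> lp p \<and> 0 < \<rho> \<and> M.mball v \<rho> \<subseteq> V s" if s: "s \<in> {1..N}" for s
    proof -
      obtain v where "v \<in> V s" using V s by blast
      then show ?thesis using V s unfolding lp_topology_def M.openin_mtopology by blast
    qed
    then obtain v \<rho> where v: "\<And>s. s \<in> {1..N} \<Longrightarrow> v s \<in> lp p"
      and \<rho>: "\<And>s. s \<in> {1..N} \<Longrightarrow> 0 < \<rho> s" and ball: "\<And>s. s \<in> {1..N} \<Longrightarrow> M.mball (v s) (\<rho> s) \<subseteq> V s"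
      by metis
    obtain \<mu> where \<mu>: "0 < \<mu>" "\<And>s. s \<in> {1..N} \<Longrightarrow> \<mu> \<le> \<rho> s"
      by (rule finite_positive_lower_bound[of "{1..N}" \<rho>]) (use \<rho> in auto)
    define \<eta> where "\<eta> = (\<mu> / 4) powr p"
    have \<eta>: "0 < \<eta>" "\<eta> powr (1 / p) = \<mu> / 4" using \<mu>(1) p by (auto simp: \<eta>_def powr_powr)
    obtain l0 i where li: "\<And>s. s \<in> {1..N} \<Longrightarrow>
        lp_dist p (v s) (\<lambda>j. if 1 \<le> j \<and> j \<le> Suc l0 then Q i s j else 0) \<le> \<mu> / 4"
      using truncated_approximation[of v \<eta> Q, OF v \<eta>(1) Q(2)] unfolding \<eta>(2) by blast
    obtain r where r: "(1/2::real) ^ r < \<eta> / 3" using real_arch_pow_inv[of "\<eta> / 3" "1/2"] \<eta>(1) by auto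
    define q where "q = prod_encode (prod_encode (l0, i), r)"
    have "r \<le> q" unfolding q_def by (rule le_prod_encode_2)
    then have "(1/2::real) ^ q \<le> (1/2) ^ r" by (intro power_decreasing) auto
    then have "3 * (1/2::real) ^ q \<le> \<eta>" using r by linarith
    then have q: "(3 * (1/2::real) ^ q) powr (1 / p) \<le> \<mu> / 4"
      unfolding \<eta>(2)[symmetric] using p by (intro powr_mono2) auto
    have tq: "target q s = (\<lambda>j. if 1 \<le> j \<and> j \<le> Suc l0 then Q i s j else 0)" for s
      by (rule ext) (simp add: target_def l_def a_def q_def)
    have "A (L q) \<subseteq> {n. 1 \<le> n \<and> (\<forall>s\<in>{1..N}. (pseudo_shift (f s) (w s) ^^ n) vec \<in> V s)}"
    proof (intro subsetI CollectI conjI ballI)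
      fix n assume n: "n \<in> A (L q)"
      show "1 \<le> n" using scattered_late[OF sc n L1] L1[of q] by linarith
      fix s assume s: "s \<in> {1..N}"
      let ?y = "(pseudo_shift (f s) (w s) ^^ n) vec"
      have y: "?y \<in> lp p" "lp_dist p ?y (target q s) \<le> \<mu> / 4"
        using orbit_near_target[OF s n] q by auto
      have t: "target q s \<in> lp p" by (rule lp_finite_support[of "l q"]) (auto simp: target_def)
      have "lp_dist p (v s) ?y \<le> lp_dist p (v s) (target q s) + lp_dist p (target q s) ?y"
        by (rule M.triangle[OF v[OF s] t y(1)])
      also have "lp_dist p (target q s) ?y = lp_dist p ?y (target q s)" by (rule M.commute)
      finally have "lp_dist p (v s) ?y < \<rho> s"
        using y(2) li[OF s] \<mu>(1) \<mu>(2)[OF s] unfolding tq by linarith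
      then show "?y \<in> V s" using ball[OF s] v[OF s] y(1) by (auto simp: M.mball_def)
    qed
    then show "{n. 1 \<le> n \<and> (\<forall>s\<in>{1..N}. (pseudo_shift (f s) (w s) ^^ n) vec \<in> V s)} \<in> \<A>"
      using family_superset[OF fam A(1)[OF L1]] by blast
  qed
qed

end

section \<open>The conditions are necessary\<close>

lemma quotient_perturbation:
  fixes u v b c :: "'b::real_normed_field"
  assumes "norm (u - b) \<le> \<eta>" "norm (v - c) \<le> \<eta>" "\<mu> \<le> norm c" "norm b \<le> M" "0 < \<mu>" "\<eta> \<le> \<mu> / 2"
  shows "norm (u / v - b / c) \<le> \<eta> * (2 / \<mu> + 2 * M / \<mu>\<^sup>2)" "\<mu> / 2 \<le> norm v"
proof -
  have "norm c - norm v \<le> norm (v - c)" by (metis norm_minus_commute norm_triangle_ineq2)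
  then show v: "\<mu> / 2 \<le> norm v" using assms by linarith
  have nz: "v \<noteq> 0" "c \<noteq> 0" using v assms by auto
  have \<eta>0: "0 \<le> \<eta>" by (rule order_trans[OF norm_ge_zero assms(1)])
  have M0: "0 \<le> M" by (rule order_trans[OF norm_ge_zero assms(4)])
  have "u / v - b / c = (u - b) / v - b * (v - c) / (v * c)"
    using nz by (simp add: field_simps)
  then have "norm (u / v - b / c) \<le> norm (u - b) / norm v + norm b * norm (v - c) / (norm v * norm c)"
    by (metis norm_divide norm_mult norm_triangle_ineq4)
  also have "norm (u - b) / norm v \<le> \<eta> / (\<mu> / 2)"
    using v assms \<eta>0 by (intro frac_le) auto
  also have "norm b * norm (v - c) / (norm v * norm c) \<le> M * \<eta> / (\<mu> / 2 * \<mu>)"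
    using v assms M0 \<eta>0 by (intro frac_le mult_mono mult_nonneg_nonneg) auto
  finally show "norm (u / v - b / c) \<le> \<eta> * (2 / \<mu> + 2 * M / \<mu>\<^sup>2)"
    using assms(5) by (simp add: field_simps power2_eq_square)
qed

context pseudo_shifts
begin

lemma powr_le_imp_le: "u powr p \<le> v powr p \<Longrightarrow> 0 \<le> v \<Longrightarrow> u \<le> v" for u v :: real
  using p powr_less_mono2[of p v u] by (cases "u \<le> v") auto

text \<open>
  At the times in \<open>B\<close> the orbits of \<open>x\<close> are within \<open>\<delta>\<close> of the respective \<open>y s\<close>.
\<close>

definition tracks :: "(nat \<Rightarrow> 'a) \<Rightarrow> nat set \<Rightarrow> (nat \<Rightarrow> nat \<Rightarrow> 'a) \<Rightarrow> real \<Rightarrow> bool" where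
  "tracks x B y \<delta> \<longleftrightarrow> (\<forall>n\<in>B. \<forall>s\<in>{1..N}. \<forall>F. finite F \<longrightarrow> F \<subseteq> {1..} \<longrightarrow>
     (\<Sum>i\<in>F. norm (W s i n * x (\<phi> s n i) - y s i) powr p) \<le> \<delta> powr p)"

lemma tracksD:
  "tracks x B y \<delta> \<Longrightarrow> n \<in> B \<Longrightarrow> s \<in> {1..N} \<Longrightarrow> finite F \<Longrightarrow> F \<subseteq> {1..} \<Longrightarrow>
     (\<Sum>i\<in>F. norm (W s i n * x (\<phi> s n i) - y s i) powr p) \<le> \<delta> powr p"
  by (simp add: tracks_def)

lemma orbit_visits:
  assumes "disjoint_hypercyclic (lp_topology p) \<A> N (\<lambda>s. pseudo_shift (f s) (w s))"
  shows "\<exists>x. \<forall>y \<delta>. (\<forall>s\<in>{1..N}. y s \<in> lp p) \<longrightarrow> 0 < \<delta> \<longrightarrow> (\<exists>B\<in>\<A>. tracks x B y \<delta>)"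
proof -
  interpret M: Metric_space "lp p" "lp_dist p :: (nat \<Rightarrow> 'a) \<Rightarrow> _" by (rule Metric_space_lp[OF p])
  obtain x where hyp: "\<And>V. \<forall>s\<in>{1..N}. openin (lp_topology p) (V s) \<and> V s \<noteq> {} \<Longrightarrow>
        {n. n \<ge> 1 \<and> (\<forall>s\<in>{1..N}. (pseudo_shift (f s) (w s) ^^ n) x \<in> V s)} \<in> \<A>"
    using assms unfolding disjoint_hypercyclic_def lp_topology_def by auto
  show ?thesis
  proof (intro exI[of _ x] allI impI)
    fix y :: "nat \<Rightarrow> nat \<Rightarrow> 'a" and \<delta> :: real
    assume y: "\<forall>s\<in>{1..N}. y s \<in> lp p" and \<delta>: "0 < \<delta>"
    define V where "V s = M.mball (y s) \<delta>" for s
    have "\<forall>s\<in>{1..N}. openin (lp_topology p) (V s) \<and> V s \<noteq> {}"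
    proof (intro ballI conjI)
      fix s assume "s \<in> {1..N}"
      then have "y s \<in> V s" using y \<delta> by (simp add: V_def M.centre_in_mball_iff)
      then show "V s \<noteq> {}" by blast
      show "openin (lp_topology p) (V s)" by (simp add: V_def lp_topology_def)
    qed
    then have B: "{n. n \<ge> 1 \<and> (\<forall>s\<in>{1..N}. (pseudo_shift (f s) (w s) ^^ n) x \<in> V s)} \<in> \<A>" (is "?B \<in> \<A>")
      by (rule hyp)
    have "(\<Sum>i\<in>F. norm (W s i n * x (\<phi> s n i) - y s i) powr p) \<le> \<delta> powr p"
      if n: "n \<in> ?B" and s: "s \<in> {1..N}" and F: "finite F" "F \<subseteq> {1..}" for n s F
    proof -
      let ?T = "(pseudo_shift (f s) (w s) ^^ n) x"
      define z where "z i = ?T i - y s i" for i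
      have T: "?T \<in> lp p" "lp_dist p (y s) ?T < \<delta>" using n s by (auto simp: V_def M.mball_def)
      have z: "z \<in> lp p" unfolding z_def using T(1) bspec[OF y s] by (rule lp_diff[OF p])
      have zd: "lp_norm p z < \<delta>" using T(2) M.commute[of "y s" ?T] by (simp add: lp_dist_def z_def[abs_def])
      have "(\<Sum>i\<in>F. norm (W s i n * x (\<phi> s n i) - y s i) powr p) = (\<Sum>i\<in>F. norm (z i) powr p)"
        using F(2) by (intro sum.cong) (auto simp: z_def pseudo_shift_iter[OF data[OF s]])
      also have "\<dots> \<le> lp_norm p z powr p" by (rule finite_sum_le_lp_norm[OF p z F(1)])
      also have "\<dots> \<le> \<delta> powr p" using zd p by (intro powr_mono2) (auto simp: lp_norm_def)
      finally show ?thesis .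
    qed
    then have "tracks x ?B y \<delta>" unfolding tracks_def by blast
    then show "\<exists>B\<in>\<A>. tracks x B y \<delta>" using B by blast
  qed
qed

text \<open>
  At a time \<open>n\<close> when the orbit is within \<open>1/2\<close> of the \<open>j\<close>-th unit vector \<open>e\<close>, its entry at \<open>\<phi> s k j\<close> is
  \<open>W s j (n + k) * x (\<phi> s (n + k) j) / W s j k\<close>. If \<open>n + k\<close> is another such time, the modulus of this entry
  is at least \<open>1 / (2 * |W s j k|)\<close>, whereas \<open>e\<close> vanishes there. So the sums over such \<open>k\<close> are bounded, and
  \<open>summable_of_recurrence\<close> applies.
\<close>

lemma weights_if_disjoint_hypercyclic:
  assumes fam: "\<A> \<in> {fam_uBd, fam_ud, fam_ld}"
    and hyp: "disjoint_hypercyclic (lp_topology p) \<A> N (\<lambda>s. pseudo_shift (f s) (w s))"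
    and s: "s \<in> {1..N}" and j: "1 \<le> j"
  shows "W s j k \<noteq> 0" "summable (\<lambda>n. norm (1 / W s j n) powr p)"
proof -
  obtain x where visits: "\<forall>y \<delta>. (\<forall>s\<in>{1..N}. y s \<in> lp p) \<longrightarrow> 0 < \<delta> \<longrightarrow> (\<exists>B\<in>\<A>. tracks x B y \<delta>)"
    using orbit_visits[OF hyp] by (elim exE)
  define e :: "nat \<Rightarrow> 'a" where "e i = (if i = j then 1 else 0)" for i
  have e: "e \<in> lp p" using j by (intro lp_finite_support[of j]) (auto simp: e_def)
  obtain B where B: "B \<in> \<A>" and "tracks x B (\<lambda>_. e) (1/2)"
    using visits[rule_format, of "\<lambda>_. e" "1/2"] e by auto
  note near = tracksD[OF this(2) _ s]
  have large: "1/2 \<le> norm (W s j m * x (\<phi> s m j))" if m: "m \<in> B" for m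
  proof -
    have "norm (W s j m * x (\<phi> s m j) - 1) powr p \<le> (1/2) powr p"
      using near[OF m, of "{j}"] j by (simp add: e_def)
    then have "norm (W s j m * x (\<phi> s m j) - 1) \<le> 1/2" by (rule powr_le_imp_le) simp
    then show ?thesis
      using norm_triangle_ineq2[of 1 "1 - W s j m * x (\<phi> s m j)"] by (simp add: norm_minus_commute)
  qed
  show nz: "W s j k \<noteq> 0" for k
  proof
    assume 0: "W s j k = 0"
    have "B \<inter> {k..} \<in> fam_uBd" by (rule family_uBd[OF fam family_tail[OF fam B]])
    then obtain m where m: "m \<in> B" "k \<le> m" using fam_uBd_nonempty by blast
    have "W s j m = 0"
      using weight_prod_add[of "f s" "w s" j k "m - k"] m(2) 0 by simp
    then show False using large[OF m(1)] by simp
  qed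
  have "bounded (w s ` {1..})" using data[OF s] by (simp add: pseudo_shift_data_def)
  then obtain b0 where b0: "\<And>i. 1 \<le> i \<Longrightarrow> norm (w s i) \<le> b0" unfolding bounded_iff by auto
  define b where "b = max 1 b0"
  have b: "1 \<le> b" "norm (w s i) \<le> b" if "1 \<le> i" for i using b0[OF that] by (auto simp: b_def)
  show "summable (\<lambda>n. norm (1 / W s j n) powr p)"
  proof (rule summable_of_recurrence[OF family_uBd[OF fam B], where C = "b powr p" and c = 1])
    show "1 \<le> b powr p" using b(1)[of 1] p by (simp add: ge_one_powr_ge_zero)
    fix k
    have i: "1 \<le> \<phi> s (Suc k) j" by (rule iter_pos[OF data[OF s] j])
    have "norm (1 / W s j k) = norm (w s (\<phi> s (Suc k) j)) * norm (1 / W s j (Suc k))"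
      using nz[of "Suc k"] by (simp add: weight_prod_Suc norm_divide norm_mult del: funpow.simps)
    also have "\<dots> \<le> b * norm (1 / W s j (Suc k))" using b(2)[OF i] by (intro mult_right_mono) auto
    finally have "norm (1 / W s j k) powr p \<le> (b * norm (1 / W s j (Suc k))) powr p"
      using p by (intro powr_mono2) auto
    also have "\<dots> = b powr p * norm (1 / W s j (Suc k)) powr p"
      using b(1)[of 1] by (intro powr_mult)
    finally show "norm (1 / W s j k) powr p \<le> b powr p * norm (1 / W s j (Suc k)) powr p" .
  next
    fix n K assume n: "n \<in> B"
    define S where "S = {k. k \<in> {1..K} \<and> n + k \<in> B}"
    have finS: "finite S" by (simp add: S_def)
    have inj: "inj_on (\<lambda>k. \<phi> s k j) S"
    proof (rule inj_onI)
      fix k k' assume "\<phi> s k j = \<phi> s k' j"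
      then show "k = k'" using iter_less_time[OF data[OF s] j, of k k'] iter_less_time[OF data[OF s] j, of k' k]
        by (cases k k' rule: linorder_cases) auto
    qed
    have "(\<Sum>k\<in>S. norm (1 / W s j k) powr p) * (1/2) powr p
        = (\<Sum>k\<in>S. (norm (1 / W s j k) * (1/2)) powr p)"
      by (simp only: sum_distrib_right powr_mult norm_ge_zero)
    also have "\<dots> \<le> (\<Sum>k\<in>S. norm (W s (\<phi> s k j) n * x (\<phi> s n (\<phi> s k j)) - e (\<phi> s k j)) powr p)"
    proof (intro sum_mono powr_mono2)
      fix k assume k: "k \<in> S"
      then have "j \<noteq> \<phi> s k j" using iter_ge[OF data[OF s] j, of k] by (auto simp: S_def)
      then have 0: "e (\<phi> s k j) = 0" by (simp add: e_def)
      have it: "\<phi> s n (\<phi> s k j) = \<phi> s (n + k) j" by (simp add: funpow_add)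
      have "W s j (n + k) = W s j k * W s (\<phi> s k j) n"
        using weight_prod_add[of "f s" "w s" j k n] by (simp add: add.commute)
      then have "W s (\<phi> s k j) n * x (\<phi> s n (\<phi> s k j)) = 1 / W s j k * (W s j (n + k) * x (\<phi> s (n + k) j))"
        using nz[of k] it by simp
      then have "norm (W s (\<phi> s k j) n * x (\<phi> s n (\<phi> s k j))) = norm (1 / W s j k) * norm (W s j (n + k) * x (\<phi> s (n + k) j))"
        by (simp only: norm_mult)
      also have "\<dots> \<ge> norm (1 / W s j k) * (1/2)"
        using k by (intro mult_left_mono large) (auto simp: S_def)
      finally show "norm (1 / W s j k) * (1/2) \<le> norm (W s (\<phi> s k j) n * x (\<phi> s n (\<phi> s k j)) - e (\<phi> s k j))"
        using 0 by simp
    qed (use p in auto)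
    also have "\<dots> = (\<Sum>i\<in>(\<lambda>k. \<phi> s k j) ` S. norm (W s i n * x (\<phi> s n i) - e i) powr p)"
      by (subst sum.reindex[OF inj]) simp
    also have "\<dots> \<le> (1/2) powr p"
      using finS iter_pos[OF data[OF s] j] by (intro near n) auto
    finally have "(\<Sum>k\<in>S. norm (1 / W s j k) powr p) * (1/2) powr p \<le> 1 * (1/2) powr p" by simp
    then have "(\<Sum>k\<in>S. norm (1 / W s j k) powr p) \<le> 1" by (rule mult_right_le_imp_le) simp
    then show "(\<Sum>k | k \<in> {1..K} \<and> n + k \<in> B. norm (1 / W s j k) powr p) \<le> 1" by (simp add: S_def)
  qed auto
qed

text \<open>
  Let \<open>X s n i\<close> be the entries of the orbits. At a common site the quotient of weights
  \<open>W s i n / W t j m\<close> equals \<open>X s n i / X t m j\<close>. For \<open>n \<in> A K\<close>, \<open>i > K\<close> and \<open>m \<in> A L\<close>, \<open>j \<le> L\<close> the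
  numerators form a tail of norm at most \<open>1 / (K + 1)\<close> and the denominators are at least \<open>L + 1\<close>. The
  resulting product bound is symmetric in \<open>K\<close> and \<open>L\<close> and yields both cross conditions.

  The number \<open>L\<close> codes \<open>(l, i, r)\<close>, and the target \<open>z L\<close> is the array \<open>Q i\<close> on \<open>[l]\<close>, scaled by
  \<open>(r + 1) * (L + 2)\<close>. Scaling leaves quotients unchanged; for large \<open>r\<close> it makes the absolute
  error of the orbit relatively small, and it makes the entries \<open>L + 2\<close> at the places in \<open>(l, L]\<close> negligible
  against those on \<open>[l]\<close>.
\<close>

lemma conditions_if_disjoint_hypercyclic:
  assumes hyp: "disjoint_hypercyclic (lp_topology p) \<A> N (\<lambda>s. pseudo_shift (f s) (w s))"
  shows "\<exists>A \<epsilon>. (\<forall>k\<ge>1. A k \<in> \<A>) \<and> (\<forall>k\<ge>1. 0 < \<epsilon> k) \<and> \<epsilon> \<longlonglongrightarrow> 0 \<and>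
    crosses_later A \<epsilon> \<and> crosses_earlier A \<epsilon> \<and> ratios_dense A"
proof -
  obtain x where visits: "\<forall>y \<delta>. (\<forall>s\<in>{1..N}. y s \<in> lp p) \<longrightarrow> 0 < \<delta> \<longrightarrow> (\<exists>B\<in>\<A>. tracks x B y \<delta>)"
    using orbit_visits[OF hyp] by (elim exE)
  obtain Q :: "nat \<Rightarrow> nat \<Rightarrow> nat \<Rightarrow> 'a" where
    Q: "\<And>a \<eta> K. 0 < \<eta> \<Longrightarrow> \<exists>i. \<forall>s\<le>K. \<forall>j\<le>K. norm (Q i s j - a s j) < \<eta>"
    using dense_nonzero_arrays by metis
  define l where "l L = fst (prod_decode L)" for L
  define idx where "idx L = fst (prod_decode (snd (prod_decode L)))" for L
  define r where "r L = real (Suc (snd (prod_decode (snd (prod_decode L)))))" for L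
  \<comment> \<open>An entry that the scaling would leave smaller than \<open>L + 2\<close> is replaced by \<open>L + 2\<close>. For a given array
    this no longer happens once \<open>r\<close> is large.\<close>
  define z :: "nat \<Rightarrow> nat \<Rightarrow> nat \<Rightarrow> 'a" where
    "z L s j = (if 1 \<le> j \<and> j \<le> l L \<and> 1 \<le> r L * norm (Q (idx L) s j)
       then of_real (r L * (real L + 2)) * Q (idx L) s j
       else if 1 \<le> j \<and> j \<le> L then of_real (real L + 2) else 0)" for L s j
  have lL: "l L \<le> L" for L
    using le_prod_encode_1[of "fst (prod_decode L)" "snd (prod_decode L)"] by (simp add: l_def)
  have r1: "1 \<le> r L" for L by (simp add: r_def)
  have z_big: "real L + 2 \<le> norm (z L s j)" if "1 \<le> j" "j \<le> L" for L s j
  proof (cases "j \<le> l L \<and> 1 \<le> r L * norm (Q (idx L) s j)")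
    case True
    have "norm (z L s j) = (real L + 2) * (r L * norm (Q (idx L) s j))"
      using True that r1[of L] by (simp add: z_def norm_mult del: of_real_add of_real_mult)
    then show ?thesis using True by (simp add: mult_le_cancel_left1)
  next
    case False
    then have "z L s j = of_real (real L + 2)" using that unfolding z_def by auto
    then show ?thesis by (simp del: of_real_add)
  qed
  have z_lp: "z L s \<in> lp p" for L s
  proof (rule lp_finite_support[of L])
    fix j assume j: "j \<notin> {1..L}"
    then show "z L s j = 0" using lL[of L] by (auto simp: z_def)
  qed
  have "\<forall>L. \<exists>B\<in>\<A>. tracks x B (z L) (1 / (real L + 1))"
  proof
    fix L :: nat
    show "\<exists>B\<in>\<A>. tracks x B (z L) (1 / (real L + 1))"
      by (rule visits[rule_format]) (auto intro: z_lp)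
  qed
  then obtain A where A: "\<And>L. A L \<in> \<A>" and tr: "\<And>L. tracks x (A L) (z L) (1 / (real L + 1))"
    by metis
  note near = tracksD[OF tr]
  define X where "X s n i = W s i n * x (\<phi> s n i)" for s n i
  have near1: "norm (X s n i - z L s i) \<le> 1 / (real L + 1)" if "n \<in> A L" "s \<in> {1..N}" "1 \<le> i" for s n i L
    by (rule powr_le_imp_le) (use near[OF that(1,2), of "{i}"] that(3) in \<open>auto simp: X_def\<close>)
  have near1': "norm (X s n i - z L s i) \<le> 1" if "n \<in> A L" "s \<in> {1..N}" "1 \<le> i" for s n i L
  proof -
    have "1 / (real L + 1) \<le> 1" by simp
    with near1[OF that] show ?thesis by (rule order_trans)
  qed
  have X_big: "real L + 1 \<le> norm (X s n j)" if "n \<in> A L" "s \<in> {1..N}" "1 \<le> j" "j \<le> L" for s n j L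
    using near1'[OF that(1-3)] z_big[OF that(3,4), of s] norm_triangle_ineq2[of "z L s j" "z L s j - X s n j"]
    by (simp add: norm_minus_commute)
  have X_tail: "(\<Sum>i\<in>F. norm (X s n i) powr p) \<le> (1 / (real L + 1)) powr p"
    if "n \<in> A L" "s \<in> {1..N}" "finite F" "F \<subseteq> {L<..}" for s n F L
  proof -
    have "(\<Sum>i\<in>F. norm (X s n i) powr p) = (\<Sum>i\<in>F. norm (W s i n * x (\<phi> s n i) - z L s i) powr p)"
      using that(4) lL[of L] by (intro sum.cong) (auto simp: X_def z_def)
    also have "\<dots> \<le> (1 / (real L + 1)) powr p" using that by (intro near) auto
    finally show ?thesis .
  qed
  have small: "(1 / (real L + 1)) powr p \<le> 1 / (real L + 1)" for L
    using powr_mono'[of 1 p "1 / (real L + 1)"] p by simp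
  have cross: "(\<Sum>m\<in>F. norm (W s (iter_inv (f s) n (\<phi> t m j)) n / W t j m) powr p)
      \<le> (1 / (real L + 1)) powr p * (1 / (real K + 1)) powr p"
    if j: "1 \<le> j" "j \<le> L" and n: "n \<in> A K" and s: "s \<in> {1..N}" and t: "t \<in> {1..N}" and F: "finite F"
      and sub: "F \<subseteq> {m \<in> A L. \<phi> t m j \<in> \<phi> s n ` {K<..}}" for j L K n s t F
  proof -
    define i where "i m = iter_inv (f s) n (\<phi> t m j)" for m
    have i: "K < i m \<and> \<phi> s n (i m) = \<phi> t m j" if m: "m \<in> F" for m
    proof -
      obtain i' where i': "K < i'" "\<phi> t m j = \<phi> s n i'" using sub m by auto
      then have "i m = i'" using iter_inv_iter[OF data[OF s], of i' n] by (simp add: i_def)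
      with i' show ?thesis by simp
    qed
    have inj: "inj_on i F"
    proof (rule inj_onI)
      fix m m' assume m: "m \<in> F" "m' \<in> F" "i m = i m'"
      then have "\<phi> t m j = \<phi> t m' j" using i by metis
      then show "m = m'" using iter_less_time[OF data[OF t] j(1), of m m'] iter_less_time[OF data[OF t] j(1), of m' m]
        by (cases m m' rule: linorder_cases) auto
    qed
    have "(\<Sum>m\<in>F. norm (W s (i m) n / W t j m) powr p)
        \<le> (\<Sum>m\<in>F. (1 / (real L + 1)) powr p * norm (X s n (i m)) powr p)"
    proof (intro sum_mono)
      fix m assume m: "m \<in> F"
      have big: "real L + 1 \<le> norm (X t m j)" using sub m by (intro X_big t j) auto
      then have "X t m j \<noteq> 0" by auto
      then have "W s (i m) n / W t j m = X s n (i m) / X t m j" using i[OF m] by (simp add: X_def)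
      then have "norm (W s (i m) n / W t j m) = norm (X s n (i m)) / norm (X t m j)" by (simp add: norm_divide)
      also have "\<dots> \<le> norm (X s n (i m)) / (real L + 1)" using big by (intro frac_le) auto
      finally have "norm (W s (i m) n / W t j m) powr p \<le> (1 / (real L + 1) * norm (X s n (i m))) powr p"
        using p by (intro powr_mono2) auto
      also have "\<dots> = (1 / (real L + 1)) powr p * norm (X s n (i m)) powr p" by (intro powr_mult)
      finally show "norm (W s (i m) n / W t j m) powr p \<le> (1 / (real L + 1)) powr p * norm (X s n (i m)) powr p" .
    qed
    also have "\<dots> = (1 / (real L + 1)) powr p * (\<Sum>i\<in>i ` F. norm (X s n i) powr p)"
      by (subst sum.reindex[OF inj]) (simp add: sum_distrib_left)
    also have "\<dots> \<le> (1 / (real L + 1)) powr p * (1 / (real K + 1)) powr p"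
      using F i by (intro mult_left_mono X_tail n s) auto
    finally show ?thesis by (simp add: i_def)
  qed
  have le1: "(1 / (real L + 1)) powr p \<le> 1" for L using small[of L] order_trans[of _ "1 / (real L + 1)" 1] by simp
  define \<epsilon> where "\<epsilon> k = 1 / (real k + 1)" for k :: nat
  have later: "crosses_later A \<epsilon>"
    unfolding crosses_later_def
  proof (intro allI impI ballI, elim conjE)
    fix j L K n s t and F :: "nat set"
    assume H: "n \<in> A K" "s \<in> {1..N}" "t \<in> {1..N}" "finite F"
      "F \<subseteq> {m \<in> A L - {n}. \<phi> t m j \<in> \<phi> s n ` {K<..}}" "1 \<le> j" "j \<le> L"
    have "(\<Sum>m\<in>F. norm (W s (iter_inv (f s) n (\<phi> t m j)) n / W t j m) powr p)
      \<le> (1 / (real L + 1)) powr p * (1 / (real K + 1)) powr p"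
      using H by (intro cross) auto
    also have "\<dots> \<le> (1 / (real L + 1)) powr p" by (intro mult_left_le le1) simp
    also have "\<dots> \<le> \<epsilon> L" unfolding \<epsilon>_def by (rule small)
    finally show "(\<Sum>m\<in>F. norm (W s (iter_inv (f s) n (\<phi> t m j)) n / W t j m) powr p) \<le> \<epsilon> L" .
  qed
  have earlier: "crosses_earlier A \<epsilon>"
    unfolding crosses_earlier_def
  proof (intro allI impI ballI, elim conjE)
    fix j K L n s t and F :: "nat set"
    assume H: "n \<in> A L" "s \<in> {1..N}" "t \<in> {1..N}" "finite F"
      "F \<subseteq> {m \<in> A K. \<phi> t m j \<in> \<phi> s n ` {L<..}}" "1 \<le> j" "j \<le> K"
    have "(\<Sum>m\<in>F. norm (W s (iter_inv (f s) n (\<phi> t m j)) n / W t j m) powr p)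
      \<le> (1 / (real K + 1)) powr p * (1 / (real L + 1)) powr p"
      using H by (intro cross) auto
    also have "\<dots> \<le> (1 / (real L + 1)) powr p" by (intro mult_left_le_one_le le1) simp_all
    also have "\<dots> \<le> \<epsilon> L" unfolding \<epsilon>_def by (rule small)
    finally show "(\<Sum>m\<in>F. norm (W s (iter_inv (f s) n (\<phi> t m j)) n / W t j m) powr p) \<le> \<epsilon> L" .
  qed
  have ratios: "ratios_dense A"
    unfolding ratios_dense_def
  proof (intro allI impI)
    fix l0 :: nat and a :: "nat \<Rightarrow> nat \<Rightarrow> 'a" and e :: real
    assume l0: "1 \<le> l0" and a: "\<forall>s\<in>{1..N}. \<forall>j\<in>{1..l0}. a s j \<noteq> 0" and e: "0 < e"
    have fin: "finite ({1..N} \<times> {1..l0})" by simp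
    obtain \<mu> where \<mu>: "0 < \<mu>" and "\<And>x. x \<in> {1..N} \<times> {1..l0} \<Longrightarrow> \<mu> \<le> norm (a (fst x) (snd x))"
      by (rule finite_positive_lower_bound[OF fin, where g = "\<lambda>x. norm (a (fst x) (snd x))"]) (use a in auto)
    then have \<mu>a: "\<mu> \<le> norm (a s j)" if "s \<in> {1..N}" "j \<in> {1..l0}" for s j
      using that by (metis SigmaI fst_conv snd_conv)
    define M where "M = (\<Sum>x\<in>{1..N} \<times> {1..l0}. norm (a (fst x) (snd x)))"
    have Ma: "norm (a s j) \<le> M" if "s \<in> {1..N}" "j \<in> {1..l0}" for s j
      using member_le_sum[of "(s, j)" "{1..N} \<times> {1..l0}" "\<lambda>x. norm (a (fst x) (snd x))"] that
      by (simp add: M_def)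
    have M0: "0 \<le> M" unfolding M_def by (intro sum_nonneg) auto
    define D where "D = 2 / \<mu> + 2 * M / \<mu>\<^sup>2"
    have D: "0 < D" unfolding D_def using \<mu> M0 by (intro add_pos_nonneg) auto
    define \<eta> where "\<eta> = min (\<mu> / 2) (e / D)"
    have \<eta>: "0 < \<eta>" "\<eta> \<le> \<mu> / 2" "\<eta> * D \<le> e"
      using \<mu> e D by (auto simp: \<eta>_def min_def field_simps)
    obtain i0 where i0: "\<And>s j. s \<le> N + l0 \<Longrightarrow> j \<le> N + l0 \<Longrightarrow> norm (Q i0 s j - a s j) < \<eta> / 2"
      using Q[of "\<eta> / 2" "N + l0" a] \<eta>(1) by auto
    obtain r0 :: nat where r0: "real r0 \<ge> 2 / \<eta> + 2 / \<mu> + 4 / (e * \<mu>)" using real_arch_simple by blast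
    have r0': "1 / real (Suc r0) \<le> \<eta> / 2" "1 \<le> real (Suc r0) * (\<mu> / 2)" "4 \<le> real (Suc r0) * (e * \<mu>)"
    proof -
      have p3: "0 < 2 / \<eta>" "0 < 2 / \<mu>" "0 < 4 / (e * \<mu>)" using \<eta> \<mu> e by auto
      then have "2 / \<eta> \<le> real (Suc r0)" "2 / \<mu> \<le> real (Suc r0)" "4 / (e * \<mu>) \<le> real (Suc r0)"
        using r0 by linarith+
      then show "1 / real (Suc r0) \<le> \<eta> / 2" "1 \<le> real (Suc r0) * (\<mu> / 2)" "4 \<le> real (Suc r0) * (e * \<mu>)"
        using \<eta>(1) \<mu> e by (simp_all add: field_simps)
    qed
    define L where "L = prod_encode (l0, prod_encode (i0, r0))"
    have L: "l L = l0" "idx L = i0" "r L = real (Suc r0)" by (auto simp: L_def l_def idx_def r_def)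
    define \<Lambda> where "\<Lambda> = r L * (real L + 2)"
    have \<Lambda>: "0 < \<Lambda>" "1 / \<Lambda> \<le> \<eta> / 2"
    proof -
      have "r L * 1 \<le> \<Lambda>" unfolding \<Lambda>_def using r1[of L] by (intro mult_left_mono) auto
      then have "r L \<le> \<Lambda>" by simp
      then show "0 < \<Lambda>" using r1[of L] by linarith
      have "1 / \<Lambda> \<le> 1 / r L" using \<open>r L \<le> \<Lambda>\<close> r1[of L] by (intro frac_le) auto
      then show "1 / \<Lambda> \<le> \<eta> / 2" using r0'(1) L(3) by simp
    qed
    have scaled: "norm (X s n j / of_real \<Lambda> - a s j) \<le> \<eta>"
      if n: "n \<in> A L" and s: "s \<in> {1..N}" and j: "j \<in> {1..l0}" for s n j
    proof -
      have q: "norm (Q i0 s j - a s j) < \<eta> / 2" using s j by (intro i0) auto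
      have "norm (a s j) - norm (Q i0 s j) \<le> norm (Q i0 s j - a s j)"
        by (metis norm_minus_commute norm_triangle_ineq2)
      then have "\<mu> / 2 \<le> norm (Q i0 s j)" using q \<mu>a[OF s j] \<eta>(2) \<mu> by linarith
      then have "real (Suc r0) * (\<mu> / 2) \<le> real (Suc r0) * norm (Q i0 s j)" by (intro mult_left_mono) auto
      then have "1 \<le> r L * norm (Q i0 s j)" unfolding L(3) using r0'(2) by linarith
      then have z: "z L s j = of_real \<Lambda> * Q i0 s j"
        using j L(1,2) by (simp add: z_def \<Lambda>_def)
      have "norm (X s n j - of_real \<Lambda> * Q i0 s j) \<le> 1" using near1'[OF n s, of j] j z by simp
      then have "norm (X s n j - of_real \<Lambda> * Q i0 s j) / \<Lambda> \<le> 1 / \<Lambda>"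
        using \<Lambda>(1) by (intro divide_right_mono) auto
      moreover have "norm (X s n j / of_real \<Lambda> - Q i0 s j) = norm (X s n j - of_real \<Lambda> * Q i0 s j) / \<Lambda>"
      proof -
        have "X s n j / of_real \<Lambda> - Q i0 s j = (X s n j - of_real \<Lambda> * Q i0 s j) / of_real \<Lambda>"
          using \<Lambda>(1) by (simp add: diff_divide_distrib)
        then show ?thesis using \<Lambda>(1) by (simp add: norm_divide)
      qed
      ultimately have "norm (X s n j / of_real \<Lambda> - Q i0 s j) \<le> \<eta> / 2" using \<Lambda>(2) by linarith
      then show ?thesis
        using q norm_triangle_ineq[of "X s n j / of_real \<Lambda> - Q i0 s j" "Q i0 s j - a s j"] by simp
    qed
    have "norm (W s i n / W t j n - (if i \<le> l0 then a s i / a t j else 0)) \<le> e"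
      if s: "s \<in> {1..N}" and t: "t \<in> {1..N}" and n: "n \<in> A L" and i: "1 \<le> i" and j: "j \<in> {1..l0}"
        and eq: "\<phi> s n i = \<phi> t n j" for s t n i j
    proof -
      have v: "norm (X t n j / of_real \<Lambda> - a t j) \<le> \<eta>" by (rule scaled[OF n t j])
      have vbig: "\<mu> / 2 \<le> norm (X t n j / of_real \<Lambda>)"
        by (rule quotient_perturbation(2)[OF v v \<mu>a[OF t j] Ma[OF t j] \<mu> \<eta>(2)])
      have "X t n j \<noteq> 0" using vbig \<mu> by auto
      then have quot: "W s i n / W t j n = X s n i / X t n j"
        using eq by (simp add: X_def)
      show ?thesis
      proof (cases "i \<le> l0")
        case True
        then have i': "i \<in> {1..l0}" using i by simp
        have "norm (X s n i / of_real \<Lambda> / (X t n j / of_real \<Lambda>) - a s i / a t j) \<le> \<eta> * D"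
          unfolding D_def
          by (rule quotient_perturbation(1)[OF scaled[OF n s i'] v \<mu>a[OF t j] Ma[OF s i'] \<mu> \<eta>(2)])
        then show ?thesis using True quot \<Lambda>(1) \<eta>(3) by simp
      next
        case False
        have "norm (z L s i) \<le> real L + 2"
          using False L(1) by (auto simp: z_def simp del: of_real_add)
        then have "norm (X s n i) \<le> real L + 3"
          using near1'[OF n s i] norm_triangle_sub[of "X s n i" "z L s i"] by linarith
        moreover have "real L + 3 \<le> 2 * (real L + 2)" by simp
        ultimately have u: "norm (X s n i) \<le> 2 * (real L + 2)" by (rule order_trans)
        have "\<Lambda> * (\<mu> / 2) \<le> norm (X t n j)"
          using vbig \<Lambda>(1) by (simp add: norm_divide pos_le_divide_eq mult.commute)
        moreover have "2 * (real L + 2) \<le> e * (\<Lambda> * (\<mu> / 2))"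
        proof -
          have "4 * (real L + 2) \<le> real (Suc r0) * (e * \<mu>) * (real L + 2)"
            using r0'(3) by (intro mult_right_mono) auto
          then show ?thesis by (simp add: \<Lambda>_def L(3) algebra_simps)
        qed
        ultimately have "norm (X s n i) \<le> e * norm (X t n j)"
          using u e mult_left_mono[of "\<Lambda> * (\<mu> / 2)" "norm (X t n j)" e] by linarith
        then show ?thesis using False quot \<open>X t n j \<noteq> 0\<close> by (simp add: norm_divide pos_divide_le_eq)
      qed
    qed
    then have "ratios_at (A L) l0 a e" unfolding ratios_at_def by blast
    moreover have "l0 \<le> L" unfolding L_def by (rule le_prod_encode_1)
    ultimately show "\<exists>L\<ge>l0. ratios_at (A L) l0 a e" by blast
  qed
  have "\<epsilon> \<longlonglongrightarrow> 0"
    using LIMSEQ_inverse_real_of_nat by (simp add: \<epsilon>_def[abs_def] inverse_eq_divide add.commute)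
  moreover have "\<forall>k\<ge>1. 0 < \<epsilon> k" by (simp add: \<epsilon>_def)
  ultimately show ?thesis using A later earlier ratios by blast
qed

end

section \<open>Passage to the extended sums, and the characterization\<close>

context pseudo_shifts
begin

lemma common_sites_iff:
  assumes s: "s \<in> {1..N}" and t: "t \<in> {1..N}" and S: "S \<subseteq> {1..}"
  shows "(\<forall>x\<in>\<phi> t n ` {1..l} \<inter> \<phi> s n ` S. P (iter_inv (f s) n x) (iter_inv (f t) n x)) \<longleftrightarrow>
    (\<forall>i\<in>S. \<forall>j\<in>{1..l}. \<phi> s n i = \<phi> t n j \<longrightarrow> P i j)" (is "?L \<longleftrightarrow> ?R")
proof
  assume L: ?L
  show ?R
  proof (intro ballI impI)
    fix i j assume ij: "i \<in> S" "j \<in> {1..l}" "\<phi> s n i = \<phi> t n j"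
    then have "\<phi> s n i \<in> \<phi> t n ` {1..l} \<inter> \<phi> s n ` S" by (metis IntI imageI)
    from bspec[OF L this] show "P i j"
      using iter_inv_iter[OF data[OF s], of i n] iter_inv_iter[OF data[OF t], of j n] ij S by auto
  qed
next
  assume R: ?R
  show ?L
  proof
    fix x assume "x \<in> \<phi> t n ` {1..l} \<inter> \<phi> s n ` S"
    then obtain i j where ij: "i \<in> S" "j \<in> {1..l}" "x = \<phi> s n i" "x = \<phi> t n j" by blast
    then have "iter_inv (f s) n x = i" "iter_inv (f t) n x = j"
      using iter_inv_iter[OF data[OF s], of i n] iter_inv_iter[OF data[OF t], of j n] S by auto
    then show "P (iter_inv (f s) n x) (iter_inv (f t) n x)" using R ij by auto
  qed
qed

lemma ratios_at_iff:
  "ratios_at B l a e \<longleftrightarrow> (\<forall>s\<in>{1..N}. \<forall>t\<in>{1..N}. s \<noteq> t \<longrightarrow> (\<forall>n\<in>B.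
     (\<forall>j \<in> \<phi> t n ` {1..l} \<inter> \<phi> s n ` {1..l}.
        norm (W s (iter_inv (f s) n j) n / W t (iter_inv (f t) n j) n -
              a s (iter_inv (f s) n j) / a t (iter_inv (f t) n j)) \<le> e) \<and>
     (\<forall>j \<in> \<phi> t n ` {1..l} \<inter> \<phi> s n ` {l<..}.
        norm (W s (iter_inv (f s) n j) n) / norm (W t (iter_inv (f t) n j) n) \<le> e)))"
  (is "_ \<longleftrightarrow> ?R")
proof -
  have eq: "(\<forall>i\<ge>1. \<forall>j\<in>{1..l}. \<phi> s n i = \<phi> t n j \<longrightarrow>
       norm (W s i n / W t j n - (if i \<le> l then a s i / a t j else 0)) \<le> e) \<longleftrightarrow>
     (\<forall>j \<in> \<phi> t n ` {1..l} \<inter> \<phi> s n ` {1..l}.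
        norm (W s (iter_inv (f s) n j) n / W t (iter_inv (f t) n j) n -
              a s (iter_inv (f s) n j) / a t (iter_inv (f t) n j)) \<le> e) \<and>
     (\<forall>j \<in> \<phi> t n ` {1..l} \<inter> \<phi> s n ` {l<..}.
        norm (W s (iter_inv (f s) n j) n) / norm (W t (iter_inv (f t) n j) n) \<le> e)"
    if s: "s \<in> {1..N}" and t: "t \<in> {1..N}" for s t n
  proof -
    have near: "(\<forall>j \<in> \<phi> t n ` {1..l} \<inter> \<phi> s n ` {1..l}.
        norm (W s (iter_inv (f s) n j) n / W t (iter_inv (f t) n j) n -
              a s (iter_inv (f s) n j) / a t (iter_inv (f t) n j)) \<le> e) \<longleftrightarrow>
        (\<forall>i\<in>{1..l}. \<forall>j\<in>{1..l}. \<phi> s n i = \<phi> t n j \<longrightarrow> norm (W s i n / W t j n - a s i / a t j) \<le> e)"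
      by (rule common_sites_iff[OF s t, where P = "\<lambda>i j. norm (W s i n / W t j n - a s i / a t j) \<le> e"]) auto
    have far: "(\<forall>j \<in> \<phi> t n ` {1..l} \<inter> \<phi> s n ` {l<..}.
        norm (W s (iter_inv (f s) n j) n) / norm (W t (iter_inv (f t) n j) n) \<le> e) \<longleftrightarrow>
        (\<forall>i\<in>{l<..}. \<forall>j\<in>{1..l}. \<phi> s n i = \<phi> t n j \<longrightarrow> norm (W s i n) / norm (W t j n) \<le> e)"
      by (rule common_sites_iff[OF s t, where P = "\<lambda>i j. norm (W s i n) / norm (W t j n) \<le> e"]) auto
    show ?thesis
      unfolding near far
    proof (intro iffI conjI ballI impI allI)
      fix i j
      assume H: "\<forall>i\<ge>1. \<forall>j\<in>{1..l}. \<phi> s n i = \<phi> t n j \<longrightarrow>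
         norm (W s i n / W t j n - (if i \<le> l then a s i / a t j else 0)) \<le> e"
        and j: "j \<in> {1..l}" and eq: "\<phi> s n i = \<phi> t n j"
      show "norm (W s i n / W t j n - a s i / a t j) \<le> e" if "i \<in> {1..l}"
        using H[rule_format, of i j] j eq that by simp
      show "norm (W s i n) / norm (W t j n) \<le> e" if "i \<in> {l<..}"
        using H[rule_format, of i j] j eq that by (simp add: norm_divide)
    next
      fix i j
      assume H: "(\<forall>i\<in>{1..l}. \<forall>j\<in>{1..l}. \<phi> s n i = \<phi> t n j \<longrightarrow> norm (W s i n / W t j n - a s i / a t j) \<le> e) \<and>
          (\<forall>i\<in>{l<..}. \<forall>j\<in>{1..l}. \<phi> s n i = \<phi> t n j \<longrightarrow> norm (W s i n) / norm (W t j n) \<le> e)"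
        and i: "1 \<le> i" and j: "j \<in> {1..l}" and eq: "\<phi> s n i = \<phi> t n j"
      show "norm (W s i n / W t j n - (if i \<le> l then a s i / a t j else 0)) \<le> e"
      proof (cases "i \<le> l")
        case True
        then show ?thesis using conjunct1[OF H, rule_format, of i j] i j eq by simp
      next
        case False
        then show ?thesis using conjunct2[OF H, rule_format, of i j] j eq by (simp add: norm_divide)
      qed
    qed
  qed
  show ?thesis unfolding ratios_at_def by (intro ball_cong imp_cong refl eq)
qed

lemma crosses_later_iff:
  assumes W_nz: "\<And>s j n. s \<in> {1..N} \<Longrightarrow> 1 \<le> j \<Longrightarrow> W s j n \<noteq> 0"
    and \<epsilon>: "\<And>k. 1 \<le> k \<Longrightarrow> 0 < \<epsilon> k"
  shows "crosses_later A \<epsilon> \<longleftrightarrow> (\<forall>j l k. 1 \<le> j \<and> j \<le> l \<and> 1 \<le> k \<longrightarrow>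
     (\<forall>n\<in>A k. \<forall>s\<in>{1..N}. \<forall>t\<in>{1..N}. s \<noteq> t \<longrightarrow>
       (\<Sum>\<^sub>\<infinity>m\<in>{m \<in> A l - {n}. \<phi> t m j \<in> \<phi> s n ` {k<..}}.
          ennreal (norm (W s (iter_inv (f s) n (\<phi> t m j)) n) powr p) /
          ennreal (norm (W t j m) powr p)) \<le> ennreal (\<epsilon> l)))"
  unfolding crosses_later_def
  by (intro arg_cong[where f = All] ext imp_cong ball_cong refl infsum_ratio_le_iff[symmetric]
      W_nz less_imp_le[OF \<epsilon>]) auto

lemma crosses_earlier_iff:
  assumes W_nz: "\<And>s j n. s \<in> {1..N} \<Longrightarrow> 1 \<le> j \<Longrightarrow> W s j n \<noteq> 0"
    and \<epsilon>: "\<And>k. 1 \<le> k \<Longrightarrow> 0 < \<epsilon> k"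
  shows "crosses_earlier A \<epsilon> \<longleftrightarrow> (\<forall>j k l. 1 \<le> j \<and> j \<le> k \<and> k < l \<longrightarrow>
     (\<forall>n\<in>A l. \<forall>s\<in>{1..N}. \<forall>t\<in>{1..N}. s \<noteq> t \<longrightarrow>
       (\<Sum>\<^sub>\<infinity>m\<in>{m \<in> A k. \<phi> t m j \<in> \<phi> s n ` {l<..}}.
          ennreal (norm (W s (iter_inv (f s) n (\<phi> t m j)) n) powr p) /
          ennreal (norm (W t j m) powr p)) \<le> ennreal (\<epsilon> l)))"
  unfolding crosses_earlier_def
  by (intro arg_cong[where f = All] ext imp_cong ball_cong refl infsum_ratio_le_iff[symmetric]
      W_nz less_imp_le[OF \<epsilon>]) auto

lemma summable_weights_iff:
  "(\<forall>j\<ge>1. \<forall>s\<in>{1..N}. (\<Sum>\<^sub>\<infinity>n\<in>{1..}. 1 / ennreal (norm (W s j n) powr p)) < \<infinity>) \<longleftrightarrow>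
   (\<forall>j\<ge>1. \<forall>s\<in>{1..N}. (\<forall>n. W s j n \<noteq> 0) \<and> summable (\<lambda>n. norm (1 / W s j n) powr p))"
proof -
  have "(\<forall>n\<ge>1. W s j n \<noteq> 0) \<longleftrightarrow> (\<forall>n. W s j n \<noteq> 0)" for s j
    by (metis less_one linorder_not_less weight_prod_0 zero_neq_one)
  then show ?thesis by (simp only: infsum_inverse_finite_iff)
qed

end

theorem theorem2p5:
  fixes N :: nat and p :: real
    and f :: "nat \<Rightarrow> nat \<Rightarrow> nat"
    and w :: "nat \<Rightarrow> nat \<Rightarrow> 'a::{real_normed_field, euclidean_space}"
    and \<A> :: "nat set set"
    and W :: "nat \<Rightarrow> nat \<Rightarrow> nat \<Rightarrow> 'a"
  assumes "N \<ge> 2" and "1 \<le> p"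
    and "\<And>s. s \<in> {1..N} \<Longrightarrow> pseudo_shift_data (f s) (w s)"
    and "\<A> \<in> {fam_uBd, fam_ud, fam_ld}"
    and "weakly_partition_regular \<A> N f"
    and W_def: "W = (\<lambda>s l n. weight_prod (f s) (w s) l n)"
  shows "disjoint_hypercyclic (lp_topology p) \<A> N (\<lambda>s. pseudo_shift (f s) (w s)) \<longleftrightarrow>
    (\<exists>(A :: nat \<Rightarrow> nat set) (\<epsilon> :: nat \<Rightarrow> real).
       (\<forall>k\<ge>1. A k \<in> \<A>) \<and> (\<forall>k\<ge>1. \<epsilon> k > 0) \<and> \<epsilon> \<longlonglongrightarrow> 0 \<and>
       (\<forall>j\<ge>1. \<forall>s\<in>{1..N}.
          (\<Sum>\<^sub>\<infinity>n\<in>{1..}. 1 / ennreal (norm (W s j n) powr p)) < \<infinity>) \<and>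
       (\<forall>j l k. 1 \<le> j \<and> j \<le> l \<and> 1 \<le> k \<longrightarrow>
          (\<forall>n\<in>A k. \<forall>s\<in>{1..N}. \<forall>t\<in>{1..N}. s \<noteq> t \<longrightarrow>
             (\<Sum>\<^sub>\<infinity>m\<in>{m \<in> A l - {n}. (f t ^^ m) j \<in> (f s ^^ n) ` {k<..}}.
                ennreal (norm (W s (iter_inv (f s) n ((f t ^^ m) j)) n) powr p) /
                ennreal (norm (W t j m) powr p)) \<le> ennreal (\<epsilon> l))) \<and>
       (\<forall>j k l. 1 \<le> j \<and> j \<le> k \<and> k < l \<longrightarrow>
          (\<forall>n\<in>A l. \<forall>s\<in>{1..N}. \<forall>t\<in>{1..N}. s \<noteq> t \<longrightarrow>
             (\<Sum>\<^sub>\<infinity>m\<in>{m \<in> A k. (f t ^^ m) j \<in> (f s ^^ n) ` {l<..}}.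
                ennreal (norm (W s (iter_inv (f s) n ((f t ^^ m) j)) n) powr p) /
                ennreal (norm (W t j m) powr p)) \<le> ennreal (\<epsilon> l))) \<and>
       (\<forall>l\<ge>1. \<forall>a :: nat \<Rightarrow> nat \<Rightarrow> 'a. (\<forall>s\<in>{1..N}. \<forall>j\<in>{1..l}. a s j \<noteq> 0) \<longrightarrow>
          (\<forall>e>0. \<exists>L\<ge>l. \<forall>s\<in>{1..N}. \<forall>t\<in>{1..N}. s \<noteq> t \<longrightarrow> (\<forall>n\<in>A L.
             (\<forall>j \<in> (f t ^^ n) ` {1..l} \<inter> (f s ^^ n) ` {1..l}.
                norm (W s (iter_inv (f s) n j) n / W t (iter_inv (f t) n j) n -
                      a s (iter_inv (f s) n j) / a t (iter_inv (f t) n j)) \<le> e) \<and>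
             (\<forall>j \<in> (f t ^^ n) ` {1..l} \<inter> (f s ^^ n) ` {l<..}.
                norm (W s (iter_inv (f s) n j) n) / norm (W t (iter_inv (f t) n j) n) \<le> e)))))"
proof -
  interpret pseudo_shifts N p f w
    by unfold_locales (use assms(2,3) in auto)
  define Good where "Good A \<epsilon> \<longleftrightarrow>
      (\<forall>j\<ge>1. \<forall>s\<in>{1..N}. (\<forall>n. W s j n \<noteq> 0) \<and> summable (\<lambda>n. norm (1 / W s j n) powr p)) \<and>
      crosses_later A \<epsilon> \<and> crosses_earlier A \<epsilon> \<and> ratios_dense A" for A \<epsilon>
  have main: "disjoint_hypercyclic (lp_topology p) \<A> N (\<lambda>s. pseudo_shift (f s) (w s)) \<longleftrightarrow>
    (\<exists>A \<epsilon>. (\<forall>k\<ge>1. A k \<in> \<A>) \<and> (\<forall>k\<ge>1. \<epsilon> k > 0) \<and> \<epsilon> \<longlonglongrightarrow> 0 \<and> Good A \<epsilon>)" (is "?H \<longleftrightarrow> ?G")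
  proof
    assume H: ?H
    show ?G
      using conditions_if_disjoint_hypercyclic[OF H]
        weights_if_disjoint_hypercyclic[OF assms(4) H]
      unfolding Good_def W_def by blast
  next
    assume ?G
    then obtain A \<epsilon> where "\<forall>k\<ge>1. A k \<in> \<A>" "\<forall>k\<ge>1. \<epsilon> k > 0" "\<epsilon> \<longlonglongrightarrow> 0" "Good A \<epsilon>" by blast
    then show ?H
      using assms(1) unfolding Good_def W_def
      by (intro disjoint_hypercyclic_if[OF _ assms(4,5), of A \<epsilon>]) auto
  qed
  show ?thesis
    unfolding main
  proof (intro arg_cong[where f = Ex] ext conj_cong refl, goal_cases)
    case (1 A \<epsilon>)
    show ?case
      unfolding Good_def W_def
    proof (intro conj_cong, goal_cases)
      case 1
      show ?case by (rule summable_weights_iff[symmetric])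
    next
      case 2
      then have "weight_prod (f s) (w s) j n \<noteq> 0" if "s \<in> {1..N}" "1 \<le> j" for s j n
        using that unfolding summable_weights_iff by blast
      then show ?case using \<open>\<forall>k\<ge>1. 0 < \<epsilon> k\<close> by (intro crosses_later_iff) auto
    next
      case 3
      then have "weight_prod (f s) (w s) j n \<noteq> 0" if "s \<in> {1..N}" "1 \<le> j" for s j n
        using that unfolding summable_weights_iff by blast
      then show ?case using \<open>\<forall>k\<ge>1. 0 < \<epsilon> k\<close> by (intro crosses_earlier_iff) auto
    next
      case 4
      show ?case unfolding ratios_dense_def ratios_at_iff by (rule refl)
    qed
  qed
qed

end
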